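(* Let $X$ be a simplicial complex on $[n]$ with Stanley-Reisner ring $A_X$. The localization maps $$T^i_{A_X,0}\;\longrightarrow\;\bigoplus_{v\in[n]}T^i_{D_+(x_v)}$$ are injective for $i=1,2$.
   Context: Let $[n]=\{0,\dots,n\}$ and $P=\mathbb C[x_0,\dots,x_n]$. A simplicial complex $X$ on $[n]$ is a family of subsets of $[n]$ closed under taking subsets, with $\emptyset\in X$ (elements of $[n]$ need not be vertices of $X$). Put $I_X=\langle \mathbf x^p : p\subseteq[n],\,p\notin X\rangle$, where $\mathbf x^p=\prod_{i\in p}x_i$, and $A_X=P/I_X$; $\mathbb P(X)=\mathrm{Proj}\,A_X$. For $A=P/I$: $T^1_A$ is the cokernel of the natural map $\mathrm{Der}_{\mathbb C}(P,P)\to\mathrm{Hom}_P(I,A)$. If $0\to R\to P^m\xrightarrow{j}P\to A\to0$ is exact and $R_0=\langle j(f)e-j(e)f : e,f\in P^m\rangle\subseteq R$, then $T^2_A$ is the cokernel of the induced map $\mathrm{Hom}_P(P^m,A)\to\mathrm{Hom}_A(R/R_0,A)$. $T^i_{A_X,0}$ denotes the degree $0$ part of $T^i_{A_X}$ with respect to the usual $\mathbb Z$-grading ($\deg x_i=1$). For $v\in[n]$, $D_+(x_v)\subseteq\mathbb P(X)$ is the standard affine chart $\{x_v\ne 0\}$; its coordinate ring is $((A_X)_{x_v})_0\cong A_{\mathrm{lk}(v,X)}$, where $\mathrm{lk}(v,X)=\{g\in X : v\notin g,\ g\cup\{v\}\in X\}$ (if $\{v\}\notin X$ the chart is empty and contributes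 $0$). $T^i_{D_+(x_v)}$ denotes $T^i$ of this coordinate ring. The localization map $T^i_{A_X,0}\to T^i_{D_+(x_v)}$ is obtained by dehomogenizing with respect to $x_v$ (setting $x_v=1$), i.e. it is the degree $0$ part of $T^i_{A_X}\to T^i_{A_X}\otimes_{A_X}(A_X)_{x_v}=T^i_{(A_X)_{x_v}}$, combined with $(A_X)_{x_v}\cong A_{\mathrm{lk}(v,X)}[x_v^{\pm1}]$ and the resulting identification of the degree $0$ part of $T^i_{(A_X)_{x_v}}$ with $T^i_{A_{\mathrm{lk}(v,X)}}$. *)

theory Defs
  imports
    Complex_Main
    "HOL-Library.Poly_Mapping"
    "HOL-Algebra.QuotRing"
    "HOL-Algebra.Module"
    "HOL-Algebra.Product_Groups"
begin

section \<open>Modules, homomorphisms and derivations\<close>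

text \<open>In the module records below only the additive structure and \<open>smult\<close> matter; the fields
  \<open>mult\<close> and \<open>one\<close>, which HOL-Algebra's module record inherits from rings, are irrelevant.\<close>

definition ideal_module :: "('a, 'b) ring_scheme \<Rightarrow> 'a set \<Rightarrow> ('a, 'a) module" where
  "ideal_module R I =
    \<lparr>carrier = I, mult = (\<otimes>\<^bsub>R\<^esub>), one = \<one>\<^bsub>R\<^esub>, zero = \<zero>\<^bsub>R\<^esub>, add = (\<oplus>\<^bsub>R\<^esub>), smult = (\<otimes>\<^bsub>R\<^esub>)\<rparr>"

abbreviation regular_module :: "('a, 'b) ring_scheme \<Rightarrow> ('a, 'a) module" where
  "regular_module R \<equiv> ideal_module R (carrier R)"

definition quot_as_module :: "('a, 'b) ring_scheme \<Rightarrow> 'a set \<Rightarrow> ('a, 'a set) module" where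
  "quot_as_module R I =
    \<lparr>carrier = carrier (R Quot I), mult = (\<otimes>\<^bsub>R Quot I\<^esub>), one = \<one>\<^bsub>R Quot I\<^esub>,
     zero = \<zero>\<^bsub>R Quot I\<^esub>, add = (\<oplus>\<^bsub>R Quot I\<^esub>),
     smult = (\<lambda>f a. (I +>\<^bsub>R\<^esub> f) \<otimes>\<^bsub>R Quot I\<^esub> a)\<rparr>"

definition free_module :: "('a, 'b) ring_scheme \<Rightarrow> nat \<Rightarrow> ('a, nat \<Rightarrow> 'a) module" where
  "free_module R m =
    \<lparr>carrier = {..<m} \<rightarrow>\<^sub>E carrier R, mult = undefined, one = undefined,
     zero = (\<lambda>k\<in>{..<m}. \<zero>\<^bsub>R\<^esub>),
     add = (\<lambda>x y. \<lambda>k\<in>{..<m}. x k \<oplus>\<^bsub>R\<^esub> y k),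
     smult = (\<lambda>a x. \<lambda>k\<in>{..<m}. a \<otimes>\<^bsub>R\<^esub> x k)\<rparr>"

definition module_homs ::
    "('r, 's) ring_scheme \<Rightarrow> ('r, 'a) module \<Rightarrow> ('r, 'b) module \<Rightarrow> ('a \<Rightarrow> 'b) set" where
  "module_homs R M N =
    {h \<in> carrier M \<rightarrow>\<^sub>E carrier N.
       (\<forall>x\<in>carrier M. \<forall>y\<in>carrier M. h (x \<oplus>\<^bsub>M\<^esub> y) = h x \<oplus>\<^bsub>N\<^esub> h y) \<and>
       (\<forall>r\<in>carrier R. \<forall>x\<in>carrier M. h (r \<odot>\<^bsub>M\<^esub> x) = r \<odot>\<^bsub>N\<^esub> h x)}"

definition Hom_module ::
    "('r, 's) ring_scheme \<Rightarrow> ('r, 'a) module \<Rightarrow> ('r, 'b) module \<Rightarrow> ('r, 'a \<Rightarrow> 'b) module" where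
  "Hom_module R M N =
    \<lparr>carrier = module_homs R M N, mult = undefined, one = undefined,
     zero = (\<lambda>x\<in>carrier M. \<zero>\<^bsub>N\<^esub>),
     add = (\<lambda>h h'. \<lambda>x\<in>carrier M. h x \<oplus>\<^bsub>N\<^esub> h' x),
     smult = (\<lambda>r h. \<lambda>x\<in>carrier M. r \<odot>\<^bsub>N\<^esub> h x)\<rparr>"

definition Der :: "'a set \<Rightarrow> ('a, 'b) ring_scheme \<Rightarrow> ('a \<Rightarrow> 'a) set" where
  "Der K R =
    {D \<in> carrier R \<rightarrow>\<^sub>E carrier R.
       (\<forall>f\<in>carrier R. \<forall>g\<in>carrier R. D (f \<oplus>\<^bsub>R\<^esub> g) = D f \<oplus>\<^bsub>R\<^esub> D g) \<and>
       (\<forall>c\<in>K. \<forall>f\<in>carrier R. D (c \<otimes>\<^bsub>R\<^esub> f) = c \<otimes>\<^bsub>R\<^esub> D f) \<and>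
       (\<forall>f\<in>carrier R. \<forall>g\<in>carrier R.
          D (f \<otimes>\<^bsub>R\<^esub> g) = (f \<otimes>\<^bsub>R\<^esub> D g) \<oplus>\<^bsub>R\<^esub> (g \<otimes>\<^bsub>R\<^esub> D f))}"


section \<open>The first cotangent module\<close>

text \<open>For a polynomial ring \<open>R\<close> over the subfield \<open>K\<close> and an ideal \<open>I\<close>, with \<open>A = R/I\<close>.\<close>

definition T1_Hom :: "('a, 'b) ring_scheme \<Rightarrow> 'a set \<Rightarrow> ('a, 'a \<Rightarrow> 'a set) module" where
  "T1_Hom R I = Hom_module R (ideal_module R I) (quot_as_module R I)"

definition T1_bounds :: "'a set \<Rightarrow> ('a, 'b) ring_scheme \<Rightarrow> 'a set \<Rightarrow> ('a \<Rightarrow> 'a set) set" where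
  "T1_bounds K R I = (\<lambda>D. \<lambda>f\<in>I. I +>\<^bsub>R\<^esub> D f) ` Der K R"

definition T1 :: "'a set \<Rightarrow> ('a, 'b) ring_scheme \<Rightarrow> 'a set \<Rightarrow> ('a \<Rightarrow> 'a set) set monoid" where
  "T1 K R I = T1_Hom R I A_Mod T1_bounds K R I"


section \<open>The second cotangent module\<close>

text \<open>A family \<open>g\<^sub>0, \<dots>, g\<^sub>m\<^sub>-\<^sub>1\<close> in \<open>R\<close> gives the map \<open>j\<close> from \<open>R\<^sup>m\<close> to \<open>R\<close> taking the \<open>k\<close>-th
  basis vector to \<open>g\<^sub>k\<close>.\<close>

definition gen_map :: "('a, 'b) ring_scheme \<Rightarrow> nat \<Rightarrow> (nat \<Rightarrow> 'a) \<Rightarrow> (nat \<Rightarrow> 'a) \<Rightarrow> 'a" where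
  "gen_map R m g e = (\<Oplus>\<^bsub>R\<^esub>k\<in>{..<m}. e k \<otimes>\<^bsub>R\<^esub> g k)"

definition presents :: "('a, 'b) ring_scheme \<Rightarrow> 'a set \<Rightarrow> nat \<Rightarrow> (nat \<Rightarrow> 'a) \<Rightarrow> bool" where
  "presents R I m g \<longleftrightarrow>
     g ` {..<m} \<subseteq> carrier R \<and> gen_map R m g ` carrier (free_module R m) = I"

definition relations :: "('a, 'b) ring_scheme \<Rightarrow> nat \<Rightarrow> (nat \<Rightarrow> 'a) \<Rightarrow> ('a, nat \<Rightarrow> 'a) module" where
  "relations R m g =
    (free_module R m)\<lparr>carrier := {e \<in> carrier (free_module R m). gen_map R m g e = \<zero>\<^bsub>R\<^esub>}\<rparr>"

definition Koszul_relations :: "('a, 'b) ring_scheme \<Rightarrow> nat \<Rightarrow> (nat \<Rightarrow> 'a) \<Rightarrow> (nat \<Rightarrow> 'a) set" where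
  "Koszul_relations R m g =
    \<Inter>{N. submodule N R (free_module R m) \<and>
        {(gen_map R m g f \<odot>\<^bsub>free_module R m\<^esub> e) \<ominus>\<^bsub>free_module R m\<^esub> (gen_map R m g e \<odot>\<^bsub>free_module R m\<^esub> f)
          | e f. e \<in> carrier (free_module R m) \<and> f \<in> carrier (free_module R m)} \<subseteq> N}"

text \<open>The quotient of the relations by the Koszul relations, as a module over \<open>R/I\<close>.\<close>

definition rel_quot ::
    "('a, 'b) ring_scheme \<Rightarrow> nat \<Rightarrow> (nat \<Rightarrow> 'a) \<Rightarrow> ('a set, (nat \<Rightarrow> 'a) set) module" where
  "rel_quot R m g =
    \<lparr>carrier = a_rcosets\<^bsub>relations R m g\<^esub> (Koszul_relations R m g),
     mult = undefined, one = undefined,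
     zero = Koszul_relations R m g,
     add = set_add (relations R m g),
     smult = (\<lambda>a C. \<Union>f\<in>a. \<Union>r\<in>C. Koszul_relations R m g +>\<^bsub>relations R m g\<^esub> (f \<odot>\<^bsub>relations R m g\<^esub> r))\<rparr>"

definition T2_Hom ::
    "('a, 'b) ring_scheme \<Rightarrow> 'a set \<Rightarrow> nat \<Rightarrow> (nat \<Rightarrow> 'a) \<Rightarrow> ('a set, (nat \<Rightarrow> 'a) set \<Rightarrow> 'a set) module" where
  "T2_Hom R I m g = Hom_module (R Quot I) (rel_quot R m g) (regular_module (R Quot I))"

text \<open>A homomorphism from \<open>R\<^sup>m\<close> to \<open>R/I\<close> is constant on the cosets of the Koszul relations;
  \<open>the_elem\<close> extracts this value.\<close>

definition T2_bounds ::
    "('a, 'b) ring_scheme \<Rightarrow> 'a set \<Rightarrow> nat \<Rightarrow> (nat \<Rightarrow> 'a) \<Rightarrow> ((nat \<Rightarrow> 'a) set \<Rightarrow> 'a set) set" where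
  "T2_bounds R I m g =
    (\<lambda>h. \<lambda>C\<in>carrier (rel_quot R m g). the_elem (h ` C)) `
      module_homs R (free_module R m) (quot_as_module R I)"

definition T2 ::
    "('a, 'b) ring_scheme \<Rightarrow> 'a set \<Rightarrow> nat \<Rightarrow> (nat \<Rightarrow> 'a) \<Rightarrow> ((nat \<Rightarrow> 'a) set \<Rightarrow> 'a set) set monoid" where
  "T2 R I m g = T2_Hom R I m g A_Mod T2_bounds R I m g"


section \<open>Complex polynomials in a set of variables\<close>

type_synonym cpoly = "(nat \<Rightarrow>\<^sub>0 nat) \<Rightarrow>\<^sub>0 complex"

definition var :: "nat \<Rightarrow> cpoly" where
  "var i = Poly_Mapping.single (Poly_Mapping.single i 1) 1"

definition constants :: "cpoly set" where
  "constants = {Poly_Mapping.single 0 c | c. True}"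

definition poly_ring :: "nat set \<Rightarrow> cpoly ring" where
  "poly_ring V =
    \<lparr>carrier = {f. \<forall>t\<in>Poly_Mapping.keys f. Poly_Mapping.keys t \<subseteq> V},
     mult = (*), one = 1, zero = 0, add = (+)\<rparr>"

definition homogeneous :: "nat \<Rightarrow> cpoly \<Rightarrow> bool" where
  "homogeneous d f \<longleftrightarrow>
     (\<forall>t\<in>Poly_Mapping.keys f. (\<Sum>i\<in>Poly_Mapping.keys t. Poly_Mapping.lookup t i) = d)"

text \<open>Homogeneous elements of \<open>R\<^sup>m\<close>, where the \<open>k\<close>-th basis vector has degree \<open>d k\<close>.\<close>

definition homogeneous_vec :: "nat \<Rightarrow> (nat \<Rightarrow> nat) \<Rightarrow> nat \<Rightarrow> (nat \<Rightarrow> cpoly) \<Rightarrow> bool" where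
  "homogeneous_vec m d c e \<longleftrightarrow>
     (\<forall>k<m. \<forall>t\<in>Poly_Mapping.keys (e k).
        (\<Sum>i\<in>Poly_Mapping.keys t. Poly_Mapping.lookup t i) + d k = c)"

definition quot_homogeneous :: "nat set \<Rightarrow> cpoly set \<Rightarrow> nat \<Rightarrow> cpoly set \<Rightarrow> bool" where
  "quot_homogeneous V I c a \<longleftrightarrow>
     (\<exists>f\<in>carrier (poly_ring V). homogeneous c f \<and> a = I +>\<^bsub>poly_ring V\<^esub> f)"

text \<open>The degree 0 part of a cokernel consists of the classes of the degree 0 homomorphisms.\<close>

definition T1_deg0 :: "nat set \<Rightarrow> cpoly set \<Rightarrow> (cpoly \<Rightarrow> cpoly set) set monoid" where
  "T1_deg0 V I = (T1 constants (poly_ring V) I)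
    \<lparr>carrier := {T1_bounds constants (poly_ring V) I +>\<^bsub>T1_Hom (poly_ring V) I\<^esub> \<phi> | \<phi>.
       \<phi> \<in> carrier (T1_Hom (poly_ring V) I) \<and>
       (\<forall>c. \<forall>f\<in>I. homogeneous c f \<longrightarrow> quot_homogeneous V I c (\<phi> f))}\<rparr>"

definition T2_deg0 :: "nat set \<Rightarrow> cpoly set \<Rightarrow> nat \<Rightarrow> (nat \<Rightarrow> cpoly) \<Rightarrow> (nat \<Rightarrow> nat) \<Rightarrow>
    ((nat \<Rightarrow> cpoly) set \<Rightarrow> cpoly set) set monoid" where
  "T2_deg0 V I m g d = (T2 (poly_ring V) I m g)
    \<lparr>carrier := {T2_bounds (poly_ring V) I m g +>\<^bsub>T2_Hom (poly_ring V) I m g\<^esub> \<psi> | \<psi>.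
       \<psi> \<in> carrier (T2_Hom (poly_ring V) I m g) \<and>
       (\<forall>c. \<forall>r\<in>carrier (relations (poly_ring V) m g). homogeneous_vec m d c r \<longrightarrow>
          quot_homogeneous V I c
            (\<psi> (Koszul_relations (poly_ring V) m g +>\<^bsub>relations (poly_ring V) m g\<^esub> r)))}\<rparr>"


section \<open>Stanley-Reisner ideals\<close>

definition simplicial_complex :: "nat set \<Rightarrow> nat set set \<Rightarrow> bool" where
  "simplicial_complex V X \<longleftrightarrow>
     X \<subseteq> Pow V \<and> {} \<in> X \<and> (\<forall>f\<in>X. \<forall>g. g \<subseteq> f \<longrightarrow> g \<in> X)"

definition link :: "nat \<Rightarrow> nat set set \<Rightarrow> nat set set" where
  "link v X = {g \<in> X. v \<notin> g \<and> g \<union> {v} \<in> X}"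

definition SR_ideal :: "nat set \<Rightarrow> nat set set \<Rightarrow> cpoly set" where
  "SR_ideal V X = Idl\<^bsub>poly_ring V\<^esub> {\<Prod>i\<in>p. var i | p. p \<subseteq> V \<and> p \<notin> X}"


section \<open>Localization\<close>

text \<open>Substituting 1 for the variable \<open>v\<close>: a surjective ring homomorphism from \<open>poly_ring V\<close> onto
  \<open>poly_ring (V - {v})\<close>.\<close>

definition dehom :: "nat \<Rightarrow> cpoly \<Rightarrow> cpoly" where
  "dehom v f =
    (\<Sum>t\<in>Poly_Mapping.keys f. Poly_Mapping.single (Poly_Mapping.update v 0 t) (Poly_Mapping.lookup f t))"

definition dehom_vec :: "nat \<Rightarrow> nat \<Rightarrow> (nat \<Rightarrow> cpoly) \<Rightarrow> (nat \<Rightarrow> cpoly)" where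
  "dehom_vec m v e = (\<lambda>k\<in>{..<m}. dehom v (e k))"

text \<open>Dehomogenization carries the Stanley-Reisner ideal \<open>I\<close> of \<open>X\<close> onto the Stanley-Reisner ideal
  \<open>J\<close> of the link of \<open>v\<close>, the image \<open>dehom v ` a\<close> of a coset \<open>a\<close> of \<open>I\<close> is a coset of \<open>J\<close>, and
  \<open>a \<mapsto> dehom v ` a\<close> is the map of quotient rings given by \<open>x\<^sub>v \<mapsto> 1\<close>. On homomorphisms, the induced
  \<open>\<phi>'\<close> is determined by \<open>\<phi>' (dehom v F) = dehom v ` \<phi> F\<close>: the value at \<open>f\<close> is the common value of
  \<open>dehom v ` \<phi> F\<close> over all \<open>F\<close> that dehomogenize to \<open>f\<close>.\<close>

definition T1_loc_hom ::
    "nat \<Rightarrow> cpoly set \<Rightarrow> cpoly set \<Rightarrow> (cpoly \<Rightarrow> cpoly set) \<Rightarrow> (cpoly \<Rightarrow> cpoly set)" where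
  "T1_loc_hom v I J \<phi> =
    (\<lambda>f\<in>J. the_elem ((\<lambda>F. dehom v ` \<phi> F) ` {F \<in> I. dehom v F = f}))"

definition T1_loc :: "nat set \<Rightarrow> nat set set \<Rightarrow> nat \<Rightarrow>
    (cpoly \<Rightarrow> cpoly set) set \<Rightarrow> (cpoly \<Rightarrow> cpoly set) set" where
  "T1_loc V X v t =
    (let W = V - {v}; I = SR_ideal V X; J = SR_ideal W (link v X)
     in the_elem ((\<lambda>\<phi>. T1_bounds constants (poly_ring W) J +>\<^bsub>T1_Hom (poly_ring W) J\<^esub>
                         T1_loc_hom v I J \<phi>) ` t))"

definition T1_chart :: "nat set \<Rightarrow> nat set set \<Rightarrow> nat \<Rightarrow> (cpoly \<Rightarrow> cpoly set) set monoid" where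
  "T1_chart V X v = T1 constants (poly_ring (V - {v})) (SR_ideal (V - {v}) (link v X))"

text \<open>If the family \<open>g\<close> generates the ideal of \<open>X\<close>, then the dehomogenized family generates that of
  the link; the second cotangent module of the chart is computed with this presentation.
  Dehomogenization takes relations onto relations and Koszul relations onto Koszul relations, hence
  cosets of the latter onto cosets of the latter.\<close>

definition T2_loc_hom :: "nat set \<Rightarrow> nat \<Rightarrow> nat \<Rightarrow> (nat \<Rightarrow> cpoly) \<Rightarrow>
    ((nat \<Rightarrow> cpoly) set \<Rightarrow> cpoly set) \<Rightarrow> ((nat \<Rightarrow> cpoly) set \<Rightarrow> cpoly set)" where
  "T2_loc_hom V v m g \<psi> =
    (\<lambda>C\<in>carrier (rel_quot (poly_ring (V - {v})) m (dehom_vec m v g)).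
       the_elem ((\<lambda>B. dehom v ` \<psi> B) `
         {B \<in> carrier (rel_quot (poly_ring V) m g). dehom_vec m v ` B = C}))"

definition T2_loc :: "nat set \<Rightarrow> nat set set \<Rightarrow> nat \<Rightarrow> (nat \<Rightarrow> cpoly) \<Rightarrow> nat \<Rightarrow>
    ((nat \<Rightarrow> cpoly) set \<Rightarrow> cpoly set) set \<Rightarrow> ((nat \<Rightarrow> cpoly) set \<Rightarrow> cpoly set) set" where
  "T2_loc V X m g v t =
    (let W = V - {v}; J = SR_ideal W (link v X); g' = dehom_vec m v g
     in the_elem ((\<lambda>\<psi>. T2_bounds (poly_ring W) J m g' +>\<^bsub>T2_Hom (poly_ring W) J m g'\<^esub>
                         T2_loc_hom V v m g \<psi>) ` t))"

definition T2_chart :: "nat set \<Rightarrow> nat set set \<Rightarrow> nat \<Rightarrow> (nat \<Rightarrow> cpoly) \<Rightarrow> nat \<Rightarrow>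
    ((nat \<Rightarrow> cpoly) set \<Rightarrow> cpoly set) set monoid" where
  "T2_chart V X m g v =
    T2 (poly_ring (V - {v})) (SR_ideal (V - {v}) (link v X)) m (dehom_vec m v g)"

end

theory Submission
  imports Defs
begin

text \<open>A homomorphism of degree 0 into \<open>A = P/I\<close> sends a monomial \<open>x\<^sup>u\<close> of \<open>I\<close> to a combination of
  monomials \<open>x\<^sup>w\<close> of the same total degree whose support is a face of \<open>X\<close>. The support of \<open>u\<close> is not
  a face, so \<open>w \<noteq> u\<close>, and equality of the degrees forces some variable \<open>x\<^sub>v\<close> to occur in \<open>w\<close> with a
  larger exponent than in \<open>u\<close> (\<open>exponent_exceeds\<close>). In the chart \<open>x\<^sub>v \<noteq> 0\<close> this coefficient is still
  visible: the total degree recovers the exponent of \<open>x\<^sub>v\<close> that was dropped, and the support of \<open>w\<close>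
  without \<open>v\<close> is a face of the link (\<open>lookup_local\<close>). Hence an element of degree 0 is determined by
  its images in the charts, one coefficient at a time, and it remains to assemble trivializations
  over the charts into a global one.

  For the first cotangent module, let the homomorphism agree in each chart \<open>v\<close> with a derivation
  \<open>D\<^sub>v\<close>. At \<open>w\<close> only terms \<open>u\<^sub>i x\<^sup>w\<close> with \<open>w = u - e\<^sub>i + e\<^sub>v\<close> are possible, with the constant term of
  \<open>D\<^sub>v(x\<^sub>i)\<close> as coefficient. So the homomorphism is induced by the derivation
  \<open>\<Sum> a\<^sub>i\<^sub>j x\<^sub>j \<partial>\<^sub>i\<close>, where \<open>a\<^sub>i\<^sub>j\<close> is the constant term of \<open>D\<^sub>j(x\<^sub>i)\<close> for \<open>i \<noteq> j\<close>
  (\<open>glue_derivations\<close>).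

  For the second cotangent module, a homomorphism \<open>\<psi>\<close> on the relations \<open>R\<close> has to be extended to \<open>P\<^sup>m\<close>.
  Choose homogeneous preimages in \<open>P\<^sup>m\<close> of the monomials of \<open>I\<close>; they give a linear section \<open>\<beta>\<close> of
  \<open>P\<^sup>m \<rightarrow> I\<close>, and \<open>\<psi>\<close> extends as soon as there is a linear map \<open>b : I \<rightarrow> A\<close> with
  \<open>\<psi>(\<beta>(p f) - p \<beta>(f)) = b(p f) - p b(f)\<close>. The coefficient of \<open>b(x\<^sup>u)\<close> at \<open>w\<close> is taken from the
  local extension in a chart \<open>v\<close> with \<open>w\<^sub>v > u\<^sub>v\<close>. This choice depends only on \<open>w - u\<close>, so it is not
  disturbed by multiplication with monomials, and the required equation may be checked in that
  chart (\<open>cochain_monomial\<close>, \<open>glue_extensions\<close>).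

  The remaining parts relate the cosets that make up the cotangent modules to polynomials. The
  localization maps are well defined because the kernel of dehomogenization is generated by
  \<open>x\<^sub>v - 1\<close> (\<open>dehom_kernel\<close>), and because relations over the chart can be homogenized
  (\<open>Rel_lift\<close>).\<close>

section \<open>Polynomials as combinations of monomials\<close>

abbreviation "keys \<equiv> Poly_Mapping.keys"
abbreviation "lookup \<equiv> Poly_Mapping.lookup"
abbreviation "single \<equiv> Poly_Mapping.single"

lemma sum_monomials:
  fixes f :: cpoly
  shows "(\<Sum>t\<in>keys f. single t (lookup f t)) = f"
proof (rule poly_mapping_eqI)
  fix w
  have "(\<Sum>t\<in>keys f. lookup (single t (lookup f t)) w)
      = (\<Sum>t\<in>keys f. if t = w then lookup f w else 0)"
    by (rule sum.cong) (auto simp: lookup_single)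
  also have "\<dots> = lookup f w"
    by (simp add: in_keys_iff)
  finally show "lookup (\<Sum>t\<in>keys f. single t (lookup f t)) w
      = lookup f w"
    by (simp add: lookup_sum)
qed

lemma monomial_induct [consumes 1, case_names zero single add]:
  fixes f :: cpoly
  assumes "keys f \<subseteq> T"
    and z: "P 0"
    and s: "\<And>t c. t \<in> T \<Longrightarrow> P (single t c)"
    and a: "\<And>f g. keys f \<subseteq> T \<Longrightarrow> keys g \<subseteq> T \<Longrightarrow> P f \<Longrightarrow> P g \<Longrightarrow> P (f + g)"
  shows "P f"
proof -
  have "keys (\<Sum>t\<in>S. single t (lookup f t)) \<subseteq> T \<and>
      P (\<Sum>t\<in>S. single t (lookup f t))" if "S \<subseteq> T" "finite S" for S
    using that(2,1)
  proof (induction S rule: finite_induct)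
    case empty
    then show ?case by (simp add: z)
  next
    case (insert t S)
    let ?s = "single t (lookup f t)"
    let ?r = "\<Sum>t\<in>S. single t (lookup f t)"
    have "keys ?s \<subseteq> T" "P ?s"
      using insert.prems s by auto
    moreover have "keys ?r \<subseteq> T" "P ?r"
      using insert by auto
    ultimately show ?case
      using insert.hyps a[of ?s ?r] keys_add[of ?s ?r] by auto
  qed
  from this[of "keys f"] assms(1) show ?thesis
    by (simp add: sum_monomials)
qed

lemma lookup_monomial_mult_shift:
  fixes f :: cpoly
  shows "lookup (single s c * f) (s + w) = c * lookup f w"
  by (simp add: lookup_mult lookup_single when_mult)

lemma lookup_monomial_mult_eq_0:
  fixes f :: cpoly
  assumes "\<And>u. w \<noteq> s + u"
  shows "lookup (single s c * f) w = 0"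
proof (rule ccontr)
  assume "lookup (single s c * f) w \<noteq> 0"
  then have "w \<in> keys (single s c * f)"
    by (simp add: in_keys_iff)
  with keys_mult[of "single s c" f] show False
    using assms by (auto split: if_splits)
qed

lemma keys_add_exponent:
  "keys (s + t :: nat \<Rightarrow>\<^sub>0 nat) = keys s \<union> keys t"
  by (auto simp: in_keys_iff lookup_add)

definition tdeg :: "(nat \<Rightarrow>\<^sub>0 nat) \<Rightarrow> nat" where
  "tdeg t = (\<Sum>i\<in>keys t. lookup t i)"

lemma tdeg_add: "tdeg (s + t) = tdeg s + tdeg t"
  unfolding tdeg_def by (rule setsum_keys_plus_distrib) auto

lemma tdeg_single [simp]: "tdeg (single i a) = a"
  by (simp add: tdeg_def)

lemma tdeg_0 [simp]: "tdeg 0 = 0"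
  by (simp add: tdeg_def)

lemma tdeg_eq_0_iff: "tdeg t = 0 \<longleftrightarrow> t = 0"
  by (auto simp: tdeg_def in_keys_iff intro!: poly_mapping_eqI)

lemma homogeneous_tdeg: "homogeneous d f \<longleftrightarrow> (\<forall>t\<in>keys f. tdeg t = d)"
  by (simp add: homogeneous_def tdeg_def)

lemma homogeneous_vec_tdeg:
  "homogeneous_vec m d c e \<longleftrightarrow> (\<forall>k<m. \<forall>t\<in>keys (e k). tdeg t + d k = c)"
  by (simp add: homogeneous_vec_def tdeg_def)

lemma homogeneous_mult:
  assumes "homogeneous a f" "homogeneous b g"
  shows "homogeneous (a + b) (f * g)"
  using assms keys_mult[of f g] unfolding homogeneous_tdeg by (force simp: tdeg_add)

lemma homogeneous_sum:
  assumes "\<And>k. k \<in> S \<Longrightarrow> homogeneous a (f k)"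
  shows "homogeneous a (\<Sum>k\<in>S. f k)"
proof -
  have "homogeneous a 0" by (simp add: homogeneous_def)
  moreover have "homogeneous a (x + y)" if "homogeneous a x" "homogeneous a y" for x y
    using that keys_add[of x y] unfolding homogeneous_def by blast
  ultimately show ?thesis
    using assms by (induction S rule: infinite_finite_induct) auto
qed

lemma homogeneous_minus:
  assumes "homogeneous a f" "homogeneous a g"
  shows "homogeneous a (f - g)"
  unfolding homogeneous_tdeg
proof
  fix t assume "t \<in> keys (f - g)"
  then have "t \<in> keys f \<or> t \<in> keys g"
    by (auto simp: in_keys_iff lookup_minus)
  then show "tdeg t = a" using assms by (auto simp: homogeneous_tdeg)
qed

definition hom_part :: "nat \<Rightarrow> cpoly \<Rightarrow> cpoly" where
  "hom_part d f = (\<Sum>t\<in>keys f. single t (lookup f t when tdeg t = d))"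

lemma lookup_hom_part: "lookup (hom_part d f) w = (lookup f w when tdeg w = d)"
proof -
  have "lookup (hom_part d f) w
      = (\<Sum>t\<in>keys f. if t = w then (lookup f w when tdeg w = d) else 0)"
    unfolding hom_part_def lookup_sum by (rule sum.cong) (auto simp: lookup_single)
  then show ?thesis by (simp add: in_keys_iff)
qed

lemma keys_hom_part: "keys (hom_part d f) = {t \<in> keys f. tdeg t = d}"
  by (auto simp: in_keys_iff lookup_hom_part)

lemma hom_part_add: "hom_part d (f + g) = hom_part d f + hom_part d g"
  by (rule poly_mapping_eqI) (simp add: lookup_hom_part lookup_add when_add_distrib)

lemma hom_part_0 [simp]: "hom_part d 0 = 0"
  by (simp add: hom_part_def)

lemma hom_part_sum: "hom_part d (\<Sum>k\<in>S. f k) = (\<Sum>k\<in>S. hom_part d (f k))"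
  by (induction S rule: infinite_finite_induct) (auto simp: hom_part_add)

lemma hom_part_homogeneous: "homogeneous a f \<Longrightarrow> hom_part d f = (f when a = d)"
  by (rule poly_mapping_eqI) (auto simp: lookup_hom_part homogeneous_tdeg when_def in_keys_iff)

lemma hom_part_mult_homogeneous:
  assumes g: "homogeneous b g"
  shows "hom_part (a + b) (f * g) = hom_part a f * g"
proof -
  have "keys f \<subseteq> UNIV" by simp
  then show ?thesis
  proof (induction f rule: monomial_induct)
    case zero
    then show ?case by simp
  next
    case (single t c)
    have "homogeneous (tdeg t) (single t c)"
      by (simp add: homogeneous_tdeg)
    then show ?case
      using hom_part_homogeneous[OF homogeneous_mult[OF _ g]] hom_part_homogeneous
      by (auto simp: when_def)
  next
    case (add f g)
    then show ?case by (simp add: distrib_right hom_part_add)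
  qed
qed

lemma hom_part_mult_eq_0:
  assumes g: "homogeneous b g" and "a < b"
  shows "hom_part a (f * g) = 0"
proof (rule poly_mapping_eqI)
  fix w
  show "lookup (hom_part a (f * g)) w = lookup 0 w"
    using assms keys_mult[of f g]
    by (force simp: lookup_hom_part when_def homogeneous_tdeg tdeg_add in_keys_iff)
qed

section \<open>The polynomial ring and linear extension\<close>

definition lin_ext :: "((nat \<Rightarrow>\<^sub>0 nat) \<Rightarrow> cpoly) \<Rightarrow> cpoly \<Rightarrow> cpoly" where
  "lin_ext M f = (\<Sum>t\<in>keys f. single 0 (lookup f t) * M t)"

lemma lin_ext_single: "lin_ext M (single t c) = single 0 c * M t"
  by (simp add: lin_ext_def)

lemma lin_ext_0 [simp]: "lin_ext M 0 = 0"
  by (simp add: lin_ext_def)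

lemma lin_ext_add: "lin_ext M (f + g) = lin_ext M f + lin_ext M g"
  unfolding lin_ext_def by (rule setsum_keys_plus_distrib) (auto simp: single_add distrib_right)

lemma lin_ext_sum: "lin_ext M (\<Sum>k\<in>S. f k) = (\<Sum>k\<in>S. lin_ext M (f k))"
  by (induction S rule: infinite_finite_induct) (auto simp: lin_ext_add)

lemma lin_ext_const: "lin_ext M (single 0 c * f) = single 0 c * lin_ext M f"
proof -
  have "keys f \<subseteq> UNIV" by simp
  then show ?thesis
    by (induction f rule: monomial_induct)
       (simp_all add: lin_ext_single lin_ext_add mult_single distrib_left mult.assoc[symmetric])
qed

abbreviation polys :: "nat set \<Rightarrow> cpoly set" where "polys V \<equiv> carrier (poly_ring V)"

lemma mem_poly_ring: "f \<in> polys V \<longleftrightarrow> (\<forall>t\<in>keys f. keys t \<subseteq> V)"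
  by (simp add: poly_ring_def)

lemma poly_ring_ops [simp]:
  "f \<otimes>\<^bsub>poly_ring V\<^esub> g = f * g" "f \<oplus>\<^bsub>poly_ring V\<^esub> g = f + g" "\<zero>\<^bsub>poly_ring V\<^esub> = 0" "\<one>\<^bsub>poly_ring V\<^esub> = 1"
  by (simp_all add: poly_ring_def)

lemma poly_ring_closed [simp, intro]:
  "0 \<in> polys V" "1 \<in> polys V"
  "f \<in> polys V \<Longrightarrow> g \<in> polys V \<Longrightarrow> f + g \<in> polys V"
  "f \<in> polys V \<Longrightarrow> g \<in> polys V \<Longrightarrow> f * g \<in> polys V"
  "f \<in> polys V \<Longrightarrow> - f \<in> polys V"
  "f \<in> polys V \<Longrightarrow> g \<in> polys V \<Longrightarrow> f - g \<in> polys V"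
proof -
  show "f * g \<in> polys V" if "f \<in> polys V" "g \<in> polys V"
    unfolding mem_poly_ring
  proof
    fix t assume "t \<in> keys (f * g)"
    then obtain a b where "t = a + b" "a \<in> keys f" "b \<in> keys g"
      using keys_mult[of f g] by blast
    then show "keys t \<subseteq> V"
      using that by (auto simp: keys_add_exponent mem_poly_ring)
  qed
  show "f + g \<in> polys V" if "f \<in> polys V" "g \<in> polys V"
    using that keys_add[of f g] unfolding mem_poly_ring by blast
  show "f - g \<in> polys V" if "f \<in> polys V" "g \<in> polys V"
    unfolding mem_poly_ring
  proof
    fix t assume "t \<in> keys (f - g)"
    then have "t \<in> keys f \<or> t \<in> keys g"
      by (auto simp: in_keys_iff lookup_minus)
    then show "keys t \<subseteq> V"
      using that by (auto simp: mem_poly_ring)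
  qed
  show "- f \<in> polys V" if "f \<in> polys V"
    using that by (simp add: mem_poly_ring in_keys_iff)
qed (auto simp: mem_poly_ring)

lemma poly_ring_sum: "(\<And>k. k \<in> S \<Longrightarrow> f k \<in> polys V) \<Longrightarrow> (\<Sum>k\<in>S. f k) \<in> polys V"
  by (induction S rule: infinite_finite_induct) auto

lemma monomial_in_poly_ring: "keys t \<subseteq> V \<Longrightarrow> single t c \<in> polys V"
  by (simp add: mem_poly_ring)

lemma const_in_poly_ring [simp]: "single 0 c \<in> polys V"
  by (simp add: mem_poly_ring)

lemma var_in_poly_ring: "v \<in> V \<Longrightarrow> var v \<in> polys V"
  by (simp add: mem_poly_ring var_def)

lemma poly_ring_mono: "W \<subseteq> V \<Longrightarrow> f \<in> polys W \<Longrightarrow> f \<in> polys V"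
  by (auto simp: mem_poly_ring)

lemma hom_part_in_poly_ring: "f \<in> polys V \<Longrightarrow> hom_part d f \<in> polys V"
  by (simp add: mem_poly_ring keys_hom_part)

lemma poly_ring_cring: "cring (poly_ring V)"
proof (rule cringI)
  show "abelian_group (poly_ring V)"
  proof (rule abelian_groupI)
    show "\<exists>y\<in>polys V. y \<oplus>\<^bsub>poly_ring V\<^esub> x = \<zero>\<^bsub>poly_ring V\<^esub>"
      if "x \<in> polys V" for x
      using that by (intro bexI[of _ "- x"]) auto
  qed (auto simp: add.assoc add.commute)
  show "comm_monoid (poly_ring V)"
    by (rule comm_monoidI) (auto simp: mult.assoc mult.commute)
qed (auto simp: distrib_right)

lemma poly_ring_a_inv [simp]: "f \<in> polys V \<Longrightarrow> \<ominus>\<^bsub>poly_ring V\<^esub> f = - f"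
proof -
  interpret cring "poly_ring V" by (rule poly_ring_cring)
  show "\<ominus>\<^bsub>poly_ring V\<^esub> f = - f" if "f \<in> polys V"
    by (rule minus_equality) (use that in auto)
qed

lemma poly_ring_finsum:
  "(\<And>k. k \<in> S \<Longrightarrow> f k \<in> polys V) \<Longrightarrow> finsum (poly_ring V) f S = sum f S"
proof (induction S rule: infinite_finite_induct)
  case (insert k S)
  interpret cring "poly_ring V" by (rule poly_ring_cring)
  show ?case
    using insert by (subst finsum_insert) auto
next
  case empty
  interpret cring "poly_ring V" by (rule poly_ring_cring)
  show ?case by simp
next
  case (infinite S)
  interpret cring "poly_ring V" by (rule poly_ring_cring)
  show ?case using infinite by (simp add: finsum_infinite)
qed

lemma lin_ext_in_poly_ring:
  assumes "\<And>t. t \<in> keys f \<Longrightarrow> M t \<in> polys V"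
  shows "lin_ext M f \<in> polys V"
  unfolding lin_ext_def by (rule poly_ring_sum) (use assms in auto)

section \<open>Dehomogenization\<close>

abbreviation drop_var :: "nat \<Rightarrow> (nat \<Rightarrow>\<^sub>0 nat) \<Rightarrow> (nat \<Rightarrow>\<^sub>0 nat)" where
  "drop_var v t \<equiv> Poly_Mapping.update v 0 t"

lemma drop_var_add: "drop_var v (s + t) = drop_var v s + drop_var v t"
  by (rule poly_mapping_eqI) (simp add: lookup_update lookup_add)

lemma keys_drop_var: "keys (drop_var v t) = keys t - {v}"
  by (simp add: keys_update)

lemma drop_var_decomp: "drop_var v t + single v (lookup t v) = t"
  by (rule poly_mapping_eqI) (simp add: lookup_update lookup_add lookup_single when_def)

lemma tdeg_drop_var: "tdeg t = tdeg (drop_var v t) + lookup t v"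
  using arg_cong[OF drop_var_decomp[of v t], of tdeg] by (simp add: tdeg_add)

text \<open>Among exponents of a given total degree, the dropped exponent is determined by the others. This is
  why no coefficient of a homogeneous polynomial is lost or merged by dehomogenization.\<close>

lemma drop_var_eqD:
  assumes "drop_var v s = drop_var v t" "tdeg s = tdeg t"
  shows "s = t"
proof -
  have "lookup s v = lookup t v"
    using tdeg_drop_var[of s v] tdeg_drop_var[of t v] assms by simp
  then show ?thesis
    by (metis assms(1) drop_var_decomp)
qed

lemma drop_var_idem: "v \<notin> keys t \<Longrightarrow> drop_var v t = t"
  by (rule poly_mapping_eqI) (auto simp: lookup_update not_in_keys_iff_lookup_eq_zero)

lemma dehom_single: "dehom v (single t c) = single (drop_var v t) c"
  by (simp add: dehom_def)

lemma dehom_0 [simp]: "dehom v 0 = 0"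
  by (simp add: dehom_def)

lemma dehom_1 [simp]: "dehom v 1 = 1"
  using dehom_single[of v 0 1] drop_var_idem[of v 0] by simp

lemma dehom_add: "dehom v (f + g) = dehom v f + dehom v g"
  unfolding dehom_def by (rule setsum_keys_plus_distrib) (auto simp: single_add)

lemma dehom_sum: "dehom v (\<Sum>k\<in>S. f k) = (\<Sum>k\<in>S. dehom v (f k))"
  by (induction S rule: infinite_finite_induct) (auto simp: dehom_add)

lemma dehom_mult: "dehom v (f * g) = dehom v f * dehom v g"
proof -
  have "keys f \<subseteq> UNIV" by simp
  then show ?thesis
  proof (induction f rule: monomial_induct)
    case (single s c)
    have "keys g \<subseteq> UNIV" by simp
    then show ?case
      by (induction g rule: monomial_induct)
         (simp_all add: mult_single dehom_single drop_var_add distrib_left dehom_add)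
  qed (simp_all add: distrib_right dehom_add)
qed

lemma dehom_uminus: "dehom v (- f) = - dehom v f"
  using dehom_add[of v f "- f"] by (simp add: eq_neg_iff_add_eq_0 add.commute)

lemma dehom_minus: "dehom v (f - g) = dehom v f - dehom v g"
  using dehom_add[of v f "- g"] by (simp add: dehom_uminus)

lemma dehom_var [simp]: "dehom v (var v) = 1"
proof -
  have "drop_var v (single v 1) = 0"
    by (rule poly_mapping_eqI) (simp add: lookup_update lookup_single when_def)
  then show ?thesis by (simp add: var_def dehom_single)
qed

lemma dehom_id: "f \<in> polys W \<Longrightarrow> v \<notin> W \<Longrightarrow> dehom v f = f"
proof -
  assume f: "f \<in> polys W" and v: "v \<notin> W"
  have "dehom v f = (\<Sum>t\<in>keys f. single t (lookup f t))"
    unfolding dehom_def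
  proof (rule sum.cong)
    fix t assume "t \<in> keys f"
    then have "v \<notin> keys t" using f v by (auto simp: mem_poly_ring)
    then show "single (drop_var v t) (lookup f t)
        = single t (lookup f t)"
      using drop_var_idem[of v t] by simp
  qed simp
  then show ?thesis by (simp add: sum_monomials)
qed

lemma keys_dehom: "keys (dehom v f) \<subseteq> drop_var v ` keys f"
proof
  fix w assume "w \<in> keys (dehom v f)"
  then have "(\<Sum>t\<in>keys f. lookup (single (drop_var v t) (lookup f t)) w) \<noteq> 0"
    by (simp add: in_keys_iff dehom_def lookup_sum)
  then obtain t where "t \<in> keys f"
    "lookup (single (drop_var v t) (lookup f t)) w \<noteq> 0"
    by (rule sum.not_neutral_contains_not_neutral)
  then show "w \<in> drop_var v ` keys f"
    by (auto simp: lookup_single)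
qed

lemma dehom_in_poly_ring: "f \<in> polys V \<Longrightarrow> dehom v f \<in> polys (V - {v})"
  using keys_dehom[of v f] by (fastforce simp: mem_poly_ring keys_drop_var)

lemma lookup_dehom_homogeneous:
  assumes h: "homogeneous d h" and w: "tdeg w = d"
  shows "lookup (dehom v h) (drop_var v w) = lookup h w"
proof -
  have "lookup (dehom v h) (drop_var v w)
      = (\<Sum>t\<in>keys h. if t = w then lookup h w else 0)"
    unfolding dehom_def lookup_sum
  proof (rule sum.cong)
    fix t assume "t \<in> keys h"
    then have "drop_var v t = drop_var v w \<longleftrightarrow> t = w"
      using h w by (auto simp: homogeneous_tdeg dest: drop_var_eqD)
    then show "lookup (single (drop_var v t) (lookup h t)) (drop_var v w)
        = (if t = w then lookup h w else 0)"
      by (auto simp: lookup_single)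
  qed simp
  then show ?thesis by (simp add: in_keys_iff)
qed

lemma dehom_homogeneous_eq_0:
  assumes h: "homogeneous d h" and "dehom v h = 0"
  shows "h = 0"
proof (rule poly_mapping_eqI)
  fix w
  show "lookup h w = lookup 0 w"
  proof (cases "tdeg w = d")
    case True
    then show ?thesis using lookup_dehom_homogeneous[OF h, of w v] assms(2) by simp
  next
    case False
    then show ?thesis using h by (auto simp: homogeneous_tdeg in_keys_iff)
  qed
qed

lemma monomial_telescope:
  "single (u + single v n) c - single u c
    = (var v - 1) * (\<Sum>i<n. single (u + single v i) c)"
proof (induction n)
  case (Suc n)
  have "(var v - 1) * single (u + single v n) c
      = single (u + single v (Suc n)) c - single (u + single v n) c"
    using single_add[of v 1 n] by (simp add: left_diff_distrib var_def mult_single add.left_commute)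
  then show ?case unfolding sum.lessThan_Suc distrib_left Suc[symmetric] by simp
qed simp

text \<open>Multiplying each monomial of \<open>f\<close> by the power of \<open>x\<^sub>v\<close> that raises its exponent to a common value
  \<open>N\<close> changes \<open>f\<close> by a multiple of \<open>x\<^sub>v - 1\<close> and results in \<open>x\<^sub>v\<^sup>N\<close> times the dehomogenization, that is, in 0.
  The description of the supports ensures that \<open>G\<close> lies in every monomial ideal that contains \<open>f\<close>.\<close>

lemma dehom_kernel:
  assumes "dehom v f = 0"
  obtains G where "f = (var v - 1) * G"
    "\<And>t. t \<in> keys G \<Longrightarrow> \<exists>u\<in>keys f.
       keys u \<subseteq> keys t \<and> keys t \<subseteq> insert v (keys u)"
proof -
  define N where "N = (\<Sum>u\<in>keys f. lookup u v)"
  have N: "lookup u v \<le> N" if "u \<in> keys f" for u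
    unfolding N_def using that by (intro member_le_sum) auto
  define S where "S u = (\<Sum>i<N - lookup u v.
      single (u + single v i) (lookup f u))" for u
  define G where "G = - (\<Sum>u\<in>keys f. S u)"
  have "(var v - 1) * (\<Sum>u\<in>keys f. S u)
      = (\<Sum>u\<in>keys f. single (drop_var v u + single v N) (lookup f u)
           - single u (lookup f u))"
    unfolding sum_distrib_left
  proof (rule sum.cong)
    fix u assume u: "u \<in> keys f"
    have "u + single v (N - lookup u v) = drop_var v u + single v N"
      by (rule poly_mapping_eqI) (use N[OF u] in \<open>auto simp: lookup_update lookup_add lookup_single when_def\<close>)
    then show "(var v - 1) * S u = single (drop_var v u + single v N) (lookup f u)
           - single u (lookup f u)"
      unfolding S_def monomial_telescope[symmetric] by simp
  qed simp
  also have "\<dots> = single (single v N) 1 * dehom v f - f"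
    by (simp add: sum_subtractf sum_monomials dehom_def sum_distrib_left mult_single add.commute)
  finally have "f = (var v - 1) * G"
    using assms by (simp add: G_def)
  moreover have "\<exists>u\<in>keys f.
       keys u \<subseteq> keys t \<and> keys t \<subseteq> insert v (keys u)"
    if "t \<in> keys G" for t
  proof -
    have "(\<Sum>u\<in>keys f. lookup (S u) t) \<noteq> 0"
      using that by (simp add: G_def in_keys_iff lookup_sum)
    then obtain u where u: "u \<in> keys f" "lookup (S u) t \<noteq> 0"
      by (rule sum.not_neutral_contains_not_neutral)
    then obtain i where "lookup (single (u + single v i) (lookup f u)) t \<noteq> 0"
      unfolding S_def lookup_sum by (meson sum.not_neutral_contains_not_neutral)
    then have "t = u + single v i"
      by (auto simp: lookup_single)
    then show ?thesis using u(1) by (auto simp: keys_add_exponent split: if_splits)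
  qed
  ultimately show thesis by (rule that)
qed

section \<open>Stanley-Reisner ideals\<close>

lemma prod_var: "finite p \<Longrightarrow> (\<Prod>i\<in>p. var i) = single (\<Sum>i\<in>p. single i 1) 1"
  by (induction p rule: finite_induct) (auto simp: var_def mult_single simp flip: single_one)

text \<open>Besides simplicial complexes this covers the empty family, which is the link of a point that is
  not a vertex; the coordinate ring of that chart is the zero ring.\<close>

locale complex_on =
  fixes V :: "nat set" and X :: "nat set set"
  assumes finV: "finite V" and sub: "X \<subseteq> Pow V" and down: "\<And>f g. f \<in> X \<Longrightarrow> g \<subseteq> f \<Longrightarrow> g \<in> X"
begin

lemma nonface_products_in_poly_ring: "{\<Prod>i\<in>p. var i |p. p \<subseteq> V \<and> p \<notin> X} \<subseteq> polys V"
proof -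
  have "(\<Prod>i\<in>p. var i) \<in> polys V" if "p \<subseteq> V" for p
    using finite_subset[OF that finV] that
    by (induction p rule: finite_induct) (auto simp: var_in_poly_ring)
  then show ?thesis by auto
qed

lemma SR_ideal_is_ideal: "ideal (SR_ideal V X) (poly_ring V)"
proof -
  interpret cring "poly_ring V" by (rule poly_ring_cring)
  show ?thesis
    unfolding SR_ideal_def by (rule genideal_ideal[OF nonface_products_in_poly_ring])
qed

lemma SR_idealI_monomial:
  assumes "keys t \<subseteq> V" "keys t \<notin> X"
  shows "single t c \<in> SR_ideal V X"
proof -
  interpret cring "poly_ring V" by (rule poly_ring_cring)
  interpret I: ideal "SR_ideal V X" "poly_ring V" by (rule SR_ideal_is_ideal)
  define p where "p = keys t"
  have fp: "finite p" by (simp add: p_def)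
  define e where "e = (\<Sum>i\<in>p. single i (1::nat))"
  have e: "lookup e i = (if i \<in> p then 1 else 0)" for i
  proof -
    have "lookup e i = (\<Sum>j\<in>p. if j = i then 1 else 0)"
      unfolding e_def lookup_sum by (rule sum.cong) (auto simp: lookup_single)
    then show ?thesis using fp by simp
  qed
  have "t - e + e = t"
    by (rule poly_mapping_eqI) (use e in \<open>auto simp: lookup_add lookup_minus p_def in_keys_iff\<close>)
  then have "single t c = single (t - e) c * (\<Prod>i\<in>p. var i)"
    by (simp add: prod_var[OF fp] e_def mult_single)
  moreover have "keys (t - e) \<subseteq> V"
    using assms(1) by (auto simp: in_keys_iff lookup_minus)
  moreover have "(\<Prod>i\<in>p. var i) \<in> SR_ideal V X"
    using genideal_self[OF nonface_products_in_poly_ring] assms unfolding SR_ideal_def p_def by blast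
  ultimately show ?thesis
    using I.I_l_closed[of "\<Prod>i\<in>p. var i" "single (t - e) c"]
    by (simp add: monomial_in_poly_ring)
qed

text \<open>The monomials whose support is not a face span an ideal. Therefore congruence modulo the
  Stanley-Reisner ideal means equality of the coefficients at the exponents supported on faces.\<close>

lemma mem_SR_ideal:
  "f \<in> SR_ideal V X \<longleftrightarrow> f \<in> polys V \<and> (\<forall>t\<in>keys f. keys t \<notin> X)"
proof -
  interpret cring "poly_ring V" by (rule poly_ring_cring)
  interpret I: ideal "SR_ideal V X" "poly_ring V" by (rule SR_ideal_is_ideal)
  define K where "K = {f \<in> polys V. \<forall>t\<in>keys f. keys t \<notin> X}"
  have mult: "f * g \<in> K" if "f \<in> K" "g \<in> polys V" for f g
  proof -
    have "keys t \<notin> X" if t: "t \<in> keys (f * g)" for t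
    proof -
      obtain a b where "t = a + b" "a \<in> keys f"
        using t keys_mult[of f g] by blast
      then show ?thesis
        using \<open>f \<in> K\<close> down[of "keys t" "keys a"]
        by (auto simp: K_def keys_add_exponent)
    qed
    then show ?thesis using that by (auto simp: K_def)
  qed
  have "ideal K (poly_ring V)"
  proof (rule idealI)
    show "subgroup K (add_monoid (poly_ring V))"
    proof
      show "x \<otimes>\<^bsub>add_monoid (poly_ring V)\<^esub> y \<in> K" if "x \<in> K" "y \<in> K" for x y
        using that keys_add[of x y] by (auto simp: K_def)
      show "inv\<^bsub>add_monoid (poly_ring V)\<^esub> x \<in> K" if "x \<in> K" for x
      proof -
        have "inv\<^bsub>add_monoid (poly_ring V)\<^esub> x = - x"
          using that poly_ring_a_inv[of x V] by (simp add: a_inv_def K_def)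
        then show ?thesis using that by (auto simp: K_def in_keys_iff)
      qed
    qed (auto simp: K_def)
  next
    show "x \<otimes>\<^bsub>poly_ring V\<^esub> a \<in> K" if "a \<in> K" "x \<in> polys V" for a x
      using mult[OF that] by (simp add: mult.commute)
  qed (use mult ring_axioms in auto)
  moreover have "{\<Prod>i\<in>p. var i |p. p \<subseteq> V \<and> p \<notin> X} \<subseteq> K"
  proof clarify
    fix p assume p: "p \<subseteq> V" "p \<notin> X"
    have fp: "finite p" using finite_subset[OF p(1) finV] .
    have "keys (\<Sum>i\<in>p. single i (1::nat)) = p"
      using fp by (induction p rule: finite_induct) (auto simp: keys_add_exponent)
    then show "(\<Prod>i\<in>p. var i) \<in> K"
      using p by (simp add: prod_var[OF fp] K_def mem_poly_ring)
  qed
  ultimately have "SR_ideal V X \<subseteq> K"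
    unfolding SR_ideal_def by (rule genideal_minimal)
  moreover have "f \<in> SR_ideal V X" if "f \<in> K" for f
  proof -
    have "keys f \<subseteq> {t. keys t \<subseteq> V \<and> keys t \<notin> X}"
      using that by (auto simp: K_def mem_poly_ring)
    then show ?thesis
    proof (induction f rule: monomial_induct)
      case zero
      show ?case using I.zero_closed by simp
    next
      case (single t c)
      then show ?case by (simp add: SR_idealI_monomial)
    next
      case (add f g)
      then show ?case using I.a_closed[of f g] by simp
    qed
  qed
  ultimately have "SR_ideal V X = K" by blast
  then show ?thesis unfolding K_def by blast
qed

abbreviation "I \<equiv> SR_ideal V X"

lemma I_carrier: "f \<in> I \<Longrightarrow> f \<in> polys V"
  by (simp add: mem_SR_ideal)

lemma I_closed:
  "0 \<in> I" "f \<in> I \<Longrightarrow> g \<in> I \<Longrightarrow> f + g \<in> I" "f \<in> I \<Longrightarrow> g \<in> I \<Longrightarrow> f - g \<in> I" "f \<in> I \<Longrightarrow> - f \<in> I"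
  "f \<in> I \<Longrightarrow> p \<in> polys V \<Longrightarrow> f * p \<in> I"
  "f \<in> I \<Longrightarrow> p \<in> polys V \<Longrightarrow> p * f \<in> I"
proof -
  interpret cring "poly_ring V" by (rule poly_ring_cring)
  interpret I: ideal I "poly_ring V" by (rule SR_ideal_is_ideal)
  show "0 \<in> I" using I.zero_closed by simp
  show a: "f + g \<in> I" if "f \<in> I" "g \<in> I" for f g using I.a_closed[OF that] by simp
  show n: "- f \<in> I" if "f \<in> I" for f using I.a_inv_closed[OF that] I_carrier[OF that] by simp
  show "f - g \<in> I" if "f \<in> I" "g \<in> I" using a[OF that(1) n[OF that(2)]] by simp
  show "f * p \<in> I" if "f \<in> I" "p \<in> polys V" using I.I_r_closed[OF that] by simp
  show "p * f \<in> I" if "f \<in> I" "p \<in> polys V" using I.I_l_closed[OF that] by simp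
qed

lemma I_sum: "(\<And>k. k \<in> S \<Longrightarrow> f k \<in> I) \<Longrightarrow> (\<Sum>k\<in>S. f k) \<in> I"
  by (induction S rule: infinite_finite_induct) (auto simp: I_closed)

lemma cong_iff:
  assumes "f \<in> polys V" "g \<in> polys V"
  shows "f - g \<in> I \<longleftrightarrow> (\<forall>w. keys w \<in> X \<longrightarrow> lookup f w = lookup g w)"
proof -
  have "f - g \<in> I \<longleftrightarrow> (\<forall>w. w \<in> keys (f - g) \<longrightarrow> keys w \<notin> X)"
    using assms by (auto simp: mem_SR_ideal)
  also have "\<dots> \<longleftrightarrow> (\<forall>w. keys w \<in> X \<longrightarrow> lookup f w = lookup g w)"
    unfolding in_keys_iff lookup_minus by fastforce
  finally show ?thesis .
qed

lemma cong_lookup: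
  assumes "f - g \<in> I" "keys w \<in> X"
  shows "lookup f w = lookup g w"
proof -
  have "w \<notin> keys (f - g)"
    using assms by (auto simp: mem_SR_ideal)
  then have "lookup (f - g) w = 0"
    by (simp add: not_in_keys_iff_lookup_eq_zero)
  then show ?thesis by (simp add: lookup_minus)
qed

lemma link_complex: "complex_on (V - {v}) (link v X)"
proof
  show "finite (V - {v})" using finV by simp
  show "link v X \<subseteq> Pow (V - {v})" using sub by (auto simp: link_def)
  show "g \<in> link v X" if "f \<in> link v X" "g \<subseteq> f" for f g
    using that down[of f g] down[of "f \<union> {v}" "g \<union> {v}"] by (auto simp: link_def)
qed

text \<open>Multiplication by \<open>x\<^sub>v\<close> lifts the ideal of the link back to the ideal of \<open>X\<close>.\<close>

lemma dehom_SR_ideal: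
  assumes v: "v \<in> V"
  shows "f \<in> I \<Longrightarrow> dehom v f \<in> SR_ideal (V - {v}) (link v X)"
    and "f \<in> SR_ideal (V - {v}) (link v X) \<Longrightarrow> var v * f \<in> I"
    and "f \<in> SR_ideal (V - {v}) (link v X) \<Longrightarrow> dehom v (var v * f) = f"
proof -
  interpret L: complex_on "V - {v}" "link v X" by (rule link_complex)
  show "dehom v f \<in> L.I" if f: "f \<in> I"
    unfolding L.mem_SR_ideal
  proof (intro conjI ballI dehom_in_poly_ring I_carrier f)
    fix w assume "w \<in> keys (dehom v f)"
    then obtain t where t: "t \<in> keys f" "w = drop_var v t"
      using keys_dehom[of v f] by blast
    then have "keys t \<notin> X" using f by (simp add: mem_SR_ideal)
    then show "keys w \<notin> link v X"
      using down[of "keys t - {v} \<union> {v}" "keys t"]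
      by (auto simp: t(2) keys_drop_var link_def)
  qed
  assume f: "f \<in> L.I"
  then have fc: "f \<in> polys (V - {v})" by (rule L.I_carrier)
  show "dehom v (var v * f) = f"
    by (simp add: dehom_mult dehom_id[OF fc])
  show "var v * f \<in> I"
    unfolding mem_SR_ideal
  proof (intro conjI ballI)
    have "f \<in> polys V" by (rule poly_ring_mono[OF _ fc]) auto
    then show "var v * f \<in> polys V" using v by (auto simp: var_in_poly_ring)
    fix t assume "t \<in> keys (var v * f)"
    then obtain u where u: "u \<in> keys f" "t = single v 1 + u"
      using keys_mult[of "var v" f] by (auto simp: var_def split: if_splits)
    then have "keys u \<notin> link v X" "v \<notin> keys u"
      using f fc by (auto simp: L.mem_SR_ideal mem_poly_ring)
    then show "keys t \<notin> X"
      using down[of "insert v (keys u)" "keys u"]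
      by (auto simp: u(2) keys_add_exponent link_def)
  qed
qed

lemma dehom_kernel_I:
  assumes v: "v \<in> V" and f: "f \<in> I" "dehom v f = 0"
  obtains G where "G \<in> I" "f = (var v - 1) * G"
proof -
  obtain G where G: "f = (var v - 1) * G"
    "\<And>t. t \<in> keys G \<Longrightarrow> \<exists>u\<in>keys f.
       keys u \<subseteq> keys t \<and> keys t \<subseteq> insert v (keys u)"
    using dehom_kernel[OF f(2)] by blast
  have "G \<in> I"
    unfolding mem_SR_ideal mem_poly_ring
  proof (intro conjI ballI)
    fix t assume "t \<in> keys G"
    then obtain u where u: "u \<in> keys f" "keys u \<subseteq> keys t"
      "keys t \<subseteq> insert v (keys u)"
      using G(2) by blast
    moreover from u(1) f(1) have "keys u \<subseteq> V" "keys u \<notin> X"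
      by (auto simp: mem_SR_ideal mem_poly_ring)
    ultimately show "keys t \<subseteq> V" "keys t \<notin> X"
      using v down by auto
  qed
  then show thesis using G(1) that by blast
qed

lemma dehom_kernel_poly:
  assumes v: "v \<in> V" and f: "f \<in> polys V" "dehom v f = 0"
  obtains G where "G \<in> polys V" "f = (var v - 1) * G"
proof -
  obtain G where G: "f = (var v - 1) * G"
    "\<And>t. t \<in> keys G \<Longrightarrow> \<exists>u\<in>keys f.
       keys u \<subseteq> keys t \<and> keys t \<subseteq> insert v (keys u)"
    using dehom_kernel[OF f(2)] by blast
  have "G \<in> polys V"
    unfolding mem_poly_ring
  proof
    fix t assume "t \<in> keys G"
    then show "keys t \<subseteq> V"
      using G(2) f(1) v by (fastforce simp: mem_poly_ring)
  qed
  then show thesis using G(1) that by blast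
qed

lemma link_drop_var:
  assumes "keys w \<in> X" "v \<in> keys w"
  shows "keys (drop_var v w) \<in> link v X"
  using assms down[of "keys w" "keys w - {v}"]
  by (auto simp: link_def keys_drop_var insert_absorb)

end

section \<open>Derivations of degree zero\<close>

text \<open>The value of the derivation \<open>\<Sum> a\<^sub>i\<^sub>j x\<^sub>j \<partial>\<^sub>i\<close> at the monomial \<open>x\<^sup>t\<close>. The subtraction of exponents is
  truncated only if \<open>x\<^sub>i\<close> does not divide \<open>x\<^sup>t\<close>, and then the coefficient is 0.\<close>

definition linear_field_term :: "nat set \<Rightarrow> (nat \<Rightarrow> nat \<Rightarrow> complex) \<Rightarrow> (nat \<Rightarrow>\<^sub>0 nat) \<Rightarrow> cpoly" where
  "linear_field_term V a t =
    (\<Sum>i\<in>V. \<Sum>j\<in>V. single (t - single i 1 + single j 1)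
                       (a i j * of_nat (lookup t i)))"

lemma minus_single_add:
  assumes "lookup t i > 0"
  shows "s + (t - single i 1) = s + t - single i (1::nat)"
  by (rule poly_mapping_eqI) (use assms in \<open>auto simp: lookup_add lookup_minus lookup_single when_def\<close>)

lemma linear_field_term_add:
  "linear_field_term V a (s + t) =
     single s 1 * linear_field_term V a t + single t 1 * linear_field_term V a s"
proof -
  let ?m = "\<lambda>i j r c. single (r - single i 1 + single j (1::nat)) (c::complex)"
  have *: "?m i j (s + t) (c * of_nat (lookup t i))
      = single s 1 * ?m i j t (c * of_nat (lookup t i))" for i j c and s t
    by (cases "lookup t i = 0")
       (simp_all add: mult_single minus_single_add[unfolded One_nat_def] add.assoc[symmetric])
  have "?m i j (s + t) (a i j * of_nat (lookup (s + t) i))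
      = single s 1 * ?m i j t (a i j * of_nat (lookup t i))
      + single t 1 * ?m i j s (a i j * of_nat (lookup s i))" for i j
    unfolding *[symmetric]
    by (simp add: lookup_add distrib_left single_add add.commute)
  then show ?thesis
    by (simp add: linear_field_term_def sum_distrib_left sum.distrib)
qed

lemma lin_ext_Leibniz:
  assumes "\<And>s t. M (s + t) = single s 1 * M t + single t 1 * M s"
  shows "lin_ext M (f * g) = f * lin_ext M g + g * lin_ext M f"
proof -
  have "keys f \<subseteq> UNIV" by simp
  then show ?thesis
  proof (induction f rule: monomial_induct)
    case (single s c)
    have "keys g \<subseteq> UNIV" by simp
    then show ?case
    proof (induction g rule: monomial_induct)
      case (single t d)
      have c: "single s c = single 0 c * single s 1"
        and d: "single t d = single 0 d * single t 1"
        and cd: "single 0 (c * d) = single 0 c * single (0::nat \<Rightarrow>\<^sub>0 nat) d"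
        by (simp_all add: mult_single)
      have e: "lin_ext M (single s c * single t d)
          = single 0 c * single 0 d
              * (single s 1 * M t + single t 1 * M s)"
        by (simp only: mult_single lin_ext_single assms cd[symmetric] add_0_left)
      show ?case
        unfolding e lin_ext_single by (subst c, subst d) (simp only: algebra_simps)
    qed (simp_all add: distrib_left distrib_right lin_ext_add)
  qed (simp_all add: distrib_left distrib_right lin_ext_add)
qed

lemma lin_ext_Der:
  assumes "\<And>s t. M (s + t) = single s 1 * M t + single t 1 * M s"
    and "\<And>t. keys t \<subseteq> V \<Longrightarrow> M t \<in> polys V"
  shows "(\<lambda>f\<in>polys V. lin_ext M f) \<in> Der constants (poly_ring V)"
proof -
  have "lin_ext M f \<in> polys V" if "f \<in> polys V" for f
    using that assms(2) by (intro lin_ext_in_poly_ring) (auto simp: mem_poly_ring)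
  then show ?thesis
    unfolding Der_def constants_def
  proof (intro CollectI conjI ballI)
    fix c f :: cpoly
    assume "c \<in> {single 0 c |c. True}" "f \<in> polys V"
    then show "(\<lambda>f\<in>polys V. lin_ext M f) (c \<otimes>\<^bsub>poly_ring V\<^esub> f)
        = c \<otimes>\<^bsub>poly_ring V\<^esub> (\<lambda>f\<in>polys V. lin_ext M f) f"
      by (auto simp: lin_ext_const)
  qed (simp_all add: lin_ext_add lin_ext_Leibniz[OF assms(1)])
qed

lemma linear_field_term_in_poly_ring:
  assumes "keys t \<subseteq> V"
  shows "linear_field_term V a t \<in> polys V"
  unfolding linear_field_term_def
proof (intro poly_ring_sum monomial_in_poly_ring)
  fix i j assume "j \<in> V"
  moreover have "keys (t - single i 1) \<subseteq> keys t"
    by (auto simp: in_keys_iff lookup_minus)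
  ultimately show "keys (t - single i 1 + single j 1) \<subseteq> V"
    using assms by (auto simp: keys_add_exponent split: if_splits)
qed

lemma Der_monomial:
  assumes fin: "finite W" and D: "D \<in> Der constants (poly_ring W)" and t: "keys t \<subseteq> W"
  shows "D (single t 1)
    = (\<Sum>i\<in>W. single (t - single i 1) (of_nat (lookup t i)) * D (var i))"
  using t
proof (induction "tdeg t" arbitrary: t)
  case 0
  then have t: "t = 0" by (simp add: tdeg_eq_0_iff)
  have "D (1 * 1) = 1 * D 1 + 1 * D 1"
    using D by (simp only: Der_def poly_ring_ops mem_Collect_eq) (metis (no_types) poly_ring_closed(2))
  then have "D 1 = 0" by simp
  then show ?case by (simp add: t)
next
  case (Suc n)
  then have "t \<noteq> 0" by auto
  then obtain j where j: "lookup t j \<noteq> 0"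
    by (metis lookup_zero poly_mapping_eqI)
  define s where "s = t - single j 1"
  have t: "t = single j 1 + s"
    by (rule poly_mapping_eqI) (use j in \<open>auto simp: s_def lookup_add lookup_minus lookup_single when_def\<close>)
  have W: "j \<in> W" "keys s \<subseteq> W"
    using Suc.prems by (auto simp: t keys_add_exponent)
  have n: "n = tdeg s" using Suc.hyps(2) by (simp add: t tdeg_add)
  have "D (var j * single s 1) = var j * D (single s 1) + single s 1 * D (var j)"
    using D W by (simp add: Der_def var_in_poly_ring monomial_in_poly_ring)
  also have "var j * single s 1 = single t 1"
    by (simp add: t var_def mult_single)
  also have "D (single s 1) = (\<Sum>i\<in>W. single (s - single i 1) (of_nat (lookup s i)) * D (var i))"
    using Suc.hyps(1)[OF n W(2)] .
  also have "var j * \<dots> + single s 1 * D (var j)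
      = (\<Sum>i\<in>W. var j * (single (s - single i 1) (of_nat (lookup s i)) * D (var i))
          + (if i = j then single s 1 * D (var i) else 0))"
    using fin W by (simp add: sum.distrib sum_distrib_left)
  also have "\<dots> = (\<Sum>i\<in>W. single (t - single i 1) (of_nat (lookup t i)) * D (var i))"
  proof (rule sum.cong)
    fix i assume "i \<in> W"
    have 1: "var j * (single (s - single i 1) (of_nat (lookup s i)))
        = single (t - single i 1) (of_nat (lookup s i) :: complex)"
    proof (cases "lookup s i = 0")
      case False
      then show ?thesis
        by (simp add: var_def mult_single t minus_single_add[unfolded One_nat_def])
    qed simp
    have 2: "i = j \<Longrightarrow> s = t - single i 1"
      by (simp add: s_def)
    have 3: "lookup t i = lookup s i + (if i = j then 1 else 0)"
      by (simp add: t lookup_add lookup_single when_def)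
    show "var j * (single (s - single i 1) (of_nat (lookup s i)) * D (var i))
          + (if i = j then single s 1 * D (var i) else 0)
        = single (t - single i 1) (of_nat (lookup t i)) * D (var i)"
      unfolding mult.assoc[symmetric] 1 3 using 2
      by (auto simp: single_add distrib_right)
  qed simp
  finally show ?case .
qed

section \<open>Gluing derivations\<close>

text \<open>This selects the chart in which a given coefficient is examined.\<close>

lemma exponent_exceeds:
  assumes "tdeg w = tdeg u" "w \<noteq> u"
  shows "\<exists>v. lookup u v < lookup w v"
proof (rule ccontr)
  assume "\<not> ?thesis"
  then have "\<And>v. lookup w v \<le> lookup u v"
    by (simp add: not_less)
  then have u: "u = w + (u - w)"
    by (intro poly_mapping_eqI) (simp add: lookup_add lookup_minus)
  have "tdeg (u - w) = 0"
    using arg_cong[OF u, of tdeg] assms(1) by (simp add: tdeg_add)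
  then show False
    using u assms(2) by (simp add: tdeg_eq_0_iff)
qed

lemma linear_field_term_homogeneous: "homogeneous (tdeg u) (linear_field_term V a u)"
  unfolding linear_field_term_def
proof (intro homogeneous_sum)
  fix i j
  show "homogeneous (tdeg u) (single (u - single i 1 + single j 1)
      (a i j * of_nat (lookup u i)))"
  proof (cases "lookup u i = 0")
    case False
    then have "u = (u - single i 1) + single i 1"
      by (intro poly_mapping_eqI) (auto simp: lookup_add lookup_minus lookup_single when_def)
    then have "tdeg u = tdeg (u - single i 1) + 1"
      by (metis tdeg_add tdeg_single)
    then show ?thesis
      by (auto simp: homogeneous_tdeg tdeg_add)
  qed (simp add: homogeneous_def)
qed

context complex_on
begin

lemma cong_trans: "x - y \<in> I \<Longrightarrow> y - z \<in> I \<Longrightarrow> x - z \<in> I"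
  using I_closed(2)[of "x - y" "y - z"] by simp

lemma cong_sym: "x - y \<in> I \<Longrightarrow> y - x \<in> I"
  using I_closed(4)[of "x - y"] by simp

lemma cong_add: "x - y \<in> I \<Longrightarrow> x' - y' \<in> I \<Longrightarrow> (x + x') - (y + y') \<in> I"
  using I_closed(2)[of "x - y" "x' - y'"] by (simp add: algebra_simps)

lemma cong_minus: "x - y \<in> I \<Longrightarrow> x' - y' \<in> I \<Longrightarrow> (x - x') - (y - y') \<in> I"
  using I_closed(3)[of "x - y" "x' - y'"] by (simp add: algebra_simps)

lemma cong_mult: "p \<in> polys V \<Longrightarrow> x - y \<in> I \<Longrightarrow> p * x - p * y \<in> I"
  using I_closed(6)[of "x - y" p] by (simp add: algebra_simps)

lemma cong_sum: "(\<And>k. k \<in> S \<Longrightarrow> x k - y k \<in> I) \<Longrightarrow> (\<Sum>k\<in>S. x k) - (\<Sum>k\<in>S. y k) \<in> I"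
  using I_sum[of S "\<lambda>k. x k - y k"] by (simp add: sum_subtractf)

text \<open>A class of degree \<open>d\<close> can be read off in the chart of \<open>v\<close> at all exponents that involve \<open>x\<^sub>v\<close>: the
  support of such an exponent is a face of \<open>X\<close> exactly if it becomes a face of the link when \<open>v\<close> is
  removed.\<close>

lemma lookup_local:
  assumes F: "F - h \<in> I" "homogeneous d h" and loc: "dehom v F - G \<in> SR_ideal (V - {v}) (link v X)"
    and v: "v \<in> V" and w: "keys w \<in> X" "v \<in> keys w" "tdeg w = d"
  shows "lookup F w = lookup G (drop_var v w)"
proof -
  interpret L: complex_on "V - {v}" "link v X" by (rule link_complex)
  have "lookup F w = lookup h w"
    by (rule cong_lookup[OF F(1) w(1)])
  also have "\<dots> = lookup (dehom v h) (drop_var v w)"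
    by (rule lookup_dehom_homogeneous[OF F(2) w(3), symmetric])
  also have "\<dots> = lookup (dehom v F) (drop_var v w)"
    using L.cong_lookup[OF _ link_drop_var[OF w(1,2)], of "dehom v F" "dehom v h"]
      dehom_SR_ideal(1)[OF v F(1)] by (simp add: dehom_minus)
  also have "\<dots> = lookup G (drop_var v w)"
    by (rule L.cong_lookup[OF loc link_drop_var[OF w(1,2)]])
  finally show ?thesis .
qed

text \<open>At an exponent \<open>w\<close> with \<open>w\<^sub>v > u\<^sub>v\<close>, the local derivation \<open>D v\<close> contributes the coefficients of
  \<open>D v (x\<^sub>i)\<close> at \<open>w - u + e\<^sub>i\<close> with the entry at \<open>v\<close> dropped. The total degree of this exponent is
  \<open>1 - (w\<^sub>v - u\<^sub>v)\<close>, so only constant terms occur, and only for \<open>w = u - e\<^sub>i + e\<^sub>v\<close>.\<close>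

lemma glue_derivations_monomial:
  assumes F: "F - h \<in> I" "homogeneous (tdeg u) h"
    and loc: "\<And>v. v \<in> V \<Longrightarrow> dehom v F - D v (dehom v (single u 1)) \<in> SR_ideal (V - {v}) (link v X)"
    and D: "\<And>v. v \<in> V \<Longrightarrow> D v \<in> Der constants (poly_ring (V - {v}))"
    and u: "keys u \<subseteq> V" "keys u \<notin> X"
    and FP: "F \<in> polys V"
  shows "F - linear_field_term V (\<lambda>i j. if i = j then 0 else lookup (D j (var i)) 0) u \<in> I"
proof -
  define a where "a = (\<lambda>i j. if i = j then 0 else lookup (D j (var i)) 0)"
  have "lookup F w = lookup (linear_field_term V a u) w"
    if w: "keys w \<in> X" for w
  proof (cases "tdeg w = tdeg u")
    case False
    then have "lookup h w = 0" "lookup (linear_field_term V a u) w = 0"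
      using F(2) linear_field_term_homogeneous[of u V a] by (auto simp: homogeneous_tdeg in_keys_iff)
    then show ?thesis using cong_lookup[OF F(1) w] by simp
  next
    case True
    have "w \<noteq> u" using w u by auto
    then obtain v where v: "lookup u v < lookup w v"
      using exponent_exceeds[OF True] by blast
    then have vw: "v \<in> keys w" by (auto simp: in_keys_iff)
    then have vV: "v \<in> V" using w sub by auto
    define W where "W = V - {v}"
    define u' where "u' = drop_var v u"
    define w' where "w' = drop_var v w"
    have fW: "finite W" using finV by (simp add: W_def)
    have u'W: "keys u' \<subseteq> W" using u(1) by (auto simp: u'_def W_def keys_drop_var)
    have DW: "D v \<in> Der constants (poly_ring W)" using D[OF vV] by (simp add: W_def)
    have "lookup F w = lookup (D v (single u' 1)) w'"
      using lookup_local[OF F loc[OF vV] vV w vw True] by (simp add: dehom_single u'_def w'_def)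
    also have "\<dots> = (\<Sum>i\<in>W. lookup (single (u' - single i 1) (of_nat (lookup u' i)) * D v (var i)) w')"
      by (simp add: Der_monomial[OF fW DW u'W] lookup_sum)
    also have "\<dots> = (\<Sum>i\<in>W. if u - single i 1 + single v 1 = w then a i v * of_nat (lookup u i) else 0)"
    proof (rule sum.cong)
      fix i assume i: "i \<in> W"
      then have iv: "i \<noteq> v" by (simp add: W_def)
      then have u'i: "lookup u' i = lookup u i"
        by (simp add: u'_def lookup_update)
      define s where "s = u' - single i 1"
      let ?l = "lookup (single s (of_nat (lookup u i)) * D v (var i)) w'"
      let ?e = "u - single i 1 + single v 1"
      have ds: "drop_var v ?e = s"
        by (rule poly_mapping_eqI) (use iv in \<open>auto simp: s_def u'_def lookup_update lookup_add lookup_minus lookup_single when_def\<close>)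
      have "?l = (if ?e = w then a i v * of_nat (lookup u i) else 0)"
      proof (cases "lookup u i = 0")
        case True then show ?thesis by simp
      next
        case ui: False
        show ?thesis
        proof (cases "\<exists>x. w' = s + x")
          case True
          then obtain x where x: "w' = s + x" by blast
          have "u' = s + single i 1"
            unfolding s_def
            by (rule poly_mapping_eqI) (use ui u'i in \<open>auto simp: lookup_add lookup_minus lookup_single when_def\<close>)
          then have ts: "tdeg u' = tdeg s + 1" by (simp add: tdeg_add)
          have tw: "tdeg w = tdeg s + tdeg x + lookup w v"
            using tdeg_drop_var[of w v] x by (simp add: w'_def tdeg_add)
          have tu: "tdeg u = tdeg s + 1 + lookup u v"
            using tdeg_drop_var[of u v] ts by (simp add: u'_def)
          \<comment> \<open>The degrees leave no room: \<open>x\<close> has degree \<open>1 - (w\<^sub>v - u\<^sub>v)\<close>.\<close>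
          have "tdeg x = 0" and wv: "lookup w v = lookup u v + 1"
            using tw tu v \<open>tdeg w = tdeg u\<close> by auto
          then have x0: "x = 0" by (simp add: tdeg_eq_0_iff)
          have "lookup ?e v = lookup w v"
            using wv iv by (simp add: lookup_add lookup_minus lookup_single)
          then have te: "tdeg ?e = tdeg w"
            using tdeg_drop_var[of ?e v] tw x0 unfolding ds by simp
          have de: "drop_var v ?e = drop_var v w"
            unfolding ds w'_def[symmetric] x x0 by simp
          have "?e = w"
            by (rule drop_var_eqD[OF de te])
          moreover have "?l = of_nat (lookup u i) * lookup (D v (var i)) 0"
            unfolding x x0 by (rule lookup_monomial_mult_shift)
          ultimately show ?thesis using iv by (simp add: a_def)
        next
          case False
          then have "?e \<noteq> w" using ds by (metis add.right_neutral w'_def)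
          moreover have "?l = 0"
            by (rule lookup_monomial_mult_eq_0) (use False in auto)
          ultimately show ?thesis by simp
        qed
      qed
      then show "lookup (single (u' - single i 1) (of_nat (lookup u' i)) * D v (var i)) w'
          = (if ?e = w then a i v * of_nat (lookup u i) else 0)"
        by (simp add: u'i s_def)
    qed simp
    also have "\<dots> = (\<Sum>i\<in>V. if u - single i 1 + single v 1 = w then a i v * of_nat (lookup u i) else 0)"
      unfolding W_def by (rule sum.mono_neutral_left) (use finV in \<open>auto simp: a_def\<close>)
    also have "\<dots> = (\<Sum>i\<in>V. \<Sum>j\<in>V. if u - single i 1 + single j 1 = w then a i j * of_nat (lookup u i) else 0)"
    proof (rule sum.cong)
      fix i assume "i \<in> V"
      let ?t = "\<lambda>j. if u - single i 1 + single j 1 = w then a i j * of_nat (lookup u i) else 0"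
      have "?t j = 0" if "j \<noteq> v" for j
      proof -
        have "lookup (u - single i 1 + single j 1) v \<le> lookup u v"
          using that by (simp add: lookup_add lookup_minus lookup_single)
        with v have "u - single i 1 + single j 1 \<noteq> w"
          by (metis leD)
        then show ?thesis by simp
      qed
      then have "(\<Sum>j\<in>V. ?t j) = (\<Sum>j\<in>V. if j = v then ?t v else 0)"
        by (intro sum.cong) auto
      then show "?t v = (\<Sum>j\<in>V. ?t j)"
        using finV vV by simp
    qed simp
    also have "\<dots> = lookup (linear_field_term V a u) w"
      unfolding linear_field_term_def lookup_sum by (simp add: lookup_single when_def)
    finally show ?thesis .
  qed
  then show ?thesis
    using cong_iff[OF FP linear_field_term_in_poly_ring[OF u(1)], of a] by (simp add: a_def)
qed

theorem glue_derivations: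
  assumes F: "\<And>f. f \<in> I \<Longrightarrow> F f \<in> polys V"
    and add: "\<And>f g. f \<in> I \<Longrightarrow> g \<in> I \<Longrightarrow> F (f + g) - (F f + F g) \<in> I"
    and mult: "\<And>p f. p \<in> polys V \<Longrightarrow> f \<in> I \<Longrightarrow> F (p * f) - p * F f \<in> I"
    and hom: "\<And>c f. f \<in> I \<Longrightarrow> homogeneous c f \<Longrightarrow> \<exists>h. homogeneous c h \<and> F f - h \<in> I"
    and loc: "\<And>v. v \<in> V \<Longrightarrow> \<exists>D\<in>Der constants (poly_ring (V - {v})).
       \<forall>f\<in>I. dehom v (F f) - D (dehom v f) \<in> SR_ideal (V - {v}) (link v X)"
  shows "\<exists>D\<in>Der constants (poly_ring V). \<forall>f\<in>I. F f - D f \<in> I"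
proof -
  obtain D where D: "\<And>v. v \<in> V \<Longrightarrow> D v \<in> Der constants (poly_ring (V - {v}))"
    "\<And>v f. v \<in> V \<Longrightarrow> f \<in> I \<Longrightarrow> dehom v (F f) - D v (dehom v f) \<in> SR_ideal (V - {v}) (link v X)"
    using loc by metis
  define M where "M = linear_field_term V (\<lambda>i j. if i = j then 0 else lookup (D j (var i)) 0)"
  have M: "M t \<in> polys V" if "keys t \<subseteq> V" for t
    using linear_field_term_in_poly_ring[OF that] by (simp add: M_def)
  have mon: "F (single t 1) - M t \<in> I" if "keys t \<subseteq> V" "keys t \<notin> X" for t
  proof -
    have t: "single t 1 \<in> I" using that by (rule SR_idealI_monomial)
    obtain h where "homogeneous (tdeg t) h" "F (single t 1) - h \<in> I"
      using hom[OF t, of "tdeg t"] by (auto simp: homogeneous_tdeg)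
    then show ?thesis
      unfolding M_def using D t F that by (intro glue_derivations_monomial) auto
  qed
  have "F f - lin_ext M f \<in> I" if "f \<in> I" for f
  proof -
    have "keys f \<subseteq> {t. keys t \<subseteq> V \<and> keys t \<notin> X}"
      using that by (auto simp: mem_SR_ideal mem_poly_ring)
    then show ?thesis
    proof (induction f rule: monomial_induct)
      case zero
      show ?case using I_closed(4)[OF add[of 0 0]] I_closed(1) by simp
    next
      case (single t c)
      then have t: "single t 1 \<in> I" by (auto intro: SR_idealI_monomial)
      have "F (single 0 c * single t 1) - single 0 c * F (single t 1) \<in> I"
        using t by (intro mult) auto
      moreover have "single 0 c * F (single t 1) - single 0 c * M t \<in> I"
        using single mon by (intro cong_mult) auto
      ultimately show ?case
        using cong_trans by (force simp: lin_ext_single mult_single)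
    next
      case (add f g)
      then have "f \<in> I" "g \<in> I" by (auto simp: mem_SR_ideal mem_poly_ring)
      then show ?case
        using cong_trans[OF assms(2)[of f g] cong_add[OF add.IH]] by (simp add: lin_ext_add)
    qed
  qed
  moreover have "(\<lambda>f\<in>polys V. lin_ext M f) \<in> Der constants (poly_ring V)"
    by (rule lin_ext_Der) (auto simp: M_def linear_field_term_add linear_field_term_in_poly_ring)
  ultimately show ?thesis
    by (intro bexI[of _ "\<lambda>f\<in>polys V. lin_ext M f"]) (auto simp: I_carrier)
qed

end

section \<open>Gluing trivializations of extensions\<close>

text \<open>Only the first \<open>m\<close> entries matter, so that \<open>e\<close> may be given by any function and need not be
  restricted to \<open>{..<m}\<close>.\<close>

definition syzygy :: "nat set \<Rightarrow> nat \<Rightarrow> (nat \<Rightarrow> cpoly) \<Rightarrow> (nat \<Rightarrow> cpoly) \<Rightarrow> bool" where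
  "syzygy V m g e \<longleftrightarrow> (\<forall>k<m. e k \<in> polys V) \<and> (\<Sum>k<m. e k * g k) = 0"

lemma syzygy_add: "syzygy V m g e \<Longrightarrow> syzygy V m g e' \<Longrightarrow> syzygy V m g (\<lambda>k. e k + e' k)"
  by (simp add: syzygy_def distrib_right sum.distrib)

lemma syzygy_mult: "p \<in> polys V \<Longrightarrow> syzygy V m g e \<Longrightarrow> syzygy V m g (\<lambda>k. p * e k)"
  by (simp add: syzygy_def mult.assoc sum_distrib_left[symmetric])

lemma syzygy_0: "syzygy V m g (\<lambda>k. 0)"
  by (simp add: syzygy_def)

lemma syzygy_sum: "(\<And>j. j \<in> S \<Longrightarrow> syzygy V m g (e j)) \<Longrightarrow> syzygy V m g (\<lambda>k. \<Sum>j\<in>S. e j k)"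
  by (induction S rule: infinite_finite_induct) (auto simp: syzygy_0 syzygy_add)

lemma finite_exponents_of_degree:
  assumes "finite V"
  shows "finite {w. keys w \<subseteq> V \<and> tdeg w = d}"
proof -
  have "lookup w i \<le> d" if "tdeg w = d" for w i
    using tdeg_drop_var[of w i] that by simp
  then have "(\<lambda>w. restrict (lookup w) V) ` {w. keys w \<subseteq> V \<and> tdeg w = d} \<subseteq> V \<rightarrow>\<^sub>E {..d}"
    by auto
  moreover have "finite (V \<rightarrow>\<^sub>E {..d})"
    by (rule finite_PiE) (use assms in auto)
  ultimately have "finite ((\<lambda>w. restrict (lookup w) V) ` {w. keys w \<subseteq> V \<and> tdeg w = d})"
    by (rule finite_subset)
  moreover have "inj_on (\<lambda>w. restrict (lookup w) V) {w. keys w \<subseteq> V \<and> tdeg w = d}"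
  proof (rule inj_onI)
    fix w w' :: "nat \<Rightarrow>\<^sub>0 nat"
    assume w: "w \<in> {w. keys w \<subseteq> V \<and> tdeg w = d}" "w' \<in> {w. keys w \<subseteq> V \<and> tdeg w = d}"
      and eq: "restrict (lookup w) V = restrict (lookup w') V"
    show "w = w'"
    proof (rule poly_mapping_eqI)
      fix i
      show "lookup w i = lookup w' i"
      proof (cases "i \<in> V")
        case True
        then show ?thesis using fun_cong[OF eq, of i] by simp
      next
        case False
        then have "i \<notin> keys w" "i \<notin> keys w'" using w by auto
        then show ?thesis by (simp add: not_in_keys_iff_lookup_eq_zero)
      qed
    qed
  qed
  ultimately show ?thesis by (rule finite_imageD)
qed

text \<open>As \<open>f\<close> and the \<open>g k\<close> are homogeneous, the \<open>k\<close>-th entry may be replaced by its part of degree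
  \<open>a - d k\<close>.\<close>

lemma homogeneous_lift:
  assumes gh: "\<And>k. k < m \<Longrightarrow> homogeneous (d k) (g k)"
    and e: "\<And>k. k < m \<Longrightarrow> e k \<in> polys V" "(\<Sum>k<m. e k * g k) = f" "homogeneous a f"
  obtains e' where "\<And>k. k < m \<Longrightarrow> e' k \<in> polys V" "(\<Sum>k<m. e' k * g k) = f" "homogeneous_vec m d a e'"
proof
  define e' where "e' k = (if d k \<le> a then hom_part (a - d k) (e k) else 0)" for k
  show "e' k \<in> polys V" if "k < m" for k
    using e(1)[OF that] by (simp add: e'_def hom_part_in_poly_ring)
  have "e' k * g k = hom_part a (e k * g k)" if "k < m" for k
    using hom_part_mult_homogeneous[OF gh[OF that], of "a - d k" "e k"] hom_part_mult_eq_0[OF gh[OF that], of a "e k"]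
    by (auto simp: e'_def)
  then have "(\<Sum>k<m. e' k * g k) = hom_part a (\<Sum>k<m. e k * g k)"
    by (simp add: hom_part_sum)
  also have "\<dots> = f" using e(2) hom_part_homogeneous[OF e(3), of a] by simp
  finally show "(\<Sum>k<m. e' k * g k) = f" .
  show "homogeneous_vec m d a e'"
    by (auto simp: homogeneous_vec_tdeg e'_def keys_hom_part)
qed

context complex_on
begin

abbreviation "nonface_exponents \<equiv> {t :: nat \<Rightarrow>\<^sub>0 nat. keys t \<subseteq> V \<and> keys t \<notin> X}"

lemma nonface_exponents_add:
  "u \<in> nonface_exponents \<Longrightarrow> keys s \<subseteq> V \<Longrightarrow> s + u \<in> nonface_exponents"
  using down[of "keys (s + u)" "keys u"] by (auto simp: keys_add_exponent)

lemma keys_I: "f \<in> I \<longleftrightarrow> keys f \<subseteq> nonface_exponents"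
  by (auto simp: mem_SR_ideal mem_poly_ring)

end

text \<open>\<open>Q\<close> chooses polynomial representatives for the values of a homomorphism of degree 0 from the
  syzygies to \<open>P/I\<close>; it is linear and homogeneous only modulo \<open>I\<close>. By the last assumption this
  homomorphism extends to the free module over each chart.\<close>

locale degree_zero_syzygy_hom = complex_on +
  fixes m :: nat and g :: "nat \<Rightarrow> cpoly" and d :: "nat \<Rightarrow> nat" and Q :: "(nat \<Rightarrow> cpoly) \<Rightarrow> cpoly"
  assumes gI: "\<And>k. k < m \<Longrightarrow> g k \<in> SR_ideal V X"
    and gh: "\<And>k. k < m \<Longrightarrow> homogeneous (d k) (g k)"
    and gen: "\<And>f. f \<in> SR_ideal V X \<Longrightarrow> \<exists>e. (\<forall>k<m. e k \<in> polys V) \<and> (\<Sum>k<m. e k * g k) = f"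
    and Q: "\<And>e. syzygy V m g e \<Longrightarrow> Q e \<in> polys V"
    and Q_cong: "\<And>e e'. (\<And>k. k < m \<Longrightarrow> e k = e' k) \<Longrightarrow> Q e = Q e'"
    and Q_add: "\<And>e e'. syzygy V m g e \<Longrightarrow> syzygy V m g e' \<Longrightarrow> Q (\<lambda>k. e k + e' k) - (Q e + Q e') \<in> SR_ideal V X"
    and Q_mult: "\<And>p e. p \<in> polys V \<Longrightarrow> syzygy V m g e \<Longrightarrow> Q (\<lambda>k. p * e k) - p * Q e \<in> SR_ideal V X"
    and Q_hom: "\<And>c e. syzygy V m g e \<Longrightarrow> homogeneous_vec m d c e \<Longrightarrow> \<exists>h. homogeneous c h \<and> Q e - h \<in> SR_ideal V X"
    and Q_loc: "\<And>v. v \<in> V \<Longrightarrow> \<exists>b. (\<forall>k<m. b k \<in> polys (V - {v})) \<and>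
       (\<forall>e. syzygy V m g e \<longrightarrow> dehom v (Q e) - (\<Sum>k<m. dehom v (e k) * b k) \<in> SR_ideal (V - {v}) (link v X))"
begin

lemma Q_0: "Q (\<lambda>k. 0) \<in> I"
  using I_closed(4)[OF Q_add[OF syzygy_0 syzygy_0]] by simp

lemma Q_sum:
  "(\<And>j. j \<in> S \<Longrightarrow> syzygy V m g (e j)) \<Longrightarrow> Q (\<lambda>k. \<Sum>j\<in>S. e j k) - (\<Sum>j\<in>S. Q (e j)) \<in> I"
proof (induction S rule: infinite_finite_induct)
  case (insert j S)
  have "Q (\<lambda>k. e j k + (\<Sum>j\<in>S. e j k)) - (Q (e j) + Q (\<lambda>k. \<Sum>j\<in>S. e j k)) \<in> I"
    using insert.prems by (intro Q_add syzygy_sum) auto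
  moreover have "(Q (e j) + Q (\<lambda>k. \<Sum>j\<in>S. e j k)) - (Q (e j) + (\<Sum>j\<in>S. Q (e j))) \<in> I"
    using insert by (intro cong_add) (auto simp: I_closed)
  ultimately show ?case
    using insert.hyps cong_trans by simp
qed (simp_all add: Q_0)

lemma exists_homogeneous_lifts:
  "\<exists>\<beta>. \<forall>u\<in>nonface_exponents. (\<forall>k<m. \<beta> u k \<in> polys V) \<and>
     (\<Sum>k<m. \<beta> u k * g k) = single u 1 \<and> homogeneous_vec m d (tdeg u) (\<beta> u)"
proof (rule bchoice, rule ballI)
  fix u assume u: "u \<in> nonface_exponents"
  then obtain e where e: "\<forall>k<m. e k \<in> polys V" "(\<Sum>k<m. e k * g k) = single u 1"
    using gen[OF SR_idealI_monomial[of u 1]] by auto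
  show "\<exists>e. (\<forall>k<m. e k \<in> polys V) \<and> (\<Sum>k<m. e k * g k) = single u 1 \<and> homogeneous_vec m d (tdeg u) e"
  proof (rule homogeneous_lift[of m d g e V "single u 1" "tdeg u"])
    show "homogeneous (tdeg u) (single u 1)" by (simp add: homogeneous_tdeg)
  qed (use gh e in auto)
qed

definition monomial_lift :: "(nat \<Rightarrow>\<^sub>0 nat) \<Rightarrow> nat \<Rightarrow> cpoly" where
  "monomial_lift = (SOME \<beta>. \<forall>u\<in>nonface_exponents. (\<forall>k<m. \<beta> u k \<in> polys V) \<and>
     (\<Sum>k<m. \<beta> u k * g k) = single u 1 \<and> homogeneous_vec m d (tdeg u) (\<beta> u))"

lemma monomial_lift:
  assumes "u \<in> nonface_exponents"
  shows "k < m \<Longrightarrow> monomial_lift u k \<in> polys V"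
    and "(\<Sum>k<m. monomial_lift u k * g k) = single u 1"
    and "homogeneous_vec m d (tdeg u) (monomial_lift u)"
  using someI_ex[OF exists_homogeneous_lifts] assms unfolding monomial_lift_def by blast+

definition chart_coeffs :: "nat \<Rightarrow> nat \<Rightarrow> cpoly" where
  "chart_coeffs v = (SOME b. (\<forall>k<m. b k \<in> polys (V - {v})) \<and>
       (\<forall>e. syzygy V m g e \<longrightarrow> dehom v (Q e) - (\<Sum>k<m. dehom v (e k) * b k) \<in> SR_ideal (V - {v}) (link v X)))"

lemma chart_coeffs:
  assumes "v \<in> V"
  shows "k < m \<Longrightarrow> chart_coeffs v k \<in> polys (V - {v})"
    and "syzygy V m g e \<Longrightarrow> dehom v (Q e) - (\<Sum>k<m. dehom v (e k) * chart_coeffs v k) \<in> SR_ideal (V - {v}) (link v X)"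
  using someI_ex[OF Q_loc[OF assms]] unfolding chart_coeffs_def by blast+

definition chart_value :: "nat \<Rightarrow> (nat \<Rightarrow>\<^sub>0 nat) \<Rightarrow> cpoly" where
  "chart_value v u = (\<Sum>k<m. dehom v (monomial_lift u k) * chart_coeffs v k)"

text \<open>The choice depends on \<open>u\<close> and \<open>w\<close> only through \<open>w - u\<close>; hence \<open>growing_var_shift\<close>, which makes
  the chartwise choices of coefficients compatible with multiplication by monomials.\<close>

definition growing_var :: "(nat \<Rightarrow>\<^sub>0 nat) \<Rightarrow> (nat \<Rightarrow>\<^sub>0 nat) \<Rightarrow> nat" where
  "growing_var u w = (SOME v. lookup u v < lookup w v)"

definition glued_coeff :: "(nat \<Rightarrow>\<^sub>0 nat) \<Rightarrow> (nat \<Rightarrow>\<^sub>0 nat) \<Rightarrow> complex" where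
  "glued_coeff u w = (let v = growing_var u w in lookup (chart_value v u) (drop_var v w))"

text \<open>The value at \<open>x\<^sup>u\<close> of the map \<open>b : I \<rightarrow> P/I\<close> sought: each coefficient comes from the chart in which
  it is visible.\<close>

definition glued_value :: "(nat \<Rightarrow>\<^sub>0 nat) \<Rightarrow> cpoly" where
  "glued_value u = (\<Sum>w | keys w \<in> X \<and> tdeg w = tdeg u. single w (glued_coeff u w))"

lemma growing_var_shift: "growing_var (s + u) (s + w) = growing_var u w"
  by (simp add: growing_var_def lookup_add)

lemma glued_coeff_shift:
  assumes "v = growing_var u w"
  shows "glued_coeff u w = lookup (single (drop_var v s) 1 * chart_value v u) (drop_var v (s + w))"
  using assms by (simp add: glued_coeff_def Let_def drop_var_add lookup_monomial_mult_shift)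

lemma finite_exps: "finite {w. keys w \<in> X \<and> tdeg w = a}"
  by (rule finite_subset[OF _ finite_exponents_of_degree[OF finV, of a]]) (use sub in auto)

lemma lookup_glued_value:
  "lookup (glued_value u) w = (if keys w \<in> X \<and> tdeg w = tdeg u then glued_coeff u w else 0)"
proof -
  have "lookup (glued_value u) w
      = (\<Sum>x | keys x \<in> X \<and> tdeg x = tdeg u. if x = w then glued_coeff u w else 0)"
    unfolding glued_value_def lookup_sum by (rule sum.cong) (auto simp: lookup_single)
  then show ?thesis by (simp add: finite_exps)
qed

lemma glued_value_in_poly_ring: "glued_value u \<in> polys V"
  unfolding glued_value_def by (intro poly_ring_sum monomial_in_poly_ring) (use sub in auto)

definition lift_vec :: "cpoly \<Rightarrow> nat \<Rightarrow> cpoly" where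
  "lift_vec f k = lin_ext (\<lambda>u. monomial_lift u k) f"

definition cochain :: "cpoly \<Rightarrow> cpoly" where
  "cochain f = lin_ext glued_value f"

text \<open>The section \<open>lift_vec\<close> of \<open>P\<^sup>m \<rightarrow> I\<close> is linear over the complex numbers but not over \<open>P\<close>. The
  failure is a syzygy.\<close>

definition defect :: "cpoly \<Rightarrow> cpoly \<Rightarrow> nat \<Rightarrow> cpoly" where
  "defect p f k = lift_vec (p * f) k - p * lift_vec f k"

lemma lift_vec:
  assumes "f \<in> I"
  shows "k < m \<Longrightarrow> lift_vec f k \<in> polys V" and "(\<Sum>k<m. lift_vec f k * g k) = f"
proof -
  show "lift_vec f k \<in> polys V" if "k < m"
    unfolding lift_vec_def using assms monomial_lift(1)[OF _ that] by (intro lin_ext_in_poly_ring) (auto simp: keys_I)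
  from assms have "keys f \<subseteq> nonface_exponents" by (simp add: keys_I)
  then show "(\<Sum>k<m. lift_vec f k * g k) = f"
  proof (induction f rule: monomial_induct)
    case (single u c)
    then show ?case
      using monomial_lift(2)[of u]
      by (simp add: lift_vec_def lin_ext_single mult.assoc sum_distrib_left[symmetric] mult_single)
  qed (simp_all add: lift_vec_def lin_ext_add distrib_right sum.distrib)
qed

lemma defect_syzygy:
  assumes "p \<in> polys V" "f \<in> I"
  shows "syzygy V m g (defect p f)"
proof -
  have "p * f \<in> I" using assms by (simp add: I_closed)
  then show ?thesis
    using lift_vec[of f] lift_vec[of "p * f"] assms
    by (simp add: syzygy_def defect_def left_diff_distrib sum_subtractf mult.assoc sum_distrib_left[symmetric])
qed

lemma defect_single:
  "defect (single s c) (single u c') k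
     = single 0 (c * c') * defect (single s 1) (single u 1) k"
proof -
  have c: "single s c = single 0 c * single s 1"
    and c': "single 0 (c * c') = single 0 c * single (0::nat \<Rightarrow>\<^sub>0 nat) c'"
    by (simp_all add: mult_single)
  show ?thesis
    unfolding defect_def lift_vec_def mult_single lin_ext_single
    by (subst c, subst c', subst c') (simp add: algebra_simps)
qed

text \<open>Both sides are compared at an exponent \<open>w\<close> of the right degree in the chart of
  \<open>v = growing_var (s + u) w\<close>, where \<open>Q\<close> is given by the coefficients \<open>chart_coeffs v\<close>. The same
  chart is used for the coefficient of \<open>glued_value u\<close> at \<open>w - s\<close>.\<close>

lemma cochain_monomial:
  assumes u: "u \<in> nonface_exponents" and s: "keys s \<subseteq> V"
  shows "Q (defect (single s 1) (single u 1))
      - (glued_value (s + u) - single s 1 * glued_value u) \<in> I"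
proof -
  define \<epsilon> where "\<epsilon> = defect (single s 1) (single u 1)"
  have su: "s + u \<in> nonface_exponents" using u s by (rule nonface_exponents_add)
  have \<epsilon>: "\<epsilon> k = monomial_lift (s + u) k - single s 1 * monomial_lift u k" for k
    by (simp add: \<epsilon>_def defect_def lift_vec_def mult_single lin_ext_single)
  have syz: "syzygy V m g \<epsilon>"
    unfolding \<epsilon>_def using u s by (intro defect_syzygy monomial_in_poly_ring) (auto simp: keys_I)
  have "homogeneous_vec m d (tdeg (s + u)) \<epsilon>"
    unfolding homogeneous_vec_tdeg
  proof (intro allI impI ballI)
    fix k t assume k: "k < m" and "t \<in> keys (\<epsilon> k)"
    then have "t \<in> keys (monomial_lift (s + u) k) \<or> t \<in> keys (single s 1 * monomial_lift u k)"
      by (auto simp: \<epsilon> in_keys_iff lookup_minus)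
    then show "tdeg t + d k = tdeg (s + u)"
    proof
      assume "t \<in> keys (monomial_lift (s + u) k)"
      then show ?thesis using monomial_lift(3)[OF su] k by (auto simp: homogeneous_vec_tdeg)
    next
      assume "t \<in> keys (single s 1 * monomial_lift u k)"
      then obtain x where "t = s + x" "x \<in> keys (monomial_lift u k)"
        using keys_mult[of "single s 1" "monomial_lift u k"] by auto
      then show ?thesis using monomial_lift(3)[OF u] k by (auto simp: homogeneous_vec_tdeg tdeg_add)
    qed
  qed
  then obtain h where h: "homogeneous (tdeg (s + u)) h" "Q \<epsilon> - h \<in> I"
    using Q_hom[OF syz] by blast
  let ?R = "glued_value (s + u) - single s 1 * glued_value u"
  have "lookup (Q \<epsilon>) w = lookup ?R w" if w: "keys w \<in> X" for w
  proof (cases "tdeg w = tdeg (s + u)")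
    case False
    have "lookup (single s 1 * glued_value u) w = 0"
    proof (cases "\<exists>x. w = s + x")
      case True
      then obtain x where x: "w = s + x" by blast
      then have "tdeg x \<noteq> tdeg u" using False by (simp add: tdeg_add)
      then show ?thesis unfolding x lookup_monomial_mult_shift by (simp add: lookup_glued_value)
    qed (auto intro: lookup_monomial_mult_eq_0)
    moreover have "lookup h w = 0"
      using h(1) False by (auto simp: homogeneous_tdeg in_keys_iff)
    ultimately show ?thesis
      using False cong_lookup[OF h(2) w] by (simp add: lookup_minus lookup_glued_value)
  next
    case True
    have "w \<noteq> s + u" using w su by auto
    define v where "v = growing_var (s + u) w"
    have v: "lookup (s + u) v < lookup w v"
      unfolding v_def growing_var_def by (rule someI_ex, rule exponent_exceeds[OF True \<open>w \<noteq> s + u\<close>])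
    then have vw: "v \<in> keys w" by (auto simp: in_keys_iff)
    then have vV: "v \<in> V" using w sub by auto
    have "lookup (Q \<epsilon>) w = lookup (\<Sum>k<m. dehom v (\<epsilon> k) * chart_coeffs v k) (drop_var v w)"
      by (rule lookup_local[OF h(2,1) chart_coeffs(2)[OF vV syz] vV w vw True])
    also have "(\<Sum>k<m. dehom v (\<epsilon> k) * chart_coeffs v k)
        = chart_value v (s + u) - single (drop_var v s) 1 * chart_value v u"
      by (simp add: chart_value_def \<epsilon> dehom_minus dehom_mult dehom_single left_diff_distrib sum_subtractf
          sum_distrib_left mult.assoc)
    also have "lookup \<dots> (drop_var v w) = lookup ?R w"
    proof -
      have 1: "lookup (chart_value v (s + u)) (drop_var v w) = lookup (glued_value (s + u)) w"
        using w True by (simp add: lookup_glued_value glued_coeff_def Let_def v_def)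
      have "lookup (single (drop_var v s) 1 * chart_value v u) (drop_var v w)
          = lookup (single s 1 * glued_value u) w"
      proof (cases "\<exists>x. w = s + x")
        case x: True
        then obtain x where x: "w = s + x" by blast
        have "v = growing_var u x" by (simp add: v_def x growing_var_shift)
        then have "glued_coeff u x = lookup (single (drop_var v s) 1 * chart_value v u) (drop_var v w)"
          unfolding x by (rule glued_coeff_shift)
        moreover have "keys x \<in> X" using w down by (auto simp: x keys_add_exponent)
        moreover have "tdeg x = tdeg u" using True by (simp add: x tdeg_add)
        ultimately show ?thesis by (simp add: x lookup_monomial_mult_shift lookup_glued_value)
      next
        case nx: False
        \<comment> \<open>The exponent of \<open>x\<^sub>v\<close> in \<open>s\<close> is smaller than in \<open>w\<close>, so divisibility by \<open>x\<^sup>s\<close> is not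
          gained by setting \<open>x\<^sub>v = 1\<close>.\<close>
        have "drop_var v w \<noteq> drop_var v s + x" for x
        proof
          assume eq: "drop_var v w = drop_var v s + x"
          have "w = s + (w - s)"
          proof (rule poly_mapping_eqI)
            fix i
            have "lookup s i \<le> lookup w i"
              using arg_cong[OF eq, of "\<lambda>t. lookup t i"] v
              by (cases "i = v") (auto simp: lookup_update lookup_add)
            then show "lookup w i = lookup (s + (w - s)) i"
              by (simp add: lookup_add lookup_minus)
          qed
          then show False using nx by blast
        qed
        then show ?thesis using nx by (auto simp: lookup_monomial_mult_eq_0)
      qed
      with 1 show ?thesis by (simp add: lookup_minus)
    qed
    finally show ?thesis .
  qed
  moreover have "?R \<in> polys V"
    using s by (intro poly_ring_closed glued_value_in_poly_ring monomial_in_poly_ring)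
  ultimately have "Q \<epsilon> - ?R \<in> I"
    using cong_iff[OF Q[OF syz]] by blast
  then show ?thesis by (simp add: \<epsilon>_def)
qed

lemma cochain_defect:
  assumes p: "p \<in> polys V" and f: "f \<in> I"
  shows "Q (defect p f) - (cochain (p * f) - p * cochain f) \<in> I"
proof -
  have "keys p \<subseteq> {t. keys t \<subseteq> V}" using p by (auto simp: mem_poly_ring)
  then show ?thesis
  proof (induction p rule: monomial_induct)
    case zero
    have "defect 0 f = (\<lambda>k. 0)" by (simp add: defect_def lift_vec_def fun_eq_iff)
    then show ?case by (simp add: Q_0 cochain_def)
  next
    case (add p q)
    then have pq: "p \<in> polys V" "q \<in> polys V" by (auto simp: mem_poly_ring)
    have "defect (p + q) f = (\<lambda>k. defect p f k + defect q f k)"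
      by (simp add: defect_def lift_vec_def fun_eq_iff distrib_right lin_ext_add)
    then have "Q (defect (p + q) f) - (Q (defect p f) + Q (defect q f)) \<in> I"
      using Q_add[OF defect_syzygy[OF pq(1) f] defect_syzygy[OF pq(2) f]] by simp
    from cong_trans[OF this cong_add[OF add.IH]] show ?case
      by (simp add: cochain_def lin_ext_add algebra_simps)
  next
    case (single s c)
    then have s: "keys s \<subseteq> V" by simp
    have sc: "single s c' \<in> polys V" for c' using s by (rule monomial_in_poly_ring)
    from f have "keys f \<subseteq> nonface_exponents" by (simp add: keys_I)
    then show ?case
    proof (induction f rule: monomial_induct)
      case zero
      have "defect (single s c) 0 = (\<lambda>k. 0)" by (simp add: defect_def lift_vec_def fun_eq_iff)
      then show ?case by (simp add: Q_0 cochain_def)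
    next
      case (add f h)
      then have fh: "f \<in> I" "h \<in> I" by (auto simp: keys_I)
      have "defect (single s c) (f + h) = (\<lambda>k. defect (single s c) f k + defect (single s c) h k)"
        by (simp add: defect_def lift_vec_def fun_eq_iff distrib_left lin_ext_add)
      then have "Q (defect (single s c) (f + h)) - (Q (defect (single s c) f) + Q (defect (single s c) h)) \<in> I"
        using Q_add[OF defect_syzygy[OF sc fh(1)] defect_syzygy[OF sc fh(2)]] by simp
      from cong_trans[OF this cong_add[OF add.IH]] show ?case
        by (simp add: cochain_def lin_ext_add algebra_simps)
    next
      case (single u c')
      let ?\<epsilon> = "defect (single s 1) (single u 1)"
      let ?r = "glued_value (s + u) - single s 1 * glued_value u"
      have eq: "defect (single s c) (single u c') = (\<lambda>k. single 0 (c * c') * ?\<epsilon> k)"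
        by (rule ext) (rule defect_single)
      have "Q (\<lambda>k. single 0 (c * c') * ?\<epsilon> k) - single 0 (c * c') * Q ?\<epsilon> \<in> I"
        using single sc by (intro Q_mult defect_syzygy) (auto simp: keys_I)
      moreover have "single 0 (c * c') * Q ?\<epsilon> - single 0 (c * c') * ?r \<in> I"
        using single s by (intro cong_mult cochain_monomial) auto
      moreover have "single 0 (c * c') * ?r
          = cochain (single s c * single u c') - single s c * cochain (single u c')"
      proof -
        have "single 0 (c * c') * (single s 1 * glued_value u)
            = single s c * (single 0 c' * glued_value u)"
          by (simp add: mult.assoc[symmetric] mult_single)
        then show ?thesis
          by (simp add: cochain_def mult_single lin_ext_single right_diff_distrib)
      qed
      ultimately show ?case
        unfolding eq using cong_trans by metis
    qed
  qed
qed

text \<open>The value on the \<open>k\<close>-th basis vector \<open>e\<^sub>k\<close> comes from the decomposition into the syzygy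
  \<open>e\<^sub>k - lift_vec (g k)\<close> and \<open>lift_vec (g k)\<close>, on which \<open>cochain\<close> prescribes the extension. A
  syzygy \<open>e\<close> is the combination of the former syzygies with coefficients \<open>e k\<close>, minus the sum of the
  defects of \<open>e k\<close> and \<open>g k\<close>.\<close>

theorem glue_extensions:
  "\<exists>b. (\<forall>k<m. b k \<in> polys V) \<and> (\<forall>e. syzygy V m g e \<longrightarrow> Q e - (\<Sum>k<m. e k * b k) \<in> I)"
proof -
  define \<eta> where "\<eta> k k' = (if k' = k then 1 else 0) - lift_vec (g k) k'" for k k' :: nat
  define b where "b k = Q (\<eta> k) + cochain (g k)" for k
  have syz: "syzygy V m g (\<eta> k)" if k: "k < m" for k
  proof -
    have "(\<Sum>k'<m. \<eta> k k' * g k') = (\<Sum>k'<m. if k' = k then g k else 0) - (\<Sum>k'<m. lift_vec (g k) k' * g k')"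
      unfolding \<eta>_def left_diff_distrib sum_subtractf by (intro arg_cong2[of _ _ _ _ "(-)"] sum.cong) auto
    also have "\<dots> = 0"
      using k lift_vec(2)[OF gI[OF k]] by simp
    finally show ?thesis
      using lift_vec(1)[OF gI[OF k]] by (auto simp: syzygy_def \<eta>_def)
  qed
  have bP: "b k \<in> polys V" if "k < m" for k
    unfolding b_def cochain_def using Q[OF syz[OF that]]
    by (intro poly_ring_closed lin_ext_in_poly_ring glued_value_in_poly_ring) auto
  have "Q e - (\<Sum>k<m. e k * b k) \<in> I" if e: "syzygy V m g e" for e
  proof -
    have eP: "e k \<in> polys V" if "k < m" for k using e that by (simp add: syzygy_def)
    have e0: "(\<Sum>k<m. e k * g k) = 0" using e by (simp add: syzygy_def)
    define \<delta> where "\<delta> k = defect (e k) (g k)" for k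
    have \<delta>s: "syzygy V m g (\<delta> k)" if "k < m" for k
      unfolding \<delta>_def by (intro defect_syzygy eP gI that)
    have n1: "(- 1 :: cpoly) \<in> polys V" by auto
    have "e k' = (\<Sum>k<m. e k * \<eta> k k' + (- 1) * \<delta> k k')" if k': "k' < m" for k'
    proof -
      have "(\<Sum>k<m. e k * \<eta> k k' + (- 1) * \<delta> k k')
          = (\<Sum>k<m. (if k = k' then e k' else 0) - lift_vec (e k * g k) k')"
        by (rule sum.cong) (auto simp: \<eta>_def \<delta>_def defect_def algebra_simps)
      also have "\<dots> = e k' - lift_vec (\<Sum>k<m. e k * g k) k'"
        using k' by (simp add: sum_subtractf lift_vec_def lin_ext_sum)
      finally show ?thesis by (simp add: e0 lift_vec_def)
    qed
    then have A: "Q e = Q (\<lambda>k'. \<Sum>k<m. e k * \<eta> k k' + (- 1) * \<delta> k k')"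
      by (rule Q_cong)
    have B: "Q (\<lambda>k'. \<Sum>k<m. e k * \<eta> k k' + (- 1) * \<delta> k k')
        - (\<Sum>k<m. Q (\<lambda>k'. e k * \<eta> k k' + (- 1) * \<delta> k k')) \<in> I"
      by (intro Q_sum syzygy_add syzygy_mult syz \<delta>s eP n1) auto
    have C: "(\<Sum>k<m. Q (\<lambda>k'. e k * \<eta> k k' + (- 1) * \<delta> k k'))
        - (\<Sum>k<m. e k * b k - cochain (e k * g k)) \<in> I"
    proof (intro cong_sum)
      fix k assume "k \<in> {..<m}"
      then have k: "k < m" by simp
      have A: "Q (\<lambda>k'. e k * \<eta> k k' + (- 1) * \<delta> k k') - (Q (\<lambda>k'. e k * \<eta> k k') + Q (\<lambda>k'. (- 1) * \<delta> k k')) \<in> I"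
        by (intro Q_add syzygy_mult syz \<delta>s eP k n1)
      have B: "(Q (\<lambda>k'. e k * \<eta> k k') + Q (\<lambda>k'. (- 1) * \<delta> k k')) - (e k * Q (\<eta> k) + (- 1) * Q (\<delta> k)) \<in> I"
        by (intro cong_add Q_mult syz \<delta>s eP k n1)
      have C: "(e k * Q (\<eta> k) + (- 1) * Q (\<delta> k))
          - (e k * Q (\<eta> k) + (- 1) * (cochain (e k * g k) - e k * cochain (g k))) \<in> I"
        using cong_mult[OF n1 cochain_defect[OF eP[OF k] gI[OF k]]] I_closed(1)
        unfolding \<delta>_def by (intro cong_add) auto
      have D: "e k * Q (\<eta> k) + (- 1) * (cochain (e k * g k) - e k * cochain (g k)) = e k * b k - cochain (e k * g k)"
        by (simp add: b_def algebra_simps)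
      show "Q (\<lambda>k'. e k * \<eta> k k' + (- 1) * \<delta> k k') - (e k * b k - cochain (e k * g k)) \<in> I"
        using cong_trans[OF cong_trans[OF A B] C] unfolding D .
    qed
    have D: "(\<Sum>k<m. e k * b k - cochain (e k * g k)) = (\<Sum>k<m. e k * b k)"
      unfolding sum_subtractf cochain_def lin_ext_sum[symmetric] e0 by simp
    show ?thesis using cong_trans[OF B C] unfolding A[symmetric] D .
  qed
  then show ?thesis using bP by blast
qed

end

section \<open>Cokernels and the maps between them\<close>

lemma additive_subgroup_if_differences:
  fixes G (structure)
  assumes G: "abelian_group G" and sub: "B \<subseteq> carrier G" and ne: "B \<noteq> {}"
    and diff: "\<And>x y. x \<in> B \<Longrightarrow> y \<in> B \<Longrightarrow> \<exists>z\<in>B. z \<oplus> y = x"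
  shows "additive_subgroup B G"
proof -
  interpret abelian_group G by (rule G)
  have diff': "x \<ominus> y \<in> B" if xy: "x \<in> B" "y \<in> B" for x y
  proof -
    obtain z where z: "z \<in> B" "z \<oplus> y = x" using diff[OF xy] by blast
    have "z \<oplus> y \<oplus> \<ominus> y = z" using z(1) xy sub by (simp add: a_assoc r_neg subset_iff)
    then show ?thesis using z by (simp add: a_minus_def)
  qed
  obtain b where b: "b \<in> B" using ne by blast
  have 0: "\<zero> \<in> B"
    using diff'[OF b b] b sub by (auto simp: a_minus_def r_neg)
  have neg: "\<ominus> x \<in> B" if "x \<in> B" for x
    using diff'[OF 0 that] that sub by (auto simp: a_minus_def)
  have add: "x \<oplus> y \<in> B" if "x \<in> B" "y \<in> B" for x y
    using diff'[OF that(1) neg[OF that(2)]] that sub by (auto simp: a_minus_def)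
  show ?thesis
    by (rule additive_subgroupI, unfold_locales)
       (use sub 0 neg add in \<open>auto simp: a_inv_def[symmetric]\<close>)
qed

text \<open>A homomorphism into a finite product of quotients is injective on the classes of \<open>Z\<close> if the
  elements of \<open>Z\<close> with trivial images are trivial, provided \<open>Z\<close> is closed under differences. The
  assumption on differences is phrased as solvability of an equation, so that no formula for
  inverses in \<open>G\<close> is required.\<close>

lemma coset_family_mon:
  fixes G :: "('a, 'b) ring_scheme" and H :: "nat \<Rightarrow> ('c, 'd) ring_scheme"
  assumes G: "abelian_group G" and B: "additive_subgroup B G"
    and H: "\<And>v. v \<in> S \<Longrightarrow> abelian_group (H v)" and C: "\<And>v. v \<in> S \<Longrightarrow> additive_subgroup (C v) (H v)"
    and L: "\<And>v x. v \<in> S \<Longrightarrow> x \<in> carrier G \<Longrightarrow> L v x \<in> carrier (H v)"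
    and L_add: "\<And>v x y. v \<in> S \<Longrightarrow> x \<in> carrier G \<Longrightarrow> y \<in> carrier G \<Longrightarrow> L v (x \<oplus>\<^bsub>G\<^esub> y) = L v x \<oplus>\<^bsub>H v\<^esub> L v y"
    and L_B: "\<And>v x. v \<in> S \<Longrightarrow> x \<in> B \<Longrightarrow> L v x \<in> C v"
    and Z: "Z \<subseteq> carrier G" and Z_diff: "\<And>x y. x \<in> Z \<Longrightarrow> y \<in> Z \<Longrightarrow> \<exists>z\<in>Z. z \<oplus>\<^bsub>G\<^esub> y = x"
    and inj: "\<And>z. z \<in> Z \<Longrightarrow> (\<And>v. v \<in> S \<Longrightarrow> L v z \<in> C v) \<Longrightarrow> z \<in> B"
    and S: "finite S"
  shows "(\<lambda>t. \<lambda>v\<in>S. the_elem ((\<lambda>x. C v +>\<^bsub>H v\<^esub> L v x) ` t))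
    \<in> mon ((G A_Mod B)\<lparr>carrier := {B +>\<^bsub>G\<^esub> x |x. x \<in> Z}\<rparr>) (sum_group S (\<lambda>v. H v A_Mod C v))"
proof -
  interpret G: abelian_group G by (rule G)
  interpret B: abelian_subgroup B G by (rule abelian_subgroupI3[OF B G])
  let ?\<Phi> = "\<lambda>t. \<lambda>v\<in>S. the_elem ((\<lambda>x. C v +>\<^bsub>H v\<^esub> L v x) ` t)"
  have sg: "abelian_subgroup (C v) (H v)" if "v \<in> S" for v
    by (rule abelian_subgroupI3[OF C[OF that] H[OF that]])
  have eqI: "C v +>\<^bsub>H v\<^esub> (c \<oplus>\<^bsub>H v\<^esub> y) = C v +>\<^bsub>H v\<^esub> y" if v: "v \<in> S" and "c \<in> C v" "y \<in> carrier (H v)" for v c y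
  proof -
    interpret C: abelian_subgroup "C v" "H v" by (rule sg[OF v])
    have "c \<oplus>\<^bsub>H v\<^esub> y \<in> C v +>\<^bsub>H v\<^esub> y" using that by (auto simp: a_r_coset_def')
    then show ?thesis using that(3) C.a_repr_independence' by blast
  qed
  have val: "the_elem ((\<lambda>x. C v +>\<^bsub>H v\<^esub> L v x) ` (B +>\<^bsub>G\<^esub> x)) = C v +>\<^bsub>H v\<^esub> L v x"
    if v: "v \<in> S" and x: "x \<in> carrier G" for v x
  proof -
    have "C v +>\<^bsub>H v\<^esub> L v y = C v +>\<^bsub>H v\<^esub> L v x" if y: "y \<in> B +>\<^bsub>G\<^esub> x" for y
    proof -
      obtain b where b: "b \<in> B" "y = b \<oplus>\<^bsub>G\<^esub> x" using y by (auto simp: a_r_coset_def')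
      then show ?thesis
        using eqI[OF v L_B[OF v b(1)] L[OF v x]] L_add[OF v _ x, of b] B.a_subset by auto
    qed
    moreover have "x \<in> B +>\<^bsub>G\<^esub> x" using x by (rule B.a_rcos_self)
    ultimately have "(\<lambda>x. C v +>\<^bsub>H v\<^esub> L v x) ` (B +>\<^bsub>G\<^esub> x) = {C v +>\<^bsub>H v\<^esub> L v x}" by blast
    then show ?thesis by simp
  qed
  have grp: "group (H v A_Mod C v)" if "v \<in> S" for v
    using abelian_subgroup.a_factorgroup_is_group[OF sg[OF that]] .
  have carr: "C v +>\<^bsub>H v\<^esub> y \<in> carrier (H v A_Mod C v)" if "y \<in> carrier (H v)" for v y
    using that by (auto simp: A_FactGroup_def' A_RCOSETS_def')
  have Phi: "?\<Phi> (B +>\<^bsub>G\<^esub> x) = (\<lambda>v\<in>S. C v +>\<^bsub>H v\<^esub> L v x)" if "x \<in> carrier G" for x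
    by (rule restrict_ext) (rule val[OF _ that])
  show ?thesis
    unfolding mon_def
  proof (intro CollectI conjI homI inj_onI)
    fix t assume "t \<in> carrier ((G A_Mod B)\<lparr>carrier := {B +>\<^bsub>G\<^esub> x |x. x \<in> Z}\<rparr>)"
    then obtain x where x: "x \<in> Z" "t = B +>\<^bsub>G\<^esub> x" by auto
    then have "x \<in> carrier G" using Z by blast
    then show "?\<Phi> t \<in> carrier (sum_group S (\<lambda>v. H v A_Mod C v))"
      unfolding x(2) Phi[OF \<open>x \<in> carrier G\<close>]
      using S L carr by (auto simp: carrier_sum_group[OF grp])
  next
    fix t t' assume "t \<in> carrier ((G A_Mod B)\<lparr>carrier := {B +>\<^bsub>G\<^esub> x |x. x \<in> Z}\<rparr>)"
      "t' \<in> carrier ((G A_Mod B)\<lparr>carrier := {B +>\<^bsub>G\<^esub> x |x. x \<in> Z}\<rparr>)"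
    then obtain x x' where x: "x \<in> Z" "t = B +>\<^bsub>G\<^esub> x" "x' \<in> Z" "t' = B +>\<^bsub>G\<^esub> x'" by auto
    then have xc: "x \<in> carrier G" "x' \<in> carrier G" using Z by auto
    have tt: "t \<otimes>\<^bsub>(G A_Mod B)\<lparr>carrier := {B +>\<^bsub>G\<^esub> x |x. x \<in> Z}\<rparr>\<^esub> t' = B +>\<^bsub>G\<^esub> (x \<oplus>\<^bsub>G\<^esub> x')"
      using B.a_rcos_sum[OF xc] by (simp add: A_FactGroup_def' x)
    have "(C v +>\<^bsub>H v\<^esub> L v x) \<otimes>\<^bsub>H v A_Mod C v\<^esub> (C v +>\<^bsub>H v\<^esub> L v x') = C v +>\<^bsub>H v\<^esub> L v (x \<oplus>\<^bsub>G\<^esub> x')" if v: "v \<in> S" for v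
      using abelian_subgroup.a_rcos_sum[OF sg[OF v] L[OF v xc(1)] L[OF v xc(2)]] L_add[OF v xc]
      by (simp add: A_FactGroup_def')
    then show "?\<Phi> (t \<otimes>\<^bsub>(G A_Mod B)\<lparr>carrier := {B +>\<^bsub>G\<^esub> x |x. x \<in> Z}\<rparr>\<^esub> t')
        = ?\<Phi> t \<otimes>\<^bsub>sum_group S (\<lambda>v. H v A_Mod C v)\<^esub> ?\<Phi> t'"
      unfolding tt unfolding x(2,4) Phi[OF xc(1)] Phi[OF xc(2)] Phi[OF G.a_closed[OF xc]] mult_sum_group
      by (intro restrict_ext) simp
  next
    fix t t' assume "t \<in> carrier ((G A_Mod B)\<lparr>carrier := {B +>\<^bsub>G\<^esub> x |x. x \<in> Z}\<rparr>)"
      "t' \<in> carrier ((G A_Mod B)\<lparr>carrier := {B +>\<^bsub>G\<^esub> x |x. x \<in> Z}\<rparr>)" and eq: "?\<Phi> t = ?\<Phi> t'"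
    then obtain x x' where x: "x \<in> Z" "t = B +>\<^bsub>G\<^esub> x" "x' \<in> Z" "t' = B +>\<^bsub>G\<^esub> x'" by auto
    then have xc: "x \<in> carrier G" "x' \<in> carrier G" using Z by auto
    obtain z where z: "z \<in> Z" "z \<oplus>\<^bsub>G\<^esub> x' = x" using Z_diff[OF x(1,3)] by blast
    have zc: "z \<in> carrier G" using z Z by blast
    have "L v z \<in> C v" if v: "v \<in> S" for v
    proof -
      interpret C: abelian_subgroup "C v" "H v" by (rule sg[OF v])
      have "C v +>\<^bsub>H v\<^esub> L v x = C v +>\<^bsub>H v\<^esub> L v x'"
        using fun_cong[OF eq, of v] v val[OF v xc(1)] val[OF v xc(2)] unfolding x(2,4) by (simp only: restrict_apply' if_True)
      then have "L v x \<in> C v +>\<^bsub>H v\<^esub> L v x'" using C.a_rcos_self[OF L[OF v xc(1)]] by simp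
      then obtain c where c: "c \<in> C v" "L v x = c \<oplus>\<^bsub>H v\<^esub> L v x'" by (auto simp: a_r_coset_def')
      have "L v z \<oplus>\<^bsub>H v\<^esub> L v x' = c \<oplus>\<^bsub>H v\<^esub> L v x'"
        using L_add[OF v zc xc(2)] z(2) c(2) by simp
      then have "L v z = c"
        using C.a_subset c(1) L[OF v zc] L[OF v xc(2)] by (simp add: subset_iff)
      then show ?thesis using c(1) by simp
    qed
    then have "z \<in> B" using inj[OF z(1)] by blast
    then have "x \<in> B +>\<^bsub>G\<^esub> x'" using z(2) by (auto simp: a_r_coset_def')
    then show "t = t'" unfolding x(2,4) using B.a_repr_independence'[OF _ xc(2)] by simp
  qed
qed

lemma Hom_module_abelian_group:
  fixes R :: "('r, 's) ring_scheme" and M :: "('r, 'a) module" and N :: "('r, 'b) module"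
  assumes N: "abelian_group N"
    and sm: "\<And>r a. r \<in> carrier R \<Longrightarrow> a \<in> carrier N \<Longrightarrow> r \<odot>\<^bsub>N\<^esub> a \<in> carrier N"
    and dist: "\<And>r a b. r \<in> carrier R \<Longrightarrow> a \<in> carrier N \<Longrightarrow> b \<in> carrier N \<Longrightarrow>
      r \<odot>\<^bsub>N\<^esub> (a \<oplus>\<^bsub>N\<^esub> b) = r \<odot>\<^bsub>N\<^esub> a \<oplus>\<^bsub>N\<^esub> r \<odot>\<^bsub>N\<^esub> b"
    and M_add: "\<And>x y. x \<in> carrier M \<Longrightarrow> y \<in> carrier M \<Longrightarrow> x \<oplus>\<^bsub>M\<^esub> y \<in> carrier M"
    and M_sm: "\<And>r x. r \<in> carrier R \<Longrightarrow> x \<in> carrier M \<Longrightarrow> r \<odot>\<^bsub>M\<^esub> x \<in> carrier M"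
  shows "abelian_group (Hom_module R M N)"
proof -
  interpret N: abelian_group N by (rule N)
  have sm0: "r \<odot>\<^bsub>N\<^esub> \<zero>\<^bsub>N\<^esub> = \<zero>\<^bsub>N\<^esub>" if r: "r \<in> carrier R" for r
  proof -
    have "r \<odot>\<^bsub>N\<^esub> \<zero>\<^bsub>N\<^esub> \<oplus>\<^bsub>N\<^esub> r \<odot>\<^bsub>N\<^esub> \<zero>\<^bsub>N\<^esub> = \<zero>\<^bsub>N\<^esub> \<oplus>\<^bsub>N\<^esub> r \<odot>\<^bsub>N\<^esub> \<zero>\<^bsub>N\<^esub>"
      using dist[OF r N.zero_closed N.zero_closed] sm[OF r N.zero_closed] by simp
    then show ?thesis using sm[OF r N.zero_closed] by (simp only: N.add.right_cancel N.zero_closed)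
  qed
  have smneg: "r \<odot>\<^bsub>N\<^esub> (\<ominus>\<^bsub>N\<^esub> a) = \<ominus>\<^bsub>N\<^esub> (r \<odot>\<^bsub>N\<^esub> a)" if r: "r \<in> carrier R" and a: "a \<in> carrier N" for r a
  proof -
    have "r \<odot>\<^bsub>N\<^esub> (\<ominus>\<^bsub>N\<^esub> a) \<oplus>\<^bsub>N\<^esub> r \<odot>\<^bsub>N\<^esub> a = \<zero>\<^bsub>N\<^esub>"
      using dist[OF r N.a_inv_closed[OF a] a] a sm0[OF r] by (simp add: N.l_neg)
    then show ?thesis
      using N.minus_equality sm r a by (metis N.a_inv_closed)
  qed
  let ?H = "Hom_module R M N"
  have mem: "h \<in> carrier ?H \<longleftrightarrow> h \<in> extensional (carrier M) \<and> (\<forall>x\<in>carrier M. h x \<in> carrier N) \<and>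
      (\<forall>x\<in>carrier M. \<forall>y\<in>carrier M. h (x \<oplus>\<^bsub>M\<^esub> y) = h x \<oplus>\<^bsub>N\<^esub> h y) \<and>
      (\<forall>r\<in>carrier R. \<forall>x\<in>carrier M. h (r \<odot>\<^bsub>M\<^esub> x) = r \<odot>\<^bsub>N\<^esub> h x)" for h
    by (auto simp: Hom_module_def module_homs_def PiE_iff)
  have add: "h \<oplus>\<^bsub>?H\<^esub> h' = (\<lambda>x\<in>carrier M. h x \<oplus>\<^bsub>N\<^esub> h' x)" for h h'
    by (simp add: Hom_module_def)
  have zero: "\<zero>\<^bsub>?H\<^esub> = (\<lambda>x\<in>carrier M. \<zero>\<^bsub>N\<^esub>)"
    by (simp add: Hom_module_def)
  show ?thesis
  proof (rule abelian_groupI)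
    fix h h' assume h: "h \<in> carrier ?H" and h': "h' \<in> carrier ?H"
    show "h \<oplus>\<^bsub>?H\<^esub> h' \<in> carrier ?H"
      unfolding mem[of "h \<oplus>\<^bsub>?H\<^esub> h'"] add
      using h h' unfolding mem by (simp add: M_add M_sm dist sm N.a_ac)
    show "h \<oplus>\<^bsub>?H\<^esub> h' = h' \<oplus>\<^bsub>?H\<^esub> h"
      unfolding add using h h' unfolding mem by (intro restrict_ext) (simp add: N.a_comm)
  next
    show "\<zero>\<^bsub>?H\<^esub> \<in> carrier ?H"
      unfolding mem zero by (simp add: M_add M_sm sm0)
  next
    fix h h' h'' assume "h \<in> carrier ?H" "h' \<in> carrier ?H" "h'' \<in> carrier ?H"
    then show "h \<oplus>\<^bsub>?H\<^esub> h' \<oplus>\<^bsub>?H\<^esub> h'' = h \<oplus>\<^bsub>?H\<^esub> (h' \<oplus>\<^bsub>?H\<^esub> h'')"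
      unfolding add mem by (intro restrict_ext) (simp add: N.a_assoc)
  next
    fix h assume h: "h \<in> carrier ?H"
    show "\<zero>\<^bsub>?H\<^esub> \<oplus>\<^bsub>?H\<^esub> h = h"
      using h unfolding add zero mem by (intro extensionalityI[of _ "carrier M"]) auto
    let ?n = "\<lambda>x\<in>carrier M. \<ominus>\<^bsub>N\<^esub> h x"
    have "?n \<in> carrier ?H"
      using h unfolding mem by (simp add: M_add M_sm smneg N.minus_add)
    moreover have "?n \<oplus>\<^bsub>?H\<^esub> h = \<zero>\<^bsub>?H\<^esub>"
      using h unfolding add zero mem by (intro restrict_ext) (simp add: N.l_neg)
    ultimately show "\<exists>n\<in>carrier ?H. n \<oplus>\<^bsub>?H\<^esub> h = \<zero>\<^bsub>?H\<^esub>" by blast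
  qed
qed

lemma abelian_group_cong:
  assumes "abelian_group G" "carrier H = carrier G" "add H = add G" "zero H = zero G"
  shows "abelian_group H"
proof -
  interpret abelian_group G by (rule assms(1))
  show ?thesis
    by (rule abelian_groupI) (auto simp: assms(2-4) a_ac intro: l_neg)
qed

section \<open>Residue classes\<close>

context complex_on
begin

abbreviation cls :: "cpoly \<Rightarrow> cpoly set" where
  "cls f \<equiv> I +>\<^bsub>poly_ring V\<^esub> f"

lemma mem_cls: "h \<in> cls f \<longleftrightarrow> h - f \<in> I"
  by (auto simp: a_r_coset_def' intro!: bexI[of _ "h - f"])

lemma cls_eq_iff: "cls f = cls h \<longleftrightarrow> f - h \<in> I"
proof
  assume "cls f = cls h"
  moreover have "f \<in> cls f" by (simp add: mem_cls I_closed)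
  ultimately show "f - h \<in> I" using mem_cls by blast
next
  assume "f - h \<in> I"
  then show "cls f = cls h"
    using cong_trans[OF _ \<open>f - h \<in> I\<close>] cong_trans[OF _ cong_sym[OF \<open>f - h \<in> I\<close>]]
    unfolding set_eq_iff mem_cls by blast
qed

lemma carrier_quot: "carrier (poly_ring V Quot I) = cls ` polys V"
  by (auto simp: FactRing_def A_RCOSETS_def')

lemma quot_ring: "cring (poly_ring V Quot I)"
  by (rule ideal.quotient_is_cring[OF SR_ideal_is_ideal poly_ring_cring])

lemma cls_add:
  "f \<in> polys V \<Longrightarrow> h \<in> polys V \<Longrightarrow> cls f \<oplus>\<^bsub>poly_ring V Quot I\<^esub> cls h = cls (f + h)"
  using abelian_subgroup.a_rcos_sum[OF abelian_subgroupI3, of I "poly_ring V" f h]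
    SR_ideal_is_ideal poly_ring_cring[of V]
  by (simp add: FactRing_def ideal_def cring_def ring_def)

lemma cls_mult:
  "f \<in> polys V \<Longrightarrow> h \<in> polys V \<Longrightarrow> cls f \<otimes>\<^bsub>poly_ring V Quot I\<^esub> cls h = cls (f * h)"
  using ideal.rcoset_mult_add[OF SR_ideal_is_ideal, of f h] by (simp add: FactRing_def)

lemma dehom_cls:
  assumes v: "v \<in> V"
  shows "dehom v ` cls f = SR_ideal (V - {v}) (link v X) +>\<^bsub>poly_ring (V - {v})\<^esub> dehom v f"
proof -
  interpret L: complex_on "V - {v}" "link v X" by (rule link_complex)
  show ?thesis
  proof (intro equalityI subsetI)
    fix h assume "h \<in> dehom v ` cls f"
    then show "h \<in> L.cls (dehom v f)"
      using dehom_SR_ideal(1)[OF v] by (auto simp: mem_cls L.mem_cls dehom_minus[symmetric])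
  next
    fix h assume "h \<in> L.cls (dehom v f)"
    then have j: "h - dehom v f \<in> L.I" by (simp add: L.mem_cls)
    have "dehom v (var v * (h - dehom v f) + f) = h"
      using dehom_SR_ideal(3)[OF v j] by (simp add: dehom_add)
    moreover have "var v * (h - dehom v f) + f \<in> cls f"
      using dehom_SR_ideal(2)[OF v j] by (simp add: mem_cls)
    ultimately show "h \<in> dehom v ` cls f" by (metis imageI)
  qed
qed

lemma quot_homogeneous_cls:
  "quot_homogeneous V I c (cls f) \<longleftrightarrow> (\<exists>h\<in>polys V. homogeneous c h \<and> f - h \<in> I)"
  by (simp add: quot_homogeneous_def cls_eq_iff)

section \<open>The first cotangent module\<close>

abbreviation "H1 \<equiv> T1_Hom (poly_ring V) I"
abbreviation "B1 \<equiv> T1_bounds constants (poly_ring V) I"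

text \<open>Homomorphisms from \<open>I\<close> to \<open>P/I\<close> are handled through functions that choose representatives of
  their values.\<close>

definition linear_mod :: "(cpoly \<Rightarrow> cpoly) \<Rightarrow> bool" where
  "linear_mod F \<longleftrightarrow> (\<forall>f\<in>I. F f \<in> polys V) \<and>
     (\<forall>f\<in>I. \<forall>h\<in>I. F (f + h) - (F f + F h) \<in> I) \<and>
     (\<forall>p\<in>polys V. \<forall>f\<in>I. F (p * f) - p * F f \<in> I)"

lemma carrier_T1_Hom: "carrier H1 = (\<lambda>F. \<lambda>f\<in>I. cls (F f)) ` Collect linear_mod"
proof (intro equalityI subsetI)
  fix \<phi> assume "\<phi> \<in> carrier H1"
  then have \<phi>: "\<phi> \<in> I \<rightarrow>\<^sub>E cls ` polys V"
    "\<And>f h. f \<in> I \<Longrightarrow> h \<in> I \<Longrightarrow> \<phi> (f + h) = \<phi> f \<oplus>\<^bsub>poly_ring V Quot I\<^esub> \<phi> h"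
    "\<And>p f. p \<in> polys V \<Longrightarrow> f \<in> I \<Longrightarrow> \<phi> (p * f) = cls p \<otimes>\<^bsub>poly_ring V Quot I\<^esub> \<phi> f"
    by (simp_all add: T1_Hom_def Hom_module_def module_homs_def ideal_module_def quot_as_module_def carrier_quot)
  have "\<forall>f\<in>I. \<exists>p. p \<in> polys V \<and> \<phi> f = cls p"
    using \<phi>(1) by (auto simp: PiE_iff)
  then obtain F where F: "\<And>f. f \<in> I \<Longrightarrow> F f \<in> polys V" "\<And>f. f \<in> I \<Longrightarrow> \<phi> f = cls (F f)"
    by metis
  have "linear_mod F"
    unfolding linear_mod_def
  proof (intro conjI ballI)
    fix f h assume fh: "f \<in> I" "h \<in> I"
    then show "F (f + h) - (F f + F h) \<in> I"
      using \<phi>(2)[OF fh] F(2)[of "f + h"] F I_closed(2)[OF fh] by (simp add: cls_add cls_eq_iff)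
  next
    fix p f assume pf: "p \<in> polys V" "f \<in> I"
    then show "F (p * f) - p * F f \<in> I"
      using \<phi>(3)[OF pf] F(2)[of "p * f"] F I_closed(6)[OF pf(2,1)] by (simp add: cls_mult cls_eq_iff)
  qed (use F in auto)
  moreover have "\<phi> = (\<lambda>f\<in>I. cls (F f))"
    using \<phi>(1) F(2) by (auto simp: PiE_iff extensional_def fun_eq_iff)
  ultimately show "\<phi> \<in> (\<lambda>F. \<lambda>f\<in>I. cls (F f)) ` Collect linear_mod" by blast
next
  fix \<phi> assume "\<phi> \<in> (\<lambda>F. \<lambda>f\<in>I. cls (F f)) ` Collect linear_mod"
  then obtain F where F: "linear_mod F" "\<phi> = (\<lambda>f\<in>I. cls (F f))" by blast
  then show "\<phi> \<in> carrier H1"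
    by (auto simp: T1_Hom_def Hom_module_def module_homs_def ideal_module_def quot_as_module_def carrier_quot
        linear_mod_def I_closed cls_add cls_mult cls_eq_iff)
qed

lemma T1_Hom_abelian_group: "abelian_group H1"
proof -
  interpret Q: cring "poly_ring V Quot I" by (rule quot_ring)
  have "abelian_group (quot_as_module (poly_ring V) I)"
    by (rule abelian_group_cong[OF Q.abelian_group_axioms]) (simp_all add: quot_as_module_def)
  then show ?thesis
    unfolding T1_Hom_def
    by (rule Hom_module_abelian_group)
       (auto simp: quot_as_module_def ideal_module_def carrier_quot I_closed Q.r_distr
         intro!: Q.m_closed[unfolded carrier_quot] Q.r_distr[unfolded carrier_quot])
qed

lemma T1_Hom_add:
  assumes "linear_mod F" "linear_mod F'"
  shows "(\<lambda>f\<in>I. cls (F f)) \<oplus>\<^bsub>H1\<^esub> (\<lambda>f\<in>I. cls (F' f)) = (\<lambda>f\<in>I. cls (F f + F' f))"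
  using assms
  by (auto simp: T1_Hom_def Hom_module_def ideal_module_def quot_as_module_def linear_mod_def cls_add intro!: restrict_ext)

lemma linear_mod_minus: "linear_mod F \<Longrightarrow> linear_mod F' \<Longrightarrow> linear_mod (\<lambda>f. F f - F' f)"
  unfolding linear_mod_def
proof (intro conjI ballI)
  assume F: "(\<forall>f\<in>I. F f \<in> polys V) \<and> (\<forall>f\<in>I. \<forall>h\<in>I. F (f + h) - (F f + F h) \<in> I) \<and>
     (\<forall>p\<in>polys V. \<forall>f\<in>I. F (p * f) - p * F f \<in> I)"
    and F': "(\<forall>f\<in>I. F' f \<in> polys V) \<and> (\<forall>f\<in>I. \<forall>h\<in>I. F' (f + h) - (F' f + F' h) \<in> I) \<and>
     (\<forall>p\<in>polys V. \<forall>f\<in>I. F' (p * f) - p * F' f \<in> I)"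
  show "F f - F' f \<in> polys V" if "f \<in> I" for f using F F' that by auto
  show "F (f + h) - F' (f + h) - (F f - F' f + (F h - F' h)) \<in> I" if "f \<in> I" "h \<in> I" for f h
  proof -
    have "F (f + h) - F' (f + h) - ((F f + F h) - (F' f + F' h)) \<in> I"
      using F F' that by (intro cong_minus) auto
    then show ?thesis by (simp add: algebra_simps)
  qed
  show "F (p * f) - F' (p * f) - p * (F f - F' f) \<in> I" if "p \<in> polys V" "f \<in> I" for p f
    unfolding right_diff_distrib using F F' that by (intro cong_minus) auto
qed

lemma T1_Hom_diff:
  assumes "linear_mod F" "linear_mod F'"
  shows "(\<lambda>f\<in>I. cls (F f - F' f)) \<oplus>\<^bsub>H1\<^esub> (\<lambda>f\<in>I. cls (F' f)) = (\<lambda>f\<in>I. cls (F f))"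
  using T1_Hom_add[OF linear_mod_minus[OF assms] assms(2)] by simp

lemma Der_linear_mod:
  assumes "D \<in> Der constants (poly_ring V)"
  shows "linear_mod D"
proof -
  have D: "\<And>f. f \<in> polys V \<Longrightarrow> D f \<in> polys V"
    "\<And>f h. f \<in> polys V \<Longrightarrow> h \<in> polys V \<Longrightarrow> D (f + h) = D f + D h"
    "\<And>f h. f \<in> polys V \<Longrightarrow> h \<in> polys V \<Longrightarrow> D (f * h) = f * D h + h * D f"
    using assms by (auto simp: Der_def)
  show ?thesis
    unfolding linear_mod_def by (auto simp: D I_carrier I_closed)
qed

lemma Der_minus:
  assumes "D \<in> Der constants (poly_ring V)" "D' \<in> Der constants (poly_ring V)"
  shows "(\<lambda>f\<in>polys V. D f - D' f) \<in> Der constants (poly_ring V)"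
proof -
  have "constants \<subseteq> polys V" by (auto simp: constants_def)
  then show ?thesis
    using assms unfolding Der_def by (auto simp: PiE_mem subset_iff algebra_simps)
qed

lemma T1_bounds_subset: "B1 \<subseteq> carrier H1"
  unfolding T1_bounds_def carrier_T1_Hom using Der_linear_mod by auto

lemma T1_bounds_additive_subgroup:
  "additive_subgroup B1 H1"
proof (rule additive_subgroup_if_differences[OF T1_Hom_abelian_group T1_bounds_subset])
  have "(\<lambda>f\<in>polys V. 0) \<in> Der constants (poly_ring V)"
    by (auto simp: Der_def constants_def)
  then show "B1 \<noteq> {}" by (auto simp: T1_bounds_def)
next
  fix \<phi> \<phi>' assume "\<phi> \<in> B1" "\<phi>' \<in> B1"
  then obtain D D' where D: "D \<in> Der constants (poly_ring V)" "D' \<in> Der constants (poly_ring V)"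
    "\<phi> = (\<lambda>f\<in>I. cls (D f))" "\<phi>' = (\<lambda>f\<in>I. cls (D' f))"
    by (auto simp: T1_bounds_def)
  have "(\<lambda>f\<in>I. cls (D f - D' f)) = (\<lambda>f\<in>I. cls ((\<lambda>f\<in>polys V. D f - D' f) f))"
    by (rule restrict_ext) (simp add: I_carrier)
  then have "(\<lambda>f\<in>I. cls (D f - D' f)) \<in> B1"
    unfolding T1_bounds_def using Der_minus[OF D(1,2)] by blast
  then show "\<exists>z\<in>B1. z \<oplus>\<^bsub>H1\<^esub> \<phi>' = \<phi>"
    using T1_Hom_diff[OF D(1,2)[THEN Der_linear_mod]] D(3,4) by blast
qed

text \<open>The localized homomorphism is well defined: two elements of \<open>I\<close> with the same dehomogenization
  differ by a multiple \<open>(x\<^sub>v - 1) G\<close> with \<open>G\<close> in \<open>I\<close>, and \<open>x\<^sub>v - 1\<close> dehomogenizes to 0.\<close>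

lemma linear_mod_dehom_kernel:
  assumes v: "v \<in> V" and F: "linear_mod F" and f: "f \<in> I" "h \<in> I" "dehom v f = dehom v h"
  shows "dehom v (F f) - dehom v (F h) \<in> SR_ideal (V - {v}) (link v X)"
proof -
  interpret L: complex_on "V - {v}" "link v X" by (rule link_complex)
  have "f - h \<in> I" "dehom v (f - h) = 0" using f by (simp_all add: I_closed dehom_minus)
  then obtain G where G: "G \<in> I" "f - h = (var v - 1) * G" using dehom_kernel_I[OF v] by metis
  have c: "(var v - 1) \<in> polys V" using v by (auto simp: var_in_poly_ring)
  have gI: "(var v - 1) * G \<in> I" using c G by (simp add: I_closed)
  have "F ((var v - 1) * G + h) - (F ((var v - 1) * G) + F h) \<in> I"
    using F f(2) gI by (auto simp: linear_mod_def)
  moreover have "(F ((var v - 1) * G) + F h) - ((var v - 1) * F G + F h) \<in> I"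
    using F G c I_closed(1) by (intro cong_add) (auto simp: linear_mod_def)
  moreover have "(var v - 1) * G + h = f" using G(2)[symmetric] by simp
  ultimately have "F f - ((var v - 1) * F G + F h) \<in> I" using cong_trans by metis
  then have "dehom v (F f - ((var v - 1) * F G + F h)) \<in> L.I" by (rule dehom_SR_ideal(1)[OF v])
  then show ?thesis by (simp add: dehom_minus dehom_add dehom_mult)
qed

text \<open>Among the preimages of an element \<open>f\<close> of the ideal of the link, \<open>x\<^sub>v f\<close> is a uniform choice inside
  \<open>I\<close>; \<open>f\<close> itself need not belong to \<open>I\<close>.\<close>

lemma T1_loc_hom_eq:
  assumes v: "v \<in> V" and F: "linear_mod F"
  shows "T1_loc_hom v I (SR_ideal (V - {v}) (link v X)) (\<lambda>f\<in>I. cls (F f))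
    = (\<lambda>f\<in>SR_ideal (V - {v}) (link v X).
         SR_ideal (V - {v}) (link v X) +>\<^bsub>poly_ring (V - {v})\<^esub> dehom v (F (var v * f)))"
  unfolding T1_loc_hom_def
proof (rule restrict_ext)
  interpret L: complex_on "V - {v}" "link v X" by (rule link_complex)
  fix f assume f: "f \<in> L.I"
  have "dehom v ` (\<lambda>f\<in>I. cls (F f)) h = L.cls (dehom v (F (var v * f)))" if "h \<in> I" "dehom v h = f" for h
    using that dehom_SR_ideal[OF v, of f] f linear_mod_dehom_kernel[OF v F, of h "var v * f"]
    by (simp add: dehom_cls[OF v] L.cls_eq_iff)
  moreover have "var v * f \<in> {h \<in> I. dehom v h = f}"
    using dehom_SR_ideal[OF v, of f] f by simp
  ultimately have "(\<lambda>h. dehom v ` (\<lambda>f\<in>I. cls (F f)) h) ` {h \<in> I. dehom v h = f} = {L.cls (dehom v (F (var v * f)))}"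
    by blast
  then show "the_elem ((\<lambda>h. dehom v ` (\<lambda>f\<in>I. cls (F f)) h) ` {h \<in> I. dehom v h = f}) = L.cls (dehom v (F (var v * f)))"
    by simp
qed

lemma linear_mod_dehom:
  assumes v: "v \<in> V" and F: "linear_mod F"
  shows "complex_on.linear_mod (V - {v}) (link v X) (\<lambda>f. dehom v (F (var v * f)))"
proof -
  interpret L: complex_on "V - {v}" "link v X" by (rule link_complex)
  have F1: "\<And>f. f \<in> I \<Longrightarrow> F f \<in> polys V"
    and F2: "\<And>f h. f \<in> I \<Longrightarrow> h \<in> I \<Longrightarrow> F (f + h) - (F f + F h) \<in> I"
    and F3: "\<And>p f. p \<in> polys V \<Longrightarrow> f \<in> I \<Longrightarrow> F (p * f) - p * F f \<in> I"
    using F by (auto simp: linear_mod_def)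
  note up = dehom_SR_ideal(2)[OF v] and dn = dehom_SR_ideal(1)[OF v]
  show ?thesis
    unfolding L.linear_mod_def
  proof (intro conjI ballI)
    fix f assume "f \<in> L.I"
    then show "dehom v (F (var v * f)) \<in> polys (V - {v})"
      by (intro dehom_in_poly_ring F1 up)
  next
    fix f h assume "f \<in> L.I" "h \<in> L.I"
    then show "dehom v (F (var v * (f + h))) - (dehom v (F (var v * f)) + dehom v (F (var v * h))) \<in> L.I"
      using dn[OF F2[OF up up]] by (simp add: distrib_left dehom_minus dehom_add)
  next
    fix p f assume p: "p \<in> polys (V - {v})" and f: "f \<in> L.I"
    then have "p \<in> polys V" by (auto intro: poly_ring_mono)
    then have "dehom v (F (p * (var v * f)) - p * F (var v * f)) \<in> L.I"
      using up[OF f] by (intro dn F3)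
    then show "dehom v (F (var v * (p * f))) - p * dehom v (F (var v * f)) \<in> L.I"
      using dehom_id[OF p] by (simp add: dehom_minus dehom_mult mult.left_commute)
  qed
qed

lemma Der_dehom:
  assumes v: "v \<in> V" and D: "D \<in> Der constants (poly_ring V)"
  shows "(\<lambda>f\<in>polys (V - {v}). dehom v (D f)) \<in> Der constants (poly_ring (V - {v}))"
proof -
  have sub: "f \<in> polys V" if "f \<in> polys (V - {v})" for f
    using that by (rule poly_ring_mono[rotated]) auto
  have id: "dehom v f = f" if "f \<in> polys (V - {v})" for f
    using that by (rule dehom_id) simp
  have c: "constants \<subseteq> polys (V - {v})" by (auto simp: constants_def)
  show ?thesis
    unfolding Der_def
  proof (intro CollectI conjI ballI)
    show "(\<lambda>f\<in>polys (V - {v}). dehom v (D f))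
        \<in> polys (V - {v}) \<rightarrow>\<^sub>E polys (V - {v})"
      using D sub by (auto simp: Der_def intro!: dehom_in_poly_ring)
  next
    fix k f assume "k \<in> constants" "f \<in> polys (V - {v})"
    moreover from this have "D (k * f) = k * D f" using D sub by (simp add: Der_def)
    ultimately show "(\<lambda>f\<in>polys (V - {v}). dehom v (D f)) (k \<otimes>\<^bsub>poly_ring (V - {v})\<^esub> f)
        = k \<otimes>\<^bsub>poly_ring (V - {v})\<^esub> (\<lambda>f\<in>polys (V - {v}). dehom v (D f)) f"
      using c id[of k] by (auto simp: dehom_mult)
  next
    fix f h assume fh: "f \<in> polys (V - {v})" "h \<in> polys (V - {v})"
    then have "D (f + h) = D f + D h" "D (f * h) = f * D h + h * D f" using D sub by (simp_all add: Der_def)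
    then show "(\<lambda>f\<in>polys (V - {v}). dehom v (D f)) (f \<oplus>\<^bsub>poly_ring (V - {v})\<^esub> h)
        = (\<lambda>f\<in>polys (V - {v}). dehom v (D f)) f \<oplus>\<^bsub>poly_ring (V - {v})\<^esub> (\<lambda>f\<in>polys (V - {v}). dehom v (D f)) h"
      "(\<lambda>f\<in>polys (V - {v}). dehom v (D f)) (f \<otimes>\<^bsub>poly_ring (V - {v})\<^esub> h)
        = (f \<otimes>\<^bsub>poly_ring (V - {v})\<^esub> (\<lambda>f\<in>polys (V - {v}). dehom v (D f)) h)
          \<oplus>\<^bsub>poly_ring (V - {v})\<^esub> (h \<otimes>\<^bsub>poly_ring (V - {v})\<^esub> (\<lambda>f\<in>polys (V - {v}). dehom v (D f)) f)"
      using fh id[OF fh(1)] id[OF fh(2)] by (simp_all add: dehom_add dehom_mult)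
  qed
qed

theorem T1_localization_injective:
  "(\<lambda>t. \<lambda>v\<in>V. T1_loc V X v t) \<in> mon (T1_deg0 V I) (sum_group V (\<lambda>v. T1_chart V X v))"
proof -
  let ?Z = "{\<phi> \<in> carrier H1. \<forall>c. \<forall>f\<in>I. homogeneous c f \<longrightarrow> quot_homogeneous V I c (\<phi> f)}"
  let ?J = "\<lambda>v. SR_ideal (V - {v}) (link v X)"
  have "(\<lambda>t. \<lambda>v\<in>V. the_elem ((\<lambda>\<phi>. T1_bounds constants (poly_ring (V - {v})) (?J v)
            +>\<^bsub>T1_Hom (poly_ring (V - {v})) (?J v)\<^esub> T1_loc_hom v I (?J v) \<phi>) ` t))
    \<in> mon ((H1 A_Mod B1)
            \<lparr>carrier := {B1 +>\<^bsub>H1\<^esub> \<phi> |\<phi>. \<phi> \<in> ?Z}\<rparr>)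
        (sum_group V (\<lambda>v. T1_Hom (poly_ring (V - {v})) (?J v) A_Mod T1_bounds constants (poly_ring (V - {v})) (?J v)))"
  proof (rule coset_family_mon[OF T1_Hom_abelian_group T1_bounds_additive_subgroup])
    show "abelian_group (T1_Hom (poly_ring (V - {v})) (?J v))" for v
      by (rule complex_on.T1_Hom_abelian_group[OF link_complex])
    show "additive_subgroup (T1_bounds constants (poly_ring (V - {v})) (?J v)) (T1_Hom (poly_ring (V - {v})) (?J v))" for v
      by (rule complex_on.T1_bounds_additive_subgroup[OF link_complex])
  next
    fix v \<phi> assume v: "v \<in> V" and "\<phi> \<in> carrier H1"
    then obtain F where F: "linear_mod F" "\<phi> = (\<lambda>f\<in>I. cls (F f))" by (auto simp: carrier_T1_Hom)
    then show "T1_loc_hom v I (?J v) \<phi> \<in> carrier (T1_Hom (poly_ring (V - {v})) (?J v))"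
      using linear_mod_dehom[OF v F(1)] by (auto simp: T1_loc_hom_eq[OF v] complex_on.carrier_T1_Hom[OF link_complex])
  next
    fix v \<phi> \<phi>' assume v: "v \<in> V"
      and "\<phi> \<in> carrier H1" "\<phi>' \<in> carrier H1"
    then obtain F F' where F: "linear_mod F" "\<phi> = (\<lambda>f\<in>I. cls (F f))" "linear_mod F'" "\<phi>' = (\<lambda>f\<in>I. cls (F' f))"
      by (auto simp: carrier_T1_Hom)
    have "linear_mod (\<lambda>f. F f - (0 - F' f))"
      using linear_mod_minus[OF F(1) linear_mod_minus[OF _ F(3)], of "\<lambda>f. 0"] by (auto simp: linear_mod_def I_closed)
    then have s: "linear_mod (\<lambda>f. F f + F' f)" by simp
    show "T1_loc_hom v I (?J v) (\<phi> \<oplus>\<^bsub>H1\<^esub> \<phi>')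
        = T1_loc_hom v I (?J v) \<phi> \<oplus>\<^bsub>T1_Hom (poly_ring (V - {v})) (?J v)\<^esub> T1_loc_hom v I (?J v) \<phi>'"
      unfolding F(2,4) T1_Hom_add[OF F(1,3)] T1_loc_hom_eq[OF v F(1)] T1_loc_hom_eq[OF v F(3)] T1_loc_hom_eq[OF v s]
        complex_on.T1_Hom_add[OF link_complex linear_mod_dehom[OF v F(1)] linear_mod_dehom[OF v F(3)]] dehom_add ..
  next
    fix v \<phi> assume v: "v \<in> V" and "\<phi> \<in> B1"
    then obtain D where D: "D \<in> Der constants (poly_ring V)" "\<phi> = (\<lambda>f\<in>I. cls (D f))" by (auto simp: T1_bounds_def)
    interpret L: complex_on "V - {v}" "link v X" by (rule link_complex)
    let ?D = "\<lambda>f\<in>polys (V - {v}). dehom v (D f)"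
    have "T1_loc_hom v I (?J v) \<phi> = (\<lambda>f\<in>L.I. L.cls (?D f))"
      unfolding D(2) T1_loc_hom_eq[OF v Der_linear_mod[OF D(1)]]
    proof (rule restrict_ext)
      fix f assume f: "f \<in> L.I"
      then have fW: "f \<in> polys (V - {v})" by (rule L.I_carrier)
      then have "f \<in> polys V" by (auto intro: poly_ring_mono)
      \<comment> \<open>The second summand vanishes in the chart because \<open>f\<close> lies in the ideal of the link.\<close>
      then have "D (var v * f) = var v * D f + f * D (var v)"
        using D(1) v by (simp add: Der_def var_in_poly_ring)
      moreover have "dehom v (D (var v)) \<in> polys (V - {v})"
        using D(1) v by (intro dehom_in_poly_ring) (auto simp: Der_def var_in_poly_ring)
      ultimately show "L.cls (dehom v (D (var v * f))) = L.cls (?D f)"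
        using f fW dehom_id[OF fW] by (simp add: L.cls_eq_iff dehom_add dehom_mult L.I_closed)
    qed
    then show "T1_loc_hom v I (?J v) \<phi> \<in> T1_bounds constants (poly_ring (V - {v})) (?J v)"
      unfolding T1_bounds_def using Der_dehom[OF v D(1)] by blast
  next
    fix \<phi> \<phi>' assume z: "\<phi> \<in> ?Z" "\<phi>' \<in> ?Z"
    then obtain F F' where F: "linear_mod F" "\<phi> = (\<lambda>f\<in>I. cls (F f))" "linear_mod F'" "\<phi>' = (\<lambda>f\<in>I. cls (F' f))"
      by (auto simp: carrier_T1_Hom)
    let ?z = "\<lambda>f\<in>I. cls (F f - F' f)"
    have "quot_homogeneous V I c (?z f)" if f: "f \<in> I" "homogeneous c f" for c f
    proof -
      have "quot_homogeneous V I c (cls (F f))" "quot_homogeneous V I c (cls (F' f))"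
        using z that by (auto simp: F)
      then obtain h h' where "h \<in> polys V" "homogeneous c h" "F f - h \<in> I"
        "h' \<in> polys V" "homogeneous c h'" "F' f - h' \<in> I"
        unfolding quot_homogeneous_cls by blast
      then show ?thesis
        using f by (auto simp: quot_homogeneous_cls intro!: bexI[of _ "h - h'"] homogeneous_minus cong_minus)
    qed
    then have "?z \<in> ?Z" using linear_mod_minus[OF F(1,3)] by (auto simp: carrier_T1_Hom)
    then show "\<exists>z\<in>?Z. z \<oplus>\<^bsub>H1\<^esub> \<phi>' = \<phi>"
      using T1_Hom_diff[OF F(1,3)] F(2,4) by blast
  next
    fix \<phi> assume z: "\<phi> \<in> ?Z"
      and loc: "\<And>v. v \<in> V \<Longrightarrow> T1_loc_hom v I (?J v) \<phi> \<in> T1_bounds constants (poly_ring (V - {v})) (?J v)"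
    then obtain F where F: "linear_mod F" "\<phi> = (\<lambda>f\<in>I. cls (F f))"
      by (auto simp: carrier_T1_Hom)
    have "\<exists>D\<in>Der constants (poly_ring V). \<forall>f\<in>I. F f - D f \<in> I"
    proof (rule glue_derivations)
      fix c f assume "f \<in> I" "homogeneous c f"
      then have "quot_homogeneous V I c (cls (F f))" using z by (auto simp: F)
      then show "\<exists>h. homogeneous c h \<and> F f - h \<in> I" by (auto simp: quot_homogeneous_cls)
    next
      fix v assume v: "v \<in> V"
      interpret L: complex_on "V - {v}" "link v X" by (rule link_complex)
      obtain D where D: "D \<in> Der constants (poly_ring (V - {v}))"
        "T1_loc_hom v I L.I \<phi> = (\<lambda>f\<in>L.I. L.cls (D f))"
        using loc[OF v] by (auto simp: T1_bounds_def)
      have "dehom v (F f) - D (dehom v f) \<in> L.I" if f: "f \<in> I" for f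
      proof -
        let ?f = "dehom v f"
        have fJ: "?f \<in> L.I" by (rule dehom_SR_ideal(1)[OF v f])
        then have "L.cls (dehom v (F (var v * ?f))) = L.cls (D ?f)"
          using fun_cong[OF D(2), of ?f] unfolding F(2) T1_loc_hom_eq[OF v F(1)] by simp
        then have "dehom v (F (var v * ?f)) - D ?f \<in> L.I" by (simp add: L.cls_eq_iff)
        moreover have "dehom v (F f) - dehom v (F (var v * ?f)) \<in> L.I"
          using dehom_SR_ideal(2,3)[OF v fJ] f by (intro linear_mod_dehom_kernel[OF v F(1)]) auto
        ultimately show ?thesis using L.cong_trans by blast
      qed
      then show "\<exists>D\<in>Der constants (poly_ring (V - {v})). \<forall>f\<in>I. dehom v (F f) - D (dehom v f) \<in> L.I"
        using D(1) by blast
    qed (use F(1) in \<open>auto simp: linear_mod_def\<close>)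
    then obtain D where D: "D \<in> Der constants (poly_ring V)" "\<And>f. f \<in> I \<Longrightarrow> F f - D f \<in> I" by blast
    then have "\<phi> = (\<lambda>f\<in>I. cls (D f))" unfolding F(2) by (intro restrict_ext) (simp add: cls_eq_iff)
    then show "\<phi> \<in> B1" using D(1) by (auto simp: T1_bounds_def)
  qed (use finV in auto)
  then show ?thesis
    by (simp add: T1_loc_def[abs_def] T1_deg0_def T1_chart_def T1_def Let_def conj_ac)
qed

end

section \<open>The second cotangent module\<close>

locale presented_complex = complex_on +
  fixes m :: nat and g :: "nat \<Rightarrow> cpoly"
  assumes pres: "presents (poly_ring V) (SR_ideal V X) m g"
begin

abbreviation "P \<equiv> polys V"
abbreviation "FM \<equiv> free_module (poly_ring V) m"
abbreviation "RM \<equiv> relations (poly_ring V) m g"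
abbreviation "Rel \<equiv> carrier RM"
abbreviation "K \<equiv> Koszul_relations (poly_ring V) m g"
abbreviation rv :: "(nat \<Rightarrow> cpoly) \<Rightarrow> nat \<Rightarrow> cpoly" where "rv e \<equiv> restrict e {..<m}"
abbreviation rcls :: "(nat \<Rightarrow> cpoly) \<Rightarrow> (nat \<Rightarrow> cpoly) set" where "rcls r \<equiv> K +>\<^bsub>RM\<^esub> r"
abbreviation "RQ \<equiv> rel_quot (poly_ring V) m g"
abbreviation "H2 \<equiv> T2_Hom (poly_ring V) I m g"
abbreviation "B2 \<equiv> T2_bounds (poly_ring V) I m g"

lemma g_in_P: "k < m \<Longrightarrow> g k \<in> P"
  using pres by (auto simp: presents_def)

lemma mem_FM: "e \<in> carrier FM \<longleftrightarrow> e \<in> extensional {..<m} \<and> (\<forall>k<m. e k \<in> P)"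
  by (auto simp: free_module_def PiE_iff)

lemma gen_map_eq: "(\<And>k. k < m \<Longrightarrow> e k \<in> P) \<Longrightarrow> gen_map (poly_ring V) m g e = (\<Sum>k<m. e k * g k)"
  unfolding gen_map_def by (subst poly_ring_finsum) (auto simp: g_in_P)

lemma gen_map_image: "gen_map (poly_ring V) m g ` carrier FM = I"
  using pres by (simp add: presents_def)

lemma I_generated: "f \<in> I \<longleftrightarrow> (\<exists>e. (\<forall>k<m. e k \<in> P) \<and> (\<Sum>k<m. e k * g k) = f)"
proof
  assume "f \<in> I"
  then obtain e where "e \<in> carrier FM" "gen_map (poly_ring V) m g e = f"
    unfolding gen_map_image[symmetric] by blast
  then show "\<exists>e. (\<forall>k<m. e k \<in> P) \<and> (\<Sum>k<m. e k * g k) = f"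
    using gen_map_eq[of e] by (auto simp: mem_FM)
next
  assume "\<exists>e. (\<forall>k<m. e k \<in> P) \<and> (\<Sum>k<m. e k * g k) = f"
  then obtain e where e: "\<And>k. k < m \<Longrightarrow> e k \<in> P" "(\<Sum>k<m. e k * g k) = f" by blast
  have "rv e \<in> carrier FM" using e(1) by (simp add: mem_FM)
  moreover have "gen_map (poly_ring V) m g (rv e) = f"
    using e by (subst gen_map_eq) auto
  ultimately show "f \<in> I"
    unfolding gen_map_image[symmetric] by blast
qed

lemma g_in_I: "k < m \<Longrightarrow> g k \<in> I"
  unfolding I_generated by (intro exI[of _ "\<lambda>k'. if k' = k then 1 else 0"]) (auto simp: if_distrib[of "\<lambda>x. x * _"] cong: if_cong)

lemma mem_Rel: "e \<in> Rel \<longleftrightarrow> e \<in> extensional {..<m} \<and> syzygy V m g e"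
proof -
  have "e \<in> Rel \<longleftrightarrow> e \<in> carrier FM \<and> gen_map (poly_ring V) m g e = 0"
    by (simp add: relations_def)
  also have "\<dots> \<longleftrightarrow> e \<in> extensional {..<m} \<and> syzygy V m g e"
    using gen_map_eq[of e] by (auto simp: mem_FM syzygy_def)
  finally show ?thesis .
qed

lemma FM_ops [simp]:
  "x \<oplus>\<^bsub>FM\<^esub> y = rv (\<lambda>k. x k + y k)" "\<zero>\<^bsub>FM\<^esub> = rv (\<lambda>k. 0)" "a \<odot>\<^bsub>FM\<^esub> x = rv (\<lambda>k. a * x k)"
  by (simp_all add: free_module_def)

lemma RM_ops [simp]:
  "x \<oplus>\<^bsub>RM\<^esub> y = rv (\<lambda>k. x k + y k)" "\<zero>\<^bsub>RM\<^esub> = rv (\<lambda>k. 0)" "a \<odot>\<^bsub>RM\<^esub> x = rv (\<lambda>k. a * x k)"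
  by (simp_all add: relations_def free_module_def)

lemma rv_id [simp]: "e \<in> extensional {..<m} \<Longrightarrow> rv e = e"
  by (rule extensional_restrict)

lemma rv_cong: "(\<And>k. k < m \<Longrightarrow> e k = e' k) \<Longrightarrow> rv e = rv e'"
  by (rule restrict_ext) auto

lemma FM_abelian_group: "abelian_group FM"
proof (rule abelian_groupI)
  fix x assume x: "x \<in> carrier FM"
  show "\<exists>y\<in>carrier FM. y \<oplus>\<^bsub>FM\<^esub> x = \<zero>\<^bsub>FM\<^esub>"
    using x by (intro bexI[of _ "rv (\<lambda>k. - x k)"]) (auto simp: mem_FM intro!: rv_cong)
  show "\<zero>\<^bsub>FM\<^esub> \<oplus>\<^bsub>FM\<^esub> x = x"
    using x by (auto simp: mem_FM intro!: extensionalityI[of _ "{..<m}"])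
qed (auto simp: mem_FM add.assoc add.commute intro!: rv_cong)

lemma FM_a_inv: "x \<in> carrier FM \<Longrightarrow> \<ominus>\<^bsub>FM\<^esub> x = rv (\<lambda>k. - x k)"
proof -
  interpret FM: abelian_group FM by (rule FM_abelian_group)
  assume "x \<in> carrier FM"
  then show ?thesis
    by (intro FM.minus_equality) (auto simp: mem_FM intro!: rv_cong)
qed

lemma FM_minus: "x \<in> carrier FM \<Longrightarrow> y \<in> carrier FM \<Longrightarrow> x \<ominus>\<^bsub>FM\<^esub> y = rv (\<lambda>k. x k - y k)"
  by (auto simp: a_minus_def FM_a_inv intro!: rv_cong)

lemma FM_submodule_iff:
  "submodule N (poly_ring V) FM \<longleftrightarrow> N \<subseteq> carrier FM \<and> rv (\<lambda>k. 0) \<in> N \<and>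
     (\<forall>x\<in>N. \<forall>y\<in>N. rv (\<lambda>k. x k + y k) \<in> N) \<and> (\<forall>p\<in>P. \<forall>x\<in>N. rv (\<lambda>k. p * x k) \<in> N)" (is "_ \<longleftrightarrow> ?R")
proof
  assume "submodule N (poly_ring V) FM"
  then interpret submodule N "poly_ring V" FM .
  show ?R
    using subset one_closed m_closed smult_closed by simp
next
  assume R: ?R
  interpret FM: abelian_group FM by (rule FM_abelian_group)
  show "submodule N (poly_ring V) FM"
  proof
    show "inv\<^bsub>add_monoid FM\<^esub> x \<in> N" if x: "x \<in> N" for x
    proof -
      have xc: "x \<in> carrier FM" using R x by blast
      have "rv (\<lambda>k. (- 1) * x k) \<in> N" using R x by blast
      then show ?thesis using FM_a_inv[OF xc] by (simp add: a_inv_def)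
    qed
  qed (use R in auto)
qed

lemma FM_submodule_closed:
  assumes "submodule N (poly_ring V) FM"
  shows "N \<subseteq> carrier FM" "rv (\<lambda>k. 0) \<in> N" "x \<in> N \<Longrightarrow> y \<in> N \<Longrightarrow> rv (\<lambda>k. x k + y k) \<in> N"
    "p \<in> P \<Longrightarrow> x \<in> N \<Longrightarrow> rv (\<lambda>k. p * x k) \<in> N"
  using assms unfolding FM_submodule_iff by auto

definition koszul :: "(nat \<Rightarrow> cpoly) \<Rightarrow> (nat \<Rightarrow> cpoly) \<Rightarrow> nat \<Rightarrow> cpoly" where
  "koszul e f = rv (\<lambda>k. (\<Sum>i<m. f i * g i) * e k - (\<Sum>i<m. e i * g i) * f k)"

lemma koszul_eq:
  assumes "e \<in> carrier FM" "f \<in> carrier FM"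
  shows "(gen_map (poly_ring V) m g f \<odot>\<^bsub>FM\<^esub> e) \<ominus>\<^bsub>FM\<^esub> (gen_map (poly_ring V) m g e \<odot>\<^bsub>FM\<^esub> f) = koszul e f"
proof -
  have "gen_map (poly_ring V) m g e = (\<Sum>i<m. e i * g i)" "(\<Sum>i<m. e i * g i) \<in> P" if "e \<in> carrier FM" for e
    using that gen_map_eq[of e] by (auto simp: mem_FM g_in_P intro!: poly_ring_sum)
  then show ?thesis
    using assms by (subst FM_minus) (auto simp: mem_FM koszul_def intro!: rv_cong)
qed

lemma mem_K:
  "x \<in> K \<longleftrightarrow> (\<forall>N. submodule N (poly_ring V) FM \<longrightarrow>
     (\<forall>e\<in>carrier FM. \<forall>f\<in>carrier FM. koszul e f \<in> N) \<longrightarrow> x \<in> N)"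
proof -
  have 1: "{(gen_map (poly_ring V) m g f \<odot>\<^bsub>FM\<^esub> e) \<ominus>\<^bsub>FM\<^esub> (gen_map (poly_ring V) m g e \<odot>\<^bsub>FM\<^esub> f)
          | e f. e \<in> carrier FM \<and> f \<in> carrier FM} = {koszul e f | e f. e \<in> carrier FM \<and> f \<in> carrier FM}"
    using koszul_eq by (intro Collect_cong) (metis (no_types, lifting))
  have 2: "{koszul e f | e f. e \<in> carrier FM \<and> f \<in> carrier FM} \<subseteq> N
      \<longleftrightarrow> (\<forall>e\<in>carrier FM. \<forall>f\<in>carrier FM. koszul e f \<in> N)" for N
    by blast
  have "K = \<Inter>{N. submodule N (poly_ring V) FM \<and> (\<forall>e\<in>carrier FM. \<forall>f\<in>carrier FM. koszul e f \<in> N)}"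
    unfolding Koszul_relations_def 1 2 ..
  then show ?thesis by blast
qed

lemma koszul_in_K: "e \<in> carrier FM \<Longrightarrow> f \<in> carrier FM \<Longrightarrow> koszul e f \<in> K"
  by (simp add: mem_K)

lemma K_least:
  assumes "submodule N (poly_ring V) FM" "\<And>e f. e \<in> carrier FM \<Longrightarrow> f \<in> carrier FM \<Longrightarrow> koszul e f \<in> N"
  shows "K \<subseteq> N"
  using assms by (auto simp: mem_K)

lemma K_submodule: "submodule K (poly_ring V) FM"
proof -
  have "K \<subseteq> carrier FM"
  proof (rule K_least)
    show "submodule (carrier FM) (poly_ring V) FM"
      unfolding FM_submodule_iff by (auto simp: mem_FM)
    fix e f assume ef: "e \<in> carrier FM" "f \<in> carrier FM"
    have "(\<Sum>i<m. f i * g i) \<in> P" "(\<Sum>i<m. e i * g i) \<in> P"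
      using ef by (auto simp: mem_FM g_in_P intro!: poly_ring_sum)
    then show "koszul e f \<in> carrier FM"
      using ef by (auto simp: koszul_def mem_FM)
  qed
  moreover have "rv (\<lambda>k. 0) \<in> K" "\<And>x y. x \<in> K \<Longrightarrow> y \<in> K \<Longrightarrow> rv (\<lambda>k. x k + y k) \<in> K"
    "\<And>p x. p \<in> P \<Longrightarrow> x \<in> K \<Longrightarrow> rv (\<lambda>k. p * x k) \<in> K"
    unfolding mem_K by (simp_all add: FM_submodule_closed)
  ultimately show ?thesis
    unfolding FM_submodule_iff[of K] by blast
qed

lemma K_closed:
  "rv (\<lambda>k. 0) \<in> K" "x \<in> K \<Longrightarrow> y \<in> K \<Longrightarrow> rv (\<lambda>k. x k + y k) \<in> K" "p \<in> P \<Longrightarrow> x \<in> K \<Longrightarrow> rv (\<lambda>k. p * x k) \<in> K"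
  using K_submodule unfolding FM_submodule_iff by blast+

lemma K_diff: "x \<in> K \<Longrightarrow> y \<in> K \<Longrightarrow> rv (\<lambda>k. x k - y k) \<in> K"
proof -
  assume "x \<in> K" "y \<in> K"
  then have "rv (\<lambda>k. x k + rv (\<lambda>k. (- 1) * y k) k) \<in> K"
    by (intro K_closed) auto
  moreover have "rv (\<lambda>k. x k + rv (\<lambda>k. (- 1) * y k) k) = rv (\<lambda>k. x k - y k)"
    by (rule rv_cong) simp
  ultimately show ?thesis by simp
qed

lemma Rel_closed:
  "rv (\<lambda>k. 0) \<in> Rel" "r \<in> Rel \<Longrightarrow> s \<in> Rel \<Longrightarrow> rv (\<lambda>k. r k + s k) \<in> Rel"
  "p \<in> P \<Longrightarrow> r \<in> Rel \<Longrightarrow> rv (\<lambda>k. p * r k) \<in> Rel"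
  "r \<in> Rel \<Longrightarrow> s \<in> Rel \<Longrightarrow> rv (\<lambda>k. r k - s k) \<in> Rel"
proof -
  have rv: "syzygy V m g (rv e) \<longleftrightarrow> syzygy V m g e" for e by (simp add: syzygy_def)
  show "rv (\<lambda>k. 0) \<in> Rel" by (simp add: mem_Rel rv syzygy_0)
  show "rv (\<lambda>k. r k + s k) \<in> Rel" if "r \<in> Rel" "s \<in> Rel"
    using that by (simp add: mem_Rel rv syzygy_add)
  show "rv (\<lambda>k. p * r k) \<in> Rel" if "p \<in> P" "r \<in> Rel"
    using that by (simp add: mem_Rel rv syzygy_mult)
  show "rv (\<lambda>k. r k - s k) \<in> Rel" if "r \<in> Rel" "s \<in> Rel"
    using that by (auto simp: mem_Rel rv syzygy_def left_diff_distrib sum_subtractf)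
qed

lemma K_subset_Rel: "K \<subseteq> Rel"
proof (rule K_least)
  show "submodule Rel (poly_ring V) FM"
    unfolding FM_submodule_iff using Rel_closed by (auto simp: mem_Rel mem_FM syzygy_def)
  fix e f assume ef: "e \<in> carrier FM" "f \<in> carrier FM"
  have "(\<Sum>i<m. f i * g i) \<in> P" "(\<Sum>i<m. e i * g i) \<in> P"
    using ef by (auto simp: mem_FM g_in_P intro!: poly_ring_sum)
  then have "koszul e f k \<in> P" if "k < m" for k
    using ef that by (auto simp: koszul_def mem_FM)
  moreover have "(\<Sum>k<m. koszul e f k * g k)
      = (\<Sum>i<m. f i * g i) * (\<Sum>i<m. e i * g i) - (\<Sum>i<m. e i * g i) * (\<Sum>i<m. f i * g i)"
    unfolding sum_distrib_left[of "\<Sum>i<m. f i * g i"] sum_distrib_left[of "\<Sum>i<m. e i * g i"] sum_subtractf[symmetric]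
    by (rule sum.cong) (simp_all add: koszul_def left_diff_distrib mult.assoc)
  ultimately show "koszul e f \<in> Rel"
    by (auto simp: mem_Rel syzygy_def koszul_def)
qed

lemma RM_abelian_group: "abelian_group RM"
proof (rule abelian_groupI)
  fix x assume x: "x \<in> Rel"
  have "rv (\<lambda>k. rv (\<lambda>k. 0) k - x k) \<in> Rel" by (intro Rel_closed x)
  moreover have "rv (\<lambda>k. rv (\<lambda>k. 0) k - x k) \<oplus>\<^bsub>RM\<^esub> x = \<zero>\<^bsub>RM\<^esub>"
    unfolding RM_ops by (rule rv_cong) simp
  ultimately show "\<exists>y\<in>Rel. y \<oplus>\<^bsub>RM\<^esub> x = \<zero>\<^bsub>RM\<^esub>" by blast
  show "\<zero>\<^bsub>RM\<^esub> \<oplus>\<^bsub>RM\<^esub> x = x"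
    using x by (auto simp: mem_Rel intro!: extensionalityI[of _ "{..<m}"])
qed (auto simp: Rel_closed[simplified] add.assoc add.commute intro!: rv_cong Rel_closed)

lemma K_additive_subgroup: "additive_subgroup K RM"
proof (rule additive_subgroup_if_differences[OF RM_abelian_group K_subset_Rel])
  show "K \<noteq> {}" using K_closed(1) by blast
  fix x y assume xy: "x \<in> K" "y \<in> K"
  then have "x \<in> extensional {..<m}" using K_subset_Rel by (auto simp: mem_Rel)
  then have "rv (\<lambda>k. rv (\<lambda>k. x k - y k) k + y k) = x"
    by (intro extensionalityI[of _ "{..<m}"]) auto
  then show "\<exists>z\<in>K. z \<oplus>\<^bsub>RM\<^esub> y = x" unfolding RM_ops using K_diff[OF xy] by blast
qed

sublocale KR: abelian_subgroup K RM
  by (rule abelian_subgroupI3[OF K_additive_subgroup RM_abelian_group])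

lemma mem_rcls:
  assumes "r \<in> Rel"
  shows "s \<in> rcls r \<longleftrightarrow> s \<in> Rel \<and> rv (\<lambda>k. s k - r k) \<in> K"
proof
  assume "s \<in> rcls r"
  then obtain \<kappa> where k: "\<kappa> \<in> K" "s = rv (\<lambda>k. \<kappa> k + r k)" by (auto simp: a_r_coset_def')
  then have "\<kappa> \<in> Rel" using K_subset_Rel by blast
  then have "\<kappa> \<in> extensional {..<m}" by (simp add: mem_Rel)
  then have "rv (\<lambda>k. s k - r k) = \<kappa>"
    by (intro extensionalityI[of _ "{..<m}"]) (auto simp: k(2))
  then show "s \<in> Rel \<and> rv (\<lambda>k. s k - r k) \<in> K"
    using k Rel_closed(2)[OF \<open>\<kappa> \<in> Rel\<close> assms] by simp
next
  assume s: "s \<in> Rel \<and> rv (\<lambda>k. s k - r k) \<in> K"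
  then have "s = rv (\<lambda>k. rv (\<lambda>k. s k - r k) k + r k)"
    by (intro extensionalityI[of _ "{..<m}"]) (auto simp: mem_Rel)
  then show "s \<in> rcls r" unfolding a_r_coset_def' RM_ops using s by blast
qed

lemma rcls_eq_iff:
  assumes "r \<in> Rel" "s \<in> Rel"
  shows "rcls r = rcls s \<longleftrightarrow> rv (\<lambda>k. r k - s k) \<in> K"
proof
  assume "rcls r = rcls s"
  then have "r \<in> rcls s" using KR.a_rcos_self[OF assms(1)] by simp
  then show "rv (\<lambda>k. r k - s k) \<in> K" using mem_rcls[OF assms(2)] by simp
next
  assume "rv (\<lambda>k. r k - s k) \<in> K"
  then have "r \<in> rcls s" using mem_rcls[OF assms(2)] assms(1) by simp
  then show "rcls r = rcls s" using KR.a_repr_independence'[OF _ assms(2)] by simp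
qed

lemma carrier_RQ: "carrier RQ = rcls ` Rel"
  by (auto simp: rel_quot_def A_RCOSETS_def')

lemma RQ_add: "r \<in> Rel \<Longrightarrow> s \<in> Rel \<Longrightarrow> rcls r \<oplus>\<^bsub>RQ\<^esub> rcls s = rcls (rv (\<lambda>k. r k + s k))"
  using KR.a_rcos_sum[of r s] by (simp add: rel_quot_def)

text \<open>The ideal \<open>I\<close> acts trivially on relations modulo Koszul relations: if \<open>j(r) = 0\<close>, then
  \<open>j(e) r = j(e) r - j(r) e\<close> is a Koszul relation.\<close>

lemma RQ_smult:
  assumes f: "f \<in> P" and r: "r \<in> Rel"
  shows "cls f \<odot>\<^bsub>RQ\<^esub> rcls r = rcls (rv (\<lambda>k. f * r k))"
proof -
  have eq: "rcls (rv (\<lambda>k. f' * r' k)) = rcls (rv (\<lambda>k. f * r k))" if f': "f' \<in> cls f" and r': "r' \<in> rcls r" for f' r'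
  proof -
    have "f' - f \<in> I" using f' by (simp add: mem_cls)
    then have f'P: "f' \<in> P" using I_carrier[of "f' - f"] f poly_ring_closed(3)[of "f' - f" V f] by simp
    have r'': "r' \<in> Rel" "rv (\<lambda>k. r' k - r k) \<in> K" using mem_rcls[OF r] r' by auto
    obtain e where e: "\<forall>k<m. e k \<in> P" "(\<Sum>k<m. e k * g k) = f' - f"
      using \<open>f' - f \<in> I\<close> I_generated by auto
    have "rv e \<in> carrier FM" "r \<in> carrier FM" using e(1) r by (auto simp: mem_FM mem_Rel syzygy_def)
    then have "koszul r (rv e) \<in> K" by (intro koszul_in_K)
    moreover have "koszul r (rv e) = rv (\<lambda>k. (f' - f) * r k)"
      unfolding koszul_def using r e(2) by (intro rv_cong) (simp add: mem_Rel syzygy_def)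
    ultimately have "rv (\<lambda>k. (f' - f) * r k) \<in> K" by simp
    moreover have "rv (\<lambda>k. f' * rv (\<lambda>k. r' k - r k) k) \<in> K" by (intro K_closed f'P r'')
    ultimately have "rv (\<lambda>k. rv (\<lambda>k. f' * rv (\<lambda>k. r' k - r k) k) k + rv (\<lambda>k. (f' - f) * r k) k) \<in> K"
      by (rule K_closed(2)[rotated])
    moreover have "rv (\<lambda>k. rv (\<lambda>k. f' * rv (\<lambda>k. r' k - r k) k) k + rv (\<lambda>k. (f' - f) * r k) k)
        = rv (\<lambda>k. rv (\<lambda>k. f' * r' k) k - rv (\<lambda>k. f * r k) k)"
      by (rule rv_cong) (simp add: algebra_simps)
    ultimately show ?thesis
      using rcls_eq_iff[OF Rel_closed(3)[OF f'P r''(1)] Rel_closed(3)[OF f r]] by simp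
  qed
  have ff: "f \<in> cls f" by (simp add: mem_cls I_closed)
  have rr: "r \<in> rcls r" by (rule KR.a_rcos_self[OF r])
  have "cls f \<odot>\<^bsub>RQ\<^esub> rcls r = (\<Union>f'\<in>cls f. \<Union>r'\<in>rcls r. rcls (rv (\<lambda>k. f' * r' k)))"
    by (simp add: rel_quot_def)
  also have "\<dots> = (\<Union>f'\<in>cls f. \<Union>r'\<in>rcls r. rcls (rv (\<lambda>k. f * r k)))"
    using eq by (intro SUP_cong) auto
  also have "\<dots> = rcls (rv (\<lambda>k. f * r k))" using ff rr by auto
  finally show ?thesis .
qed

text \<open>\<open>Q\<close> chooses polynomial representatives for the values of a homomorphism on the relations modulo
  Koszul relations.\<close>

definition represents :: "((nat \<Rightarrow> cpoly) set \<Rightarrow> cpoly set) \<Rightarrow> ((nat \<Rightarrow> cpoly) \<Rightarrow> cpoly) \<Rightarrow> bool" where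
  "represents \<psi> Q \<longleftrightarrow> \<psi> \<in> extensional (rcls ` Rel) \<and>
     (\<forall>r\<in>Rel. \<psi> (rcls r) = cls (Q r)) \<and> (\<forall>r\<in>Rel. Q r \<in> P) \<and>
     (\<forall>r\<in>Rel. \<forall>s\<in>Rel. Q (rv (\<lambda>k. r k + s k)) - (Q r + Q s) \<in> I) \<and>
     (\<forall>p\<in>P. \<forall>r\<in>Rel. Q (rv (\<lambda>k. p * r k)) - p * Q r \<in> I)"

lemma representsD:
  assumes "represents \<psi> Q"
  shows "\<psi> \<in> extensional (rcls ` Rel)" "r \<in> Rel \<Longrightarrow> \<psi> (rcls r) = cls (Q r)" "r \<in> Rel \<Longrightarrow> Q r \<in> P"
    "r \<in> Rel \<Longrightarrow> s \<in> Rel \<Longrightarrow> Q (rv (\<lambda>k. r k + s k)) - (Q r + Q s) \<in> I"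
    "p \<in> P \<Longrightarrow> r \<in> Rel \<Longrightarrow> Q (rv (\<lambda>k. p * r k)) - p * Q r \<in> I"
  using assms by (auto simp: represents_def)

lemma mem_T2_Hom: "\<psi> \<in> carrier H2 \<longleftrightarrow> (\<exists>Q. represents \<psi> Q)"
proof -
  have "\<psi> \<in> carrier H2 \<longleftrightarrow>
      \<psi> \<in> rcls ` Rel \<rightarrow>\<^sub>E cls ` P \<and>
      (\<forall>r\<in>Rel. \<forall>s\<in>Rel. \<psi> (rcls (rv (\<lambda>k. r k + s k))) = \<psi> (rcls r) \<oplus>\<^bsub>poly_ring V Quot I\<^esub> \<psi> (rcls s)) \<and>
      (\<forall>p\<in>P. \<forall>r\<in>Rel. \<psi> (rcls (rv (\<lambda>k. p * r k))) = cls p \<otimes>\<^bsub>poly_ring V Quot I\<^esub> \<psi> (rcls r))" (is "_ \<longleftrightarrow> ?A")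
    by (simp add: T2_Hom_def Hom_module_def module_homs_def ideal_module_def carrier_RQ carrier_quot RQ_add RQ_smult
        cong: ball_cong)
  also have "\<dots> \<longleftrightarrow> (\<exists>Q. represents \<psi> Q)"
  proof
    assume A: ?A
    then have "\<forall>r\<in>Rel. \<exists>p. p \<in> P \<and> \<psi> (rcls r) = cls p" by (auto simp: PiE_iff)
    then obtain Q where Q: "\<And>r. r \<in> Rel \<Longrightarrow> Q r \<in> P" "\<And>r. r \<in> Rel \<Longrightarrow> \<psi> (rcls r) = cls (Q r)" by metis
    have "Q (rv (\<lambda>k. r k + s k)) - (Q r + Q s) \<in> I" if rs: "r \<in> Rel" "s \<in> Rel" for r s
    proof -
      have "\<psi> (rcls (rv (\<lambda>k. r k + s k))) = \<psi> (rcls r) \<oplus>\<^bsub>poly_ring V Quot I\<^esub> \<psi> (rcls s)" using A rs by blast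
      then show ?thesis using Q rs Rel_closed(2)[OF rs] by (simp add: cls_add cls_eq_iff)
    qed
    moreover have "Q (rv (\<lambda>k. p * r k)) - p * Q r \<in> I" if pr: "p \<in> P" "r \<in> Rel" for p r
    proof -
      have "\<psi> (rcls (rv (\<lambda>k. p * r k))) = cls p \<otimes>\<^bsub>poly_ring V Quot I\<^esub> \<psi> (rcls r)" using A pr by blast
      then show ?thesis using Q pr Rel_closed(3)[OF pr] by (simp add: cls_mult cls_eq_iff)
    qed
    ultimately have "represents \<psi> Q" using A Q by (auto simp: represents_def PiE_iff)
    then show "\<exists>Q. represents \<psi> Q" by blast
  next
    assume "\<exists>Q. represents \<psi> Q"
    then obtain Q where Q: "represents \<psi> Q" by blast
    then show ?A
      by (auto simp: representsD[OF Q] PiE_iff Rel_closed cls_add cls_mult cls_eq_iff)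
  qed
  finally show ?thesis .
qed

lemma represents_Koszul:
  assumes Q: "represents \<psi> Q" and k: "\<kappa> \<in> K"
  shows "Q \<kappa> \<in> I"
proof -
  note z = Rel_closed(1)
  have kR: "\<kappa> \<in> Rel" using k K_subset_Rel by blast
  have "Q (rv (\<lambda>k. rv (\<lambda>k. 0) k + rv (\<lambda>k. 0) k)) - (Q (rv (\<lambda>k. 0)) + Q (rv (\<lambda>k. 0))) \<in> I"
    by (rule representsD(4)[OF Q z z])
  moreover have "rv (\<lambda>k. rv (\<lambda>k. 0) k + rv (\<lambda>k. 0) k) = rv (\<lambda>k. 0)" by (rule rv_cong) simp
  ultimately have Q0: "Q (rv (\<lambda>k. 0)) \<in> I"
    using I_closed(4)[of "- Q (rv (\<lambda>k. 0))"] by simp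
  have "rv (\<lambda>k. \<kappa> k - rv (\<lambda>k. 0) k) = rv \<kappa>" by (rule rv_cong) simp
  then have "rcls \<kappa> = rcls (rv (\<lambda>k. 0))"
    using k kR rcls_eq_iff[OF kR z] by (simp add: mem_Rel)
  then have "cls (Q \<kappa>) = cls (Q (rv (\<lambda>k. 0)))"
    using representsD(2)[OF Q kR] representsD(2)[OF Q z] by simp
  then have "Q \<kappa> - Q (rv (\<lambda>k. 0)) \<in> I" by (simp add: cls_eq_iff)
  from I_closed(2)[OF this Q0] show ?thesis by simp
qed

lemma T2_Hom_abelian_group: "abelian_group H2"
proof -
  interpret Q: cring "poly_ring V Quot I" by (rule quot_ring)
  have "abelian_group (regular_module (poly_ring V Quot I))"
    by (rule abelian_group_cong[OF Q.abelian_group_axioms]) (simp_all add: ideal_module_def)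
  then show ?thesis
    unfolding T2_Hom_def
  proof (rule Hom_module_abelian_group)
    show "C \<oplus>\<^bsub>RQ\<^esub> C' \<in> carrier RQ" if "C \<in> carrier RQ" "C' \<in> carrier RQ" for C C'
      using that Rel_closed by (auto simp: carrier_RQ RQ_add)
    show "a \<odot>\<^bsub>RQ\<^esub> C \<in> carrier RQ" if "a \<in> carrier (poly_ring V Quot I)" "C \<in> carrier RQ" for a C
      using that Rel_closed by (auto simp: carrier_RQ carrier_quot RQ_smult)
  qed (simp_all add: ideal_module_def Q.r_distr)
qed

lemma T2_Hom_add:
  assumes Q: "represents \<psi> Q" and Q': "represents \<psi>' Q'" and r: "r \<in> Rel"
  shows "(\<psi> \<oplus>\<^bsub>H2\<^esub> \<psi>') (rcls r) = cls (Q r + Q' r)"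
  using r by (simp add: T2_Hom_def Hom_module_def carrier_RQ ideal_module_def representsD(2)[OF Q] representsD(2)[OF Q']
      cls_add representsD(3)[OF Q] representsD(3)[OF Q'])

lemma T2_Hom_diff:
  assumes Q: "represents \<psi> Q" and Q': "represents \<psi>' Q'"
  obtains \<psi>'' where "represents \<psi>'' (\<lambda>r. Q r - Q' r)" "\<psi>'' \<oplus>\<^bsub>H2\<^esub> \<psi>' = \<psi>"
proof -
  interpret H: abelian_group "H2" by (rule T2_Hom_abelian_group)
  let ?z = "\<psi> \<ominus>\<^bsub>H2\<^esub> \<psi>'"
  have c: "\<psi> \<in> carrier H2" "\<psi>' \<in> carrier H2"
    using Q Q' mem_T2_Hom by blast+
  then have z: "?z \<oplus>\<^bsub>H2\<^esub> \<psi>' = \<psi>"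
    by (simp add: a_minus_def H.a_assoc H.l_neg)
  have "?z \<in> carrier H2" using c by (rule H.minus_closed)
  then obtain Q'' where Q'': "represents ?z Q''" using mem_T2_Hom by blast
  have "?z (rcls r) = cls (Q r - Q' r)" if r: "r \<in> Rel" for r
  proof -
    have "cls (Q r) = cls (Q'' r + Q' r)"
      using T2_Hom_add[OF Q'' Q' r] representsD(2)[OF Q r] unfolding z by simp
    then have "cls (Q'' r) = cls (Q r - Q' r)"
      using cong_sym[of "Q r" "Q'' r + Q' r"] by (simp add: cls_eq_iff algebra_simps)
    then show ?thesis using representsD(2)[OF Q'' r] by simp
  qed
  moreover have "Q (rv (\<lambda>k. r k + s k)) - Q' (rv (\<lambda>k. r k + s k)) - (Q r - Q' r + (Q s - Q' s)) \<in> I"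
    if "r \<in> Rel" "s \<in> Rel" for r s
    using cong_minus[OF representsD(4)[OF Q that] representsD(4)[OF Q' that]] by (simp add: algebra_simps)
  moreover have "Q (rv (\<lambda>k. p * r k)) - Q' (rv (\<lambda>k. p * r k)) - p * (Q r - Q' r) \<in> I"
    if "p \<in> P" "r \<in> Rel" for p r
    unfolding right_diff_distrib by (rule cong_minus[OF representsD(5)[OF Q that] representsD(5)[OF Q' that]])
  ultimately have "represents ?z (\<lambda>r. Q r - Q' r)"
    using representsD(1)[OF Q''] representsD(3)[OF Q] representsD(3)[OF Q'] by (simp add: represents_def)
  then show thesis using z by (rule that)
qed

text \<open>A homomorphism from the free module to \<open>P/I\<close> sends \<open>j(f) e - j(e) f\<close> to an element of
  \<open>I (P/I) = 0\<close>.\<close>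

lemma combination_of_Koszul:
  assumes b: "\<And>k. k < m \<Longrightarrow> b k \<in> P" and k: "\<kappa> \<in> K"
  shows "(\<Sum>k<m. \<kappa> k * b k) \<in> I"
proof -
  let ?N = "{e \<in> carrier FM. (\<Sum>k<m. e k * b k) \<in> I}"
  have "K \<subseteq> ?N"
  proof (rule K_least)
    show "submodule ?N (poly_ring V) FM"
      unfolding FM_submodule_iff
      by (auto simp: mem_FM distrib_right sum.distrib mult.assoc sum_distrib_left[symmetric] I_closed)
  next
    fix e f assume ef: "e \<in> carrier FM" "f \<in> carrier FM"
    have j: "(\<Sum>i<m. e i * g i) \<in> I" if "e \<in> carrier FM" for e
      unfolding I_generated using that by (auto simp: mem_FM)
    have s: "(\<Sum>i<m. e i * b i) \<in> P" if "e \<in> carrier FM" for e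
      using that b by (auto simp: mem_FM intro!: poly_ring_sum)
    have "(\<Sum>i<m. f i * g i) * (\<Sum>k<m. e k * b k) - (\<Sum>i<m. e i * g i) * (\<Sum>k<m. f k * b k) \<in> I"
      by (intro I_closed j s ef)
    moreover have "(\<Sum>k<m. koszul e f k * b k)
        = (\<Sum>i<m. f i * g i) * (\<Sum>k<m. e k * b k) - (\<Sum>i<m. e i * g i) * (\<Sum>k<m. f k * b k)"
      by (simp add: koszul_def left_diff_distrib sum_subtractf mult.assoc sum_distrib_left[of _ "\<lambda>k. _ k * b k", symmetric])
    moreover have "koszul e f \<in> carrier FM"
      using koszul_in_K[OF ef] K_subset_Rel by (auto simp: mem_Rel mem_FM syzygy_def)
    ultimately show "koszul e f \<in> ?N" by simp
  qed
  then show ?thesis using k by blast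
qed

text \<open>A homomorphism on the free module is constant on the cosets of the Koszul relations.\<close>

lemma the_elem_bound:
  assumes b: "\<And>k. k < m \<Longrightarrow> b k \<in> P" and r: "r \<in> Rel"
    and h: "\<And>e. e \<in> carrier FM \<Longrightarrow> h e = cls (\<Sum>k<m. e k * b k)"
  shows "the_elem (h ` rcls r) = cls (\<Sum>k<m. r k * b k)"
proof -
  have "h s = cls (\<Sum>k<m. r k * b k)" if s: "s \<in> rcls r" for s
  proof -
    have s': "s \<in> Rel" "rv (\<lambda>k. s k - r k) \<in> K" using s mem_rcls[OF r] by auto
    have "(\<Sum>k<m. s k * b k) - (\<Sum>k<m. r k * b k) \<in> I"
      using combination_of_Koszul[OF b s'(2)] by (simp add: left_diff_distrib sum_subtractf)
    moreover have "s \<in> carrier FM" using s'(1) by (auto simp: mem_Rel mem_FM syzygy_def)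
    ultimately show ?thesis using h by (simp add: cls_eq_iff)
  qed
  moreover have "r \<in> rcls r" by (rule KR.a_rcos_self[OF r])
  ultimately have "h ` rcls r = {cls (\<Sum>k<m. r k * b k)}" by blast
  then show ?thesis by simp
qed

lemma free_module_hom:
  assumes h: "h \<in> module_homs (poly_ring V) FM (quot_as_module (poly_ring V) I)"
  obtains b where "\<And>k. k < m \<Longrightarrow> b k \<in> P" "\<And>e. e \<in> carrier FM \<Longrightarrow> h e = cls (\<Sum>k<m. e k * b k)"
proof -
  have hc: "\<And>e. e \<in> carrier FM \<Longrightarrow> h e \<in> cls ` P"
    and ha: "\<And>e f. e \<in> carrier FM \<Longrightarrow> f \<in> carrier FM \<Longrightarrow> h (rv (\<lambda>k. e k + f k)) = h e \<oplus>\<^bsub>poly_ring V Quot I\<^esub> h f"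
    and hm: "\<And>p e. p \<in> P \<Longrightarrow> e \<in> carrier FM \<Longrightarrow> h (rv (\<lambda>k. p * e k)) = cls p \<otimes>\<^bsub>poly_ring V Quot I\<^esub> h e"
    using h by (auto simp: module_homs_def quot_as_module_def carrier_quot)
  define E where "E j = rv (\<lambda>k. if k = j then 1 else 0 :: cpoly)" for j
  have EF: "E j \<in> carrier FM" for j by (auto simp: E_def mem_FM)
  have "\<forall>j. \<exists>p. p \<in> P \<and> h (E j) = cls p" using hc[OF EF] by blast
  then obtain b where b: "\<And>j. b j \<in> P" "\<And>j. h (E j) = cls (b j)" by metis
  have z: "rv (\<lambda>k. 0) \<in> carrier FM" by (simp add: mem_FM)
  have "h e = cls (\<Sum>k<m. e k * b k)" if e: "e \<in> carrier FM" for e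
  proof -
    have ePn: "e k \<in> P" if "k < m" for k using e that by (simp add: mem_FM)
    have "j \<le> m \<Longrightarrow> h (rv (\<lambda>k. if k < j then e k else 0)) = cls (\<Sum>k<j. e k * b k)" for j
    proof (induction j)
      case 0
      obtain p where p: "p \<in> P" "h (rv (\<lambda>k. 0)) = cls p" using hc[OF z] by blast
      have eq: "rv (\<lambda>k. if k < 0 then e k else 0) = rv (\<lambda>k. 0 * rv (\<lambda>k. 0) k)" by (rule rv_cong) simp
      have "h (rv (\<lambda>k. 0 * rv (\<lambda>k. 0) k)) = cls 0 \<otimes>\<^bsub>poly_ring V Quot I\<^esub> cls p"
        unfolding p(2)[symmetric] by (rule hm[OF _ z]) auto
      then show ?case unfolding eq using p(1) by (simp only: cls_mult poly_ring_closed) simp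
    next
      case (Suc j)
      then have j: "j < m" by simp
      have 1: "rv (\<lambda>k. if k < j then e k else 0) \<in> carrier FM" using ePn by (auto simp: mem_FM)
      have 2: "rv (\<lambda>k. e j * E j k) \<in> carrier FM" using ePn[OF j] EF by (auto simp: mem_FM)
      have "rv (\<lambda>k. if k < Suc j then e k else 0)
          = rv (\<lambda>k. rv (\<lambda>k. if k < j then e k else 0) k + rv (\<lambda>k. e j * E j k) k)"
        by (rule rv_cong) (auto simp: E_def less_Suc_eq)
      then have 3: "h (rv (\<lambda>k. if k < Suc j then e k else 0))
          = cls (\<Sum>k<j. e k * b k) \<oplus>\<^bsub>poly_ring V Quot I\<^esub> (cls (e j) \<otimes>\<^bsub>poly_ring V Quot I\<^esub> cls (b j))"
        using ha[OF 1 2] Suc.IH j hm[OF ePn[OF j] EF[of j]] b(2) by simp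
      have "(\<Sum>k<j. e k * b k) \<in> P" using ePn j b(1) by (intro poly_ring_sum) auto
      then have 4: "cls (\<Sum>k<j. e k * b k) \<oplus>\<^bsub>poly_ring V Quot I\<^esub> (cls (e j) \<otimes>\<^bsub>poly_ring V Quot I\<^esub> cls (b j))
          = cls ((\<Sum>k<j. e k * b k) + e j * b j)"
        using ePn[OF j] b(1) by (simp add: cls_mult cls_add)
      show ?case unfolding sum.lessThan_Suc by (rule trans[OF 3 4])
    qed
    from this[of m] have "h (rv (\<lambda>k. if k < m then e k else 0)) = cls (\<Sum>k<m. e k * b k)" by simp
    moreover have "rv (\<lambda>k. if k < m then e k else 0) = rv e" by (rule rv_cong) simp
    ultimately show ?thesis using e by (simp add: mem_FM)
  qed
  then show thesis using b(1) that by blast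
qed

lemma mem_T2_bounds:
  "\<psi> \<in> B2 \<longleftrightarrow> \<psi> \<in> extensional (rcls ` Rel) \<and>
     (\<exists>b. (\<forall>k<m. b k \<in> P) \<and> (\<forall>r\<in>Rel. \<psi> (rcls r) = cls (\<Sum>k<m. r k * b k)))"
proof
  assume "\<psi> \<in> B2"
  then obtain h where h: "h \<in> module_homs (poly_ring V) FM (quot_as_module (poly_ring V) I)"
    "\<psi> = (\<lambda>C\<in>rcls ` Rel. the_elem (h ` C))"
    by (auto simp: T2_bounds_def carrier_RQ)
  obtain b where b: "\<And>k. k < m \<Longrightarrow> b k \<in> P" "\<And>e. e \<in> carrier FM \<Longrightarrow> h e = cls (\<Sum>k<m. e k * b k)"
    using free_module_hom[OF h(1)] by blast
  have "\<forall>r\<in>Rel. \<psi> (rcls r) = cls (\<Sum>k<m. r k * b k)"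
    using the_elem_bound[OF b(1) _ b(2)] by (simp add: h(2))
  then show "\<psi> \<in> extensional (rcls ` Rel) \<and> (\<exists>b. (\<forall>k<m. b k \<in> P) \<and> (\<forall>r\<in>Rel. \<psi> (rcls r) = cls (\<Sum>k<m. r k * b k)))"
    using b(1) h(2) by auto
next
  assume "\<psi> \<in> extensional (rcls ` Rel) \<and> (\<exists>b. (\<forall>k<m. b k \<in> P) \<and> (\<forall>r\<in>Rel. \<psi> (rcls r) = cls (\<Sum>k<m. r k * b k)))"
  then obtain b where ext: "\<psi> \<in> extensional (rcls ` Rel)" and b: "\<And>k. k < m \<Longrightarrow> b k \<in> P"
    "\<And>r. r \<in> Rel \<Longrightarrow> \<psi> (rcls r) = cls (\<Sum>k<m. r k * b k)" by blast
  define h where "h = (\<lambda>e\<in>carrier FM. cls (\<Sum>k<m. e k * b k))"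
  have s: "(\<Sum>k<m. e k * b k) \<in> P" if "e \<in> carrier FM" for e
    using that b(1) by (auto simp: mem_FM intro!: poly_ring_sum)
  have "h \<in> module_homs (poly_ring V) FM (quot_as_module (poly_ring V) I)"
    unfolding module_homs_def
  proof (intro CollectI conjI ballI)
    show "h \<in> carrier FM \<rightarrow>\<^sub>E carrier (quot_as_module (poly_ring V) I)"
      using s by (auto simp: h_def quot_as_module_def carrier_quot)
    fix e assume e: "e \<in> carrier FM"
    show "h (e \<oplus>\<^bsub>FM\<^esub> f) = h e \<oplus>\<^bsub>quot_as_module (poly_ring V) I\<^esub> h f" if f: "f \<in> carrier FM" for f
    proof -
      have "rv (\<lambda>k. e k + f k) \<in> carrier FM" using e f by (auto simp: mem_FM)
      then show ?thesis
        using e f s[OF e] s[OF f] by (simp add: h_def quot_as_module_def cls_add distrib_right sum.distrib)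
    qed
    show "h (p \<odot>\<^bsub>FM\<^esub> e) = p \<odot>\<^bsub>quot_as_module (poly_ring V) I\<^esub> h e" if p: "p \<in> P" for p
    proof -
      have "rv (\<lambda>k. p * e k) \<in> carrier FM" using e p by (auto simp: mem_FM)
      then show ?thesis
        using e p s[OF e] by (simp add: h_def quot_as_module_def cls_mult mult.assoc sum_distrib_left[symmetric])
    qed
  qed
  moreover have "\<psi> = (\<lambda>C\<in>rcls ` Rel. the_elem (h ` C))"
  proof (rule extensionalityI[OF ext])
    fix C assume "C \<in> rcls ` Rel"
    then obtain r where r: "r \<in> Rel" "C = rcls r" by blast
    then show "\<psi> C = (\<lambda>C\<in>rcls ` Rel. the_elem (h ` C)) C"
      using the_elem_bound[OF b(1) r(1), where h = h] b(2)[OF r(1)] by (simp add: h_def)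
  qed simp
  ultimately show "\<psi> \<in> B2"
    by (auto simp: T2_bounds_def carrier_RQ)
qed

lemma combination_represents:
  assumes "\<psi> \<in> extensional (rcls ` Rel)" "\<And>k. k < m \<Longrightarrow> b k \<in> P"
    "\<And>r. r \<in> Rel \<Longrightarrow> \<psi> (rcls r) = cls (\<Sum>k<m. r k * b k)"
  shows "represents \<psi> (\<lambda>r. \<Sum>k<m. r k * b k)"
  using assms
  by (auto simp: represents_def distrib_right sum.distrib mult.assoc sum_distrib_left[symmetric] I_closed
      mem_Rel syzygy_def intro!: poly_ring_sum)

lemma T2_bounds_additive_subgroup: "additive_subgroup B2 H2"
proof (rule additive_subgroup_if_differences[OF T2_Hom_abelian_group])
  show "B2 \<subseteq> carrier H2"
  proof
    fix \<psi> assume "\<psi> \<in> B2"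
    then obtain b where "\<psi> \<in> extensional (rcls ` Rel)" "\<And>k. k < m \<Longrightarrow> b k \<in> P"
      "\<And>r. r \<in> Rel \<Longrightarrow> \<psi> (rcls r) = cls (\<Sum>k<m. r k * b k)"
      unfolding mem_T2_bounds by blast
    from combination_represents[OF this] show "\<psi> \<in> carrier H2"
      unfolding mem_T2_Hom by blast
  qed
  have "(\<lambda>C\<in>rcls ` Rel. cls 0) \<in> B2"
    unfolding mem_T2_bounds by (auto intro!: exI[of _ "\<lambda>k. 0"])
  then show "B2 \<noteq> {}" by blast
next
  fix \<psi> \<psi>' assume \<psi>: "\<psi> \<in> B2" and \<psi>': "\<psi>' \<in> B2"
  obtain b where b: "\<psi> \<in> extensional (rcls ` Rel)" "\<And>k. k < m \<Longrightarrow> b k \<in> P"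
      "\<And>r. r \<in> Rel \<Longrightarrow> \<psi> (rcls r) = cls (\<Sum>k<m. r k * b k)"
    using \<psi> unfolding mem_T2_bounds by blast
  obtain b' where b': "\<psi>' \<in> extensional (rcls ` Rel)" "\<And>k. k < m \<Longrightarrow> b' k \<in> P"
      "\<And>r. r \<in> Rel \<Longrightarrow> \<psi>' (rcls r) = cls (\<Sum>k<m. r k * b' k)"
    using \<psi>' unfolding mem_T2_bounds by blast
  obtain \<psi>'' where z: "represents \<psi>'' (\<lambda>r. (\<Sum>k<m. r k * b k) - (\<Sum>k<m. r k * b' k))"
      "\<psi>'' \<oplus>\<^bsub>H2\<^esub> \<psi>' = \<psi>"
    using T2_Hom_diff[OF combination_represents[OF b] combination_represents[OF b']] .
  have "\<psi>'' \<in> B2"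
    unfolding mem_T2_bounds using representsD(1,2)[OF z(1)] b(2) b'(2)
    by (auto simp: right_diff_distrib sum_subtractf intro!: exI[of _ "\<lambda>k. b k - b' k"])
  then show "\<exists>z\<in>B2. z \<oplus>\<^bsub>H2\<^esub> \<psi>' = \<psi>"
    using z(2) by blast
qed

end

section \<open>Localization of the second cotangent module\<close>

context presented_complex
begin

lemma dehom_vec_eq: "dehom_vec m v e = rv (\<lambda>k. dehom v (e k))"
  by (simp add: dehom_vec_def)

lemma dehom_combination:
  "dehom v (\<Sum>k<m. e k * g k) = (\<Sum>k<m. dehom_vec m v e k * dehom_vec m v g k)"
  by (simp add: dehom_sum dehom_mult dehom_vec_def)

lemma link_presented:
  assumes v: "v \<in> V"
  shows "presented_complex (V - {v}) (link v X) m (dehom_vec m v g)"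
proof -
  interpret L: complex_on "V - {v}" "link v X" by (rule link_complex)
  let ?g = "dehom_vec m v g"
  have gP: "?g k \<in> polys (V - {v})" if "k < m" for k
    using that g_in_P by (simp add: dehom_vec_def dehom_in_poly_ring)
  have gm: "gen_map (poly_ring (V - {v})) m ?g e = (\<Sum>k<m. e k * ?g k)"
    if "\<And>k. k < m \<Longrightarrow> e k \<in> polys (V - {v})" for e
    unfolding gen_map_def using that gP by (subst poly_ring_finsum) auto
  have "gen_map (poly_ring (V - {v})) m ?g ` carrier (free_module (poly_ring (V - {v})) m) = L.I"
  proof (intro equalityI subsetI)
    fix f assume "f \<in> gen_map (poly_ring (V - {v})) m ?g ` carrier (free_module (poly_ring (V - {v})) m)"
    then obtain e where e: "e \<in> carrier (free_module (poly_ring (V - {v})) m)" "f = gen_map (poly_ring (V - {v})) m ?g e"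
      by blast
    have eW: "e k \<in> polys (V - {v})" if "k < m" for k
      using e(1) that by (auto simp: free_module_def)
    then have "(\<Sum>k<m. e k * g k) \<in> I"
      using poly_ring_mono[of "V - {v}" V] unfolding I_generated by blast
    then have "dehom v (\<Sum>k<m. e k * g k) \<in> L.I" by (rule dehom_SR_ideal(1)[OF v])
    moreover have "dehom v (\<Sum>k<m. e k * g k) = f"
      unfolding e(2) gm[of e, OF eW, simplified] dehom_combination
      using dehom_id[OF eW, of _ v] by (intro sum.cong) (auto simp: dehom_vec_def)
    ultimately show "f \<in> L.I" by simp
  next
    fix f assume f: "f \<in> L.I"
    obtain e where e: "\<And>k. k < m \<Longrightarrow> e k \<in> P" "(\<Sum>k<m. e k * g k) = var v * f"
      using dehom_SR_ideal(2)[OF v f] unfolding I_generated by blast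
    have e': "dehom_vec m v e k \<in> polys (V - {v})" if "k < m" for k
      using e(1)[OF that] that by (simp add: dehom_vec_def dehom_in_poly_ring)
    have "f = gen_map (poly_ring (V - {v})) m ?g (dehom_vec m v e)"
      unfolding gm[of "dehom_vec m v e", OF e', simplified] dehom_combination[symmetric] e(2) by (rule dehom_SR_ideal(3)[OF v f, symmetric])
    moreover have "dehom_vec m v e \<in> carrier (free_module (poly_ring (V - {v})) m)"
      using e' by (auto simp: free_module_def dehom_vec_def)
    ultimately show "f \<in> gen_map (poly_ring (V - {v})) m ?g ` carrier (free_module (poly_ring (V - {v})) m)"
      by (rule image_eqI)
  qed
  moreover have "?g ` {..<m} \<subseteq> polys (V - {v})" using gP by auto
  ultimately show ?thesis
    by (intro presented_complex.intro link_complex presented_complex_axioms.intro)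
       (simp add: presents_def)
qed

end

locale presented_complex_chart = presented_complex +
  fixes v
  assumes v: "v \<in> V"

sublocale presented_complex_chart \<subseteq> L: presented_complex "V - {v}" "link v X" m "dehom_vec m v g"
  by (rule link_presented[OF v])

context presented_complex_chart
begin

abbreviation dv :: "(nat \<Rightarrow> cpoly) \<Rightarrow> nat \<Rightarrow> cpoly" where "dv \<equiv> dehom_vec m v"

lemma dv_apply: "k < m \<Longrightarrow> dv e k = dehom v (e k)"
  by (simp add: dehom_vec_def)

lemma dv_rv: "dv (rv e) = rv (\<lambda>k. dehom v (e k))"
  unfolding dehom_vec_eq by (rule rv_cong) simp

lemma dv_FM: "e \<in> carrier FM \<Longrightarrow> dv e \<in> carrier L.FM"
  by (auto simp: mem_FM L.mem_FM dehom_vec_eq dehom_in_poly_ring)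

lemma dv_id: "e \<in> carrier L.FM \<Longrightarrow> dv e = e"
proof (rule extensionalityI[of _ "{..<m}"])
  assume e: "e \<in> carrier L.FM"
  then show "e \<in> extensional {..<m}" by (simp add: L.mem_FM)
  show "dv e k = e k" if "k \<in> {..<m}" for k
    using e that dehom_id[of "e k" "V - {v}" v] by (simp add: L.mem_FM dehom_vec_eq)
qed (simp add: dehom_vec_eq)

lemma L_FM_subset: "e \<in> carrier L.FM \<Longrightarrow> e \<in> carrier FM"
  using poly_ring_mono[of "V - {v}" V] by (auto simp: L.mem_FM mem_FM)

lemma dv_Rel: "r \<in> Rel \<Longrightarrow> dv r \<in> L.Rel"
proof -
  assume r: "r \<in> Rel"
  then have "(\<Sum>k<m. dv r k * dv g k) = 0"
    unfolding dehom_combination[symmetric] by (simp add: mem_Rel syzygy_def)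
  moreover have "dv r \<in> extensional {..<m}" by (simp add: dehom_vec_def)
  moreover have "dv r k \<in> L.P" if "k < m" for k
    using r that by (simp add: mem_Rel syzygy_def dv_apply dehom_in_poly_ring)
  ultimately show ?thesis
    unfolding L.mem_Rel syzygy_def by blast
qed

lemma dv_koszul: "dv (koszul e f) = L.koszul (dv e) (dv f)"
  unfolding koszul_def L.koszul_def dv_rv dehom_minus dehom_mult dehom_combination
  by (rule rv_cong) (simp add: dv_apply)

lemma dv_image_K: "dv ` K = L.K"
proof
  have "submodule {e \<in> carrier FM. dv e \<in> L.K} (poly_ring V) FM"
    unfolding FM_submodule_iff
  proof (intro conjI ballI)
    have "dv (rv (\<lambda>k. 0)) = rv (\<lambda>k. 0)" by (simp add: dv_rv)
    then show "rv (\<lambda>k. 0) \<in> {e \<in> carrier FM. dv e \<in> L.K}"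
      using L.K_closed(1) by (simp add: mem_FM)
  next
    fix x y assume xy: "x \<in> {e \<in> carrier FM. dv e \<in> L.K}" "y \<in> {e \<in> carrier FM. dv e \<in> L.K}"
    have "dv (rv (\<lambda>k. x k + y k)) = rv (\<lambda>k. dv x k + dv y k)"
      unfolding dv_rv by (rule rv_cong) (simp add: dv_apply dehom_add)
    then show "rv (\<lambda>k. x k + y k) \<in> {e \<in> carrier FM. dv e \<in> L.K}"
      using xy L.K_closed(2)[of "dv x" "dv y"] by (auto simp: mem_FM)
  next
    fix p x assume p: "p \<in> P" and x: "x \<in> {e \<in> carrier FM. dv e \<in> L.K}"
    have "dv (rv (\<lambda>k. p * x k)) = rv (\<lambda>k. dehom v p * dv x k)"
      unfolding dv_rv by (rule rv_cong) (simp add: dv_apply dehom_mult)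
    then show "rv (\<lambda>k. p * x k) \<in> {e \<in> carrier FM. dv e \<in> L.K}"
      using x p L.K_closed(3)[OF dehom_in_poly_ring[OF p], of "dv x"] by (auto simp: mem_FM)
  qed auto
  moreover have "koszul e f \<in> {e \<in> carrier FM. dv e \<in> L.K}" if ef: "e \<in> carrier FM" "f \<in> carrier FM" for e f
  proof -
    have "koszul e f \<in> carrier FM"
      using koszul_in_K[OF ef] FM_submodule_closed(1)[OF K_submodule] by blast
    then show ?thesis
      using L.koszul_in_K[OF dv_FM[OF ef(1)] dv_FM[OF ef(2)]] by (simp add: dv_koszul)
  qed
  ultimately show "dv ` K \<subseteq> L.K" using K_least by blast
next
  have KF: "K \<subseteq> carrier FM" by (rule FM_submodule_closed(1)[OF K_submodule])
  have "submodule (dv ` K) (poly_ring (V - {v})) L.FM"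
    unfolding L.FM_submodule_iff
  proof (intro conjI ballI)
    show "dv ` K \<subseteq> carrier L.FM" using KF dv_FM by auto
    have "dv (rv (\<lambda>k. 0)) = rv (\<lambda>k. 0)" by (simp add: dv_rv)
    then show "rv (\<lambda>k. 0) \<in> dv ` K" using K_closed(1) by (metis imageI)
  next
    fix x y assume "x \<in> dv ` K" "y \<in> dv ` K"
    then obtain x' y' where xy: "x' \<in> K" "x = dv x'" "y' \<in> K" "y = dv y'" by blast
    have "rv (\<lambda>k. x k + y k) = dv (rv (\<lambda>k. x' k + y' k))"
      unfolding dv_rv xy by (rule rv_cong) (simp add: dv_apply dehom_add)
    then show "rv (\<lambda>k. x k + y k) \<in> dv ` K" using K_closed(2)[OF xy(1,3)] by blast
  next
    fix p x assume p: "p \<in> L.P" and "x \<in> dv ` K"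
    then obtain x' where x: "x' \<in> K" "x = dv x'" by blast
    have pP: "p \<in> P" using p by (auto intro: poly_ring_mono)
    have "dehom v p = p" using p by (rule dehom_id) simp
    then have "rv (\<lambda>k. p * x k) = dv (rv (\<lambda>k. p * x' k))"
      unfolding dv_rv x by (intro rv_cong) (simp add: dv_apply dehom_mult)
    then show "rv (\<lambda>k. p * x k) \<in> dv ` K" using K_closed(3)[OF pP x(1)] by blast
  qed
  moreover have "L.koszul e f \<in> dv ` K" if ef: "e \<in> carrier L.FM" "f \<in> carrier L.FM" for e f
  proof -
    have "L.koszul e f = dv (koszul e f)" by (simp add: dv_koszul dv_id ef)
    then show ?thesis using koszul_in_K[OF L_FM_subset[OF ef(1)] L_FM_subset[OF ef(2)]] by blast
  qed
  ultimately show "L.K \<subseteq> dv ` K" by (rule L.K_least)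
qed

lemma dv_image_rcls:
  assumes r: "r \<in> Rel"
  shows "dv ` rcls r = L.rcls (dv r)"
proof -
  have "dv (rv (\<lambda>k. \<kappa> k + r k)) = rv (\<lambda>k. dv \<kappa> k + dv r k)" for \<kappa>
    unfolding dv_rv by (rule rv_cong) (simp add: dv_apply dehom_add)
  then have "dv ` rcls r = (\<Union>\<kappa>\<in>K. {rv (\<lambda>k. dv \<kappa> k + dv r k)})"
    by (auto simp: a_r_coset_def' image_iff)
  also have "\<dots> = L.rcls (dv r)"
    unfolding a_r_coset_def' L.RM_ops dv_image_K[symmetric] by auto
  finally show ?thesis .
qed

text \<open>The entries of a relation over the chart are homogenized with \<open>x\<^sub>v\<close> so that each product with a
  generator has the same degree \<open>N\<close>. The resulting combination is homogeneous with dehomogenization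
  0, hence it is 0.\<close>

lemma Rel_lift:
  assumes gh: "\<And>k. k < m \<Longrightarrow> homogeneous (d k) (g k)" and r': "r' \<in> L.Rel"
  obtains r where "r \<in> Rel" "dv r = r'"
proof -
  define N where "N = (\<Sum>k<m. \<Sum>t\<in>keys (r' k). tdeg t + d k)"
  have N: "tdeg t + d k \<le> N" if k: "k < m" and t: "t \<in> keys (r' k)" for k t
  proof -
    have "tdeg t + d k \<le> (\<Sum>t\<in>keys (r' k). tdeg t + d k)"
      using t by (intro member_le_sum[of _ _ "\<lambda>t. tdeg t + d k"]) auto
    also have "\<dots> \<le> N"
      unfolding N_def using k by (intro member_le_sum[of _ _ "\<lambda>k. \<Sum>t\<in>keys (r' k). tdeg t + d k"]) auto
    finally show ?thesis .
  qed
  define r where "r = rv (\<lambda>k. \<Sum>t\<in>keys (r' k).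
      single (t + single v (N - d k - tdeg t)) (lookup (r' k) t))"
  have r'P: "r' k \<in> polys (V - {v})" if "k < m" for k
    using r' that by (simp add: L.mem_Rel syzygy_def)
  have rP: "r k \<in> P" if "k < m" for k
  proof -
    have "keys (t + single v a) \<subseteq> V" if "t \<in> keys (r' k)" for t and a :: nat
    proof -
      have "keys t \<subseteq> V" using r'P[OF \<open>k < m\<close>] that by (auto simp: mem_poly_ring)
      then show ?thesis using v by (simp add: keys_add_exponent)
    qed
    then show ?thesis
      using that by (simp add: r_def poly_ring_sum monomial_in_poly_ring)
  qed
  have dr: "dehom v (r k) = r' k" if k: "k < m" for k
  proof -
    have "dehom v (r k) = (\<Sum>t\<in>keys (r' k).
        single (drop_var v (t + single v (N - d k - tdeg t))) (lookup (r' k) t))"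
      using k by (simp add: r_def dehom_sum dehom_single)
    also have "\<dots> = (\<Sum>t\<in>keys (r' k). single t (lookup (r' k) t))"
    proof (rule sum.cong)
      fix t assume "t \<in> keys (r' k)"
      then have "v \<notin> keys t" using r'P[OF k] by (auto simp: mem_poly_ring)
      then have "drop_var v t = t" by (rule drop_var_idem)
      moreover have "drop_var v (single v a) = 0" for a :: nat
        by (rule poly_mapping_eqI) (simp add: lookup_update lookup_single when_def)
      ultimately show "single (drop_var v (t + single v (N - d k - tdeg t))) (lookup (r' k) t)
          = single t (lookup (r' k) t)"
        by (simp add: drop_var_add)
    qed simp
    finally show ?thesis by (simp add: sum_monomials)
  qed
  have hom: "homogeneous N (r k * g k)" if k: "k < m" for k
  proof (cases "r' k = 0")
    case True
    then show ?thesis using k by (simp add: r_def homogeneous_def)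
  next
    case False
    then obtain t where "t \<in> keys (r' k)"
      by (metis keys_eq_empty ex_in_conv)
    then have dN: "d k \<le> N" using N[OF k] by fastforce
    have "homogeneous (N - d k) (single (t + single v (N - d k - tdeg t)) (lookup (r' k) t))"
      if "t \<in> keys (r' k)" for t
      using N[OF k that] by (simp add: homogeneous_tdeg tdeg_add)
    then have "homogeneous (N - d k) (r k)"
      using k by (simp add: r_def homogeneous_sum)
    from homogeneous_mult[OF this gh[OF k]] show ?thesis using dN by simp
  qed
  have "dehom v (\<Sum>k<m. r k * g k) = (\<Sum>k<m. r' k * dv g k)"
    unfolding dehom_combination using dr by (intro sum.cong) (auto simp: dv_apply)
  also have "\<dots> = 0" using r' by (simp add: L.mem_Rel syzygy_def)
  finally have "dehom v (\<Sum>k<m. r k * g k) = 0" .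
  moreover have "homogeneous N (\<Sum>k<m. r k * g k)" by (intro homogeneous_sum hom) simp
  ultimately have "(\<Sum>k<m. r k * g k) = 0" using dehom_homogeneous_eq_0 by blast
  then have "r \<in> Rel" using rP by (simp add: mem_Rel syzygy_def) (simp add: r_def)
  moreover have "dv r = r'"
  proof (rule extensionalityI[of _ "{..<m}"])
    show "dv r \<in> extensional {..<m}" by (simp add: dehom_vec_def)
    show "r' \<in> extensional {..<m}" using r' unfolding L.mem_Rel by blast
  qed (simp add: dv_apply dr)
  ultimately show thesis by (rule that)
qed

text \<open>Entry by entry, \<open>e\<close> is a multiple of \<open>x\<^sub>v - 1\<close>, and since this polynomial is not a zero divisor,
  the quotient is again a relation.\<close>

lemma represents_dehom_kernel:
  assumes Q: "represents \<psi> Q" and e: "e \<in> Rel" "dv e = rv (\<lambda>k. 0)"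
  shows "dehom v (Q e) \<in> L.I"
proof -
  have eP: "e k \<in> P" "dehom v (e k) = 0" if k: "k < m" for k
  proof -
    show "e k \<in> P" using e(1) k by (simp add: mem_Rel syzygy_def)
    have "dv e k = 0" unfolding e(2) using k by simp
    then show "dehom v (e k) = 0" using k by (simp add: dv_apply)
  qed
  have "\<exists>G\<in>P. e k = (var v - 1) * G" if "k < m" for k
    using dehom_kernel_poly[OF v eP[OF that]] by metis
  then obtain G where G: "\<And>k. k < m \<Longrightarrow> G k \<in> P" "\<And>k. k < m \<Longrightarrow> e k = (var v - 1) * G k"
    by metis
  have "(var v - 1) * (\<Sum>k<m. G k * g k) = (\<Sum>k<m. e k * g k)"
    unfolding sum_distrib_left using G(2) by (intro sum.cong) (auto simp: mult.assoc)
  also have "\<dots> = 0" using e(1) by (simp add: mem_Rel syzygy_def)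
  finally have z: "(var v - 1) * (\<Sum>k<m. G k * g k) = 0" .
  have "var v \<noteq> (1 :: cpoly)"
  proof
    assume "var v = (1 :: cpoly)"
    then have "keys (var v) = keys (1 :: cpoly)" by simp
    then have "single v (1::nat) = 0" by (simp add: var_def)
    then show False by (metis lookup_single_eq lookup_zero zero_neq_one)
  qed
  with z have "(\<Sum>k<m. G k * g k) = 0" by simp
  then have GR: "rv G \<in> Rel" using G(1) by (simp add: mem_Rel syzygy_def)
  have c: "var v - 1 \<in> P" using v by (auto simp: var_in_poly_ring)
  have "rv (\<lambda>k. (var v - 1) * rv G k) = e"
    using e(1) G(2) by (intro extensionalityI[of _ "{..<m}"]) (auto simp: mem_Rel)
  then have "Q e - (var v - 1) * Q (rv G) \<in> I"
    using representsD(5)[OF Q c GR] by simp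
  then have "dehom v (Q e - (var v - 1) * Q (rv G)) \<in> L.I" by (rule dehom_SR_ideal(1)[OF v])
  then show ?thesis by (simp add: dehom_minus dehom_mult)
qed

text \<open>Relations with congruent dehomogenizations differ by a Koszul relation and a relation that
  dehomogenizes to 0.\<close>

lemma represents_dehom:
  assumes Q: "represents \<psi> Q" and r: "r \<in> Rel" "s \<in> Rel" and eq: "L.rcls (dv r) = L.rcls (dv s)"
  shows "dehom v (Q r) - dehom v (Q s) \<in> L.I"
proof -
  have "rv (\<lambda>k. dv r k - dv s k) \<in> dv ` K"
    using eq unfolding dv_image_K L.rcls_eq_iff[OF dv_Rel[OF r(1)] dv_Rel[OF r(2)]] .
  then obtain \<kappa> where k: "\<kappa> \<in> K" "dv \<kappa> = rv (\<lambda>k. dv r k - dv s k)"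
    by (elim imageE) simp
  have kR: "\<kappa> \<in> Rel" using k K_subset_Rel by blast
  define q where "q = rv (\<lambda>k. s k + \<kappa> k)"
  define e where "e = rv (\<lambda>k. r k - q k)"
  have qR: "q \<in> Rel" unfolding q_def by (intro Rel_closed r kR)
  have eR: "e \<in> Rel" unfolding e_def by (intro Rel_closed r qR)
  have "dv e = rv (\<lambda>k. 0)"
    unfolding e_def dv_rv
  proof (rule rv_cong)
    fix j assume j: "j < m"
    have "dehom v (\<kappa> j) = dehom v (r j) - dehom v (s j)"
      using fun_cong[OF k(2), of j] j by (simp add: dv_apply)
    then show "dehom v (r j - q j) = 0" using j by (simp add: q_def dehom_minus dehom_add)
  qed
  then have A: "dehom v (Q e) \<in> L.I" by (rule represents_dehom_kernel[OF Q eR])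
  have "rv (\<lambda>k. e k + q k) = r"
    using r by (intro extensionalityI[of _ "{..<m}"]) (auto simp: e_def mem_Rel)
  then have "Q r - (Q e + Q q) \<in> I" using representsD(4)[OF Q eR qR] by simp
  then have B: "dehom v (Q r) - (dehom v (Q e) + dehom v (Q q)) \<in> L.I"
    using dehom_SR_ideal(1)[OF v] by (metis dehom_minus dehom_add)
  have "Q q - (Q s + Q \<kappa>) \<in> I" unfolding q_def by (rule representsD(4)[OF Q r(2) kR])
  from I_closed(2)[OF this represents_Koszul[OF Q k(1)]] have "Q q - Q s \<in> I" by simp
  then have C: "dehom v (Q q) - dehom v (Q s) \<in> L.I"
    using dehom_SR_ideal(1)[OF v] by (metis dehom_minus)
  show ?thesis
    using L.I_closed(2)[OF L.I_closed(2)[OF A B] C] by simp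
qed

lemma T2_loc_hom_eq:
  assumes Q: "represents \<psi> Q" and r: "r \<in> Rel"
  shows "T2_loc_hom V v m g \<psi> (L.rcls (dv r)) = L.cls (dehom v (Q r))"
proof -
  let ?S = "{B \<in> carrier RQ. dv ` B = L.rcls (dv r)}"
  have "dehom v ` \<psi> B = L.cls (dehom v (Q r))" if B: "B \<in> ?S" for B
  proof -
    obtain s where s: "s \<in> Rel" "B = rcls s" using B by (auto simp: carrier_RQ)
    then have "L.rcls (dv s) = L.rcls (dv r)" using B dv_image_rcls by auto
    then have "dehom v (Q s) - dehom v (Q r) \<in> L.I" by (rule represents_dehom[OF Q s(1) r])
    then show ?thesis
      using s representsD(2)[OF Q s(1)] dehom_cls[OF v] by (simp add: L.cls_eq_iff)
  qed
  moreover have "rcls r \<in> ?S" using r by (simp add: carrier_RQ dv_image_rcls)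
  ultimately have "(\<lambda>B. dehom v ` \<psi> B) ` ?S = {L.cls (dehom v (Q r))}" by blast
  moreover have "L.rcls (dv r) \<in> carrier L.RQ" using dv_Rel[OF r] by (simp add: L.carrier_RQ)
  ultimately show ?thesis by (simp add: T2_loc_hom_def)
qed

lemma T2_loc_hom_extensional: "T2_loc_hom V v m g \<psi> \<in> extensional (L.rcls ` L.Rel)"
  by (simp add: T2_loc_hom_def L.carrier_RQ)

text \<open>The localized homomorphism is represented by choosing a homogenized lift of each relation over
  the chart; the choice is immaterial modulo the ideal of the link.\<close>

lemma T2_loc_hom_closed:
  assumes gh: "\<And>k. k < m \<Longrightarrow> homogeneous (d k) (g k)" and Q: "represents \<psi> Q"
  obtains Q' where "L.represents (T2_loc_hom V v m g \<psi>) Q'" "\<And>r. r \<in> Rel \<Longrightarrow> dehom v (Q r) - Q' (dv r) \<in> L.I"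
proof -
  have "\<forall>r'\<in>L.Rel. \<exists>r. r \<in> Rel \<and> dv r = r'" using Rel_lift[OF gh] by metis
  then obtain l where l: "\<And>r'. r' \<in> L.Rel \<Longrightarrow> l r' \<in> Rel" "\<And>r'. r' \<in> L.Rel \<Longrightarrow> dv (l r') = r'"
    by metis
  define Q' where "Q' r' = dehom v (Q (l r'))" for r'
  have wd: "dehom v (Q r) - Q' (dv r) \<in> L.I" if r: "r \<in> Rel" for r
    unfolding Q'_def using l[OF dv_Rel[OF r]] r by (intro represents_dehom[OF Q]) auto
  have "L.represents (T2_loc_hom V v m g \<psi>) Q'"
    unfolding L.represents_def
  proof (intro conjI ballI T2_loc_hom_extensional)
    fix r' assume r': "r' \<in> L.Rel"
    show "T2_loc_hom V v m g \<psi> (L.rcls r') = L.cls (Q' r')"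
      using T2_loc_hom_eq[OF Q l(1)[OF r']] l(2)[OF r'] by (simp add: Q'_def)
    show "Q' r' \<in> L.P"
      unfolding Q'_def by (intro dehom_in_poly_ring representsD(3)[OF Q] l r')
    show "Q' (rv (\<lambda>k. r' k + s' k)) - (Q' r' + Q' s') \<in> L.I" if s': "s' \<in> L.Rel" for s'
    proof -
      let ?r = "rv (\<lambda>k. l r' k + l s' k)"
      have R: "?r \<in> Rel" by (intro Rel_closed l r' s')
      have "dv ?r = rv (\<lambda>k. dv (l r') k + dv (l s') k)"
        unfolding dv_rv by (rule rv_cong) (simp add: dv_apply dehom_add)
      then have "dv ?r = rv (\<lambda>k. r' k + s' k)" by (simp add: l r' s')
      then have 1: "dehom v (Q ?r) - Q' (rv (\<lambda>k. r' k + s' k)) \<in> L.I" using wd[OF R] by simp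
      have "dehom v (Q ?r - (Q (l r') + Q (l s'))) \<in> L.I"
        by (intro dehom_SR_ideal(1)[OF v] representsD(4)[OF Q] l r' s')
      then have "dehom v (Q ?r) - (Q' r' + Q' s') \<in> L.I" by (simp add: Q'_def dehom_minus dehom_add)
      with 1 show ?thesis using L.cong_trans L.cong_sym by blast
    qed
    show "Q' (rv (\<lambda>k. p * r' k)) - p * Q' r' \<in> L.I" if p: "p \<in> L.P" for p
    proof -
      let ?r = "rv (\<lambda>k. p * l r' k)"
      have pP: "p \<in> P" using p by (auto intro: poly_ring_mono)
      have dp: "dehom v p = p" using p by (rule dehom_id) simp
      have R: "?r \<in> Rel" by (intro Rel_closed l r' pP)
      have "dv ?r = rv (\<lambda>k. p * dv (l r') k)"
        unfolding dv_rv by (rule rv_cong) (simp add: dv_apply dehom_mult dp)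
      then have "dv ?r = rv (\<lambda>k. p * r' k)" by (simp add: l r')
      then have 1: "dehom v (Q ?r) - Q' (rv (\<lambda>k. p * r' k)) \<in> L.I" using wd[OF R] by simp
      have "dehom v (Q ?r - p * Q (l r')) \<in> L.I"
        by (intro dehom_SR_ideal(1)[OF v] representsD(5)[OF Q] l r' pP)
      then have "dehom v (Q ?r) - p * Q' r' \<in> L.I" by (simp add: Q'_def dehom_minus dehom_mult dp)
      with 1 show ?thesis using L.cong_trans L.cong_sym by blast
    qed
  qed
  then show thesis using wd by (rule that)
qed

end

context presented_complex
begin

theorem T2_localization_injective:
  assumes gh: "\<And>k. k < m \<Longrightarrow> homogeneous (d k) (g k)"
  shows "(\<lambda>t. \<lambda>v\<in>V. T2_loc V X m g v t) \<in> mon (T2_deg0 V I m g d) (sum_group V (\<lambda>v. T2_chart V X m g v))"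
proof -
  let ?Z = "{\<psi> \<in> carrier H2. \<forall>c. \<forall>r\<in>Rel. homogeneous_vec m d c r \<longrightarrow>
      quot_homogeneous V I c (\<psi> (rcls r))}"
  let ?J = "\<lambda>v. SR_ideal (V - {v}) (link v X)" and ?W = "\<lambda>v. poly_ring (V - {v})" and ?g = "\<lambda>v. dehom_vec m v g"
  have chart: "presented_complex_chart V X m g v" if "v \<in> V" for v
    by (intro presented_complex_chart.intro presented_complex_axioms presented_complex_chart_axioms.intro that)
  have "(\<lambda>t. \<lambda>v\<in>V. the_elem ((\<lambda>\<psi>. T2_bounds (?W v) (?J v) m (?g v)
            +>\<^bsub>T2_Hom (?W v) (?J v) m (?g v)\<^esub> T2_loc_hom V v m g \<psi>) ` t))
    \<in> mon ((H2 A_Mod B2)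
            \<lparr>carrier := {B2 +>\<^bsub>H2\<^esub> \<psi> |\<psi>. \<psi> \<in> ?Z}\<rparr>)
        (sum_group V (\<lambda>v. T2_Hom (?W v) (?J v) m (?g v) A_Mod T2_bounds (?W v) (?J v) m (?g v)))"
  proof (rule coset_family_mon[OF T2_Hom_abelian_group T2_bounds_additive_subgroup])
    show "abelian_group (T2_Hom (?W v) (?J v) m (?g v))" if "v \<in> V" for v
      by (rule presented_complex.T2_Hom_abelian_group[OF link_presented[OF that]])
    show "additive_subgroup (T2_bounds (?W v) (?J v) m (?g v)) (T2_Hom (?W v) (?J v) m (?g v))" if "v \<in> V" for v
      by (rule presented_complex.T2_bounds_additive_subgroup[OF link_presented[OF that]])
  next
    fix v \<psi> assume v: "v \<in> V" and "\<psi> \<in> carrier H2"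
    then obtain Q where Q: "represents \<psi> Q" using mem_T2_Hom by blast
    interpret C: presented_complex_chart V X m g v by (rule chart[OF v])
    show "T2_loc_hom V v m g \<psi> \<in> carrier (T2_Hom (?W v) (?J v) m (?g v))"
      using C.T2_loc_hom_closed[OF gh Q] C.L.mem_T2_Hom by metis
  next
    fix v \<psi> \<psi>' assume v: "v \<in> V"
      and \<psi>: "\<psi> \<in> carrier H2" and \<psi>': "\<psi>' \<in> carrier H2"
    interpret C: presented_complex_chart V X m g v by (rule chart[OF v])
    interpret H: abelian_group "H2" by (rule T2_Hom_abelian_group)
    interpret HL: abelian_group "T2_Hom (?W v) (?J v) m (?g v)" by (rule C.L.T2_Hom_abelian_group)
    let ?l = "T2_loc_hom V v m g"
    let ?s = "\<psi> \<oplus>\<^bsub>H2\<^esub> \<psi>'"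
    have "?s \<in> carrier H2" using \<psi> \<psi>' by (rule H.a_closed)
    then obtain Q Q' Q'' where Q: "represents \<psi> Q" and Q': "represents \<psi>' Q'" and Q'': "represents ?s Q''"
      using \<psi> \<psi>' mem_T2_Hom by metis
    obtain R where R: "C.L.represents (?l \<psi>) R" "\<And>r. r \<in> Rel \<Longrightarrow> dehom v (Q r) - R (C.dv r) \<in> C.L.I"
      using C.T2_loc_hom_closed[OF gh Q] by metis
    obtain R' where R': "C.L.represents (?l \<psi>') R'" "\<And>r. r \<in> Rel \<Longrightarrow> dehom v (Q' r) - R' (C.dv r) \<in> C.L.I"
      using C.T2_loc_hom_closed[OF gh Q'] by metis
    have "?l \<psi> \<oplus>\<^bsub>T2_Hom (?W v) (?J v) m (?g v)\<^esub> ?l \<psi>' \<in> carrier (T2_Hom (?W v) (?J v) m (?g v))"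
      using R(1) R'(1) C.L.mem_T2_Hom by (intro HL.a_closed) blast+
    then have ext: "?l \<psi> \<oplus>\<^bsub>T2_Hom (?W v) (?J v) m (?g v)\<^esub> ?l \<psi>' \<in> extensional (C.L.rcls ` C.L.Rel)"
      using C.L.mem_T2_Hom C.L.representsD(1) by blast
    show "?l ?s = ?l \<psi> \<oplus>\<^bsub>T2_Hom (?W v) (?J v) m (?g v)\<^esub> ?l \<psi>'"
    proof (rule extensionalityI[OF C.T2_loc_hom_extensional ext])
      fix A assume "A \<in> C.L.rcls ` C.L.Rel"
      then obtain r' where r': "r' \<in> C.L.Rel" "A = C.L.rcls r'" by blast
      obtain r where r: "r \<in> Rel" "C.dv r = r'" using C.Rel_lift[OF gh r'(1)] by blast
      have "cls (Q'' r) = cls (Q r + Q' r)"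
        using T2_Hom_add[OF Q Q' r(1)] representsD(2)[OF Q'' r(1)] by simp
      then have "dehom v (Q'' r - (Q r + Q' r)) \<in> C.L.I"
        by (intro dehom_SR_ideal(1)[OF v]) (simp add: cls_eq_iff)
      then have "dehom v (Q'' r) - (dehom v (Q r) + dehom v (Q' r)) \<in> C.L.I"
        by (simp add: dehom_minus dehom_add)
      from C.L.cong_trans[OF this C.L.cong_add[OF R(2)[OF r(1)] R'(2)[OF r(1)]]]
      have "C.L.cls (dehom v (Q'' r)) = C.L.cls (R r' + R' r')" by (simp add: C.L.cls_eq_iff r(2))
      then show "?l ?s A = (?l \<psi> \<oplus>\<^bsub>T2_Hom (?W v) (?J v) m (?g v)\<^esub> ?l \<psi>') A"
        using C.T2_loc_hom_eq[OF Q'' r(1)] C.L.T2_Hom_add[OF R(1) R'(1) r'(1)] by (simp add: r'(2) r(2))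
    qed
  next
    fix v \<psi> assume v: "v \<in> V" and \<psi>: "\<psi> \<in> B2"
    interpret C: presented_complex_chart V X m g v by (rule chart[OF v])
    obtain b where b: "\<psi> \<in> extensional (rcls ` Rel)" "\<And>k. k < m \<Longrightarrow> b k \<in> P"
      "\<And>r. r \<in> Rel \<Longrightarrow> \<psi> (rcls r) = cls (\<Sum>k<m. r k * b k)"
      using \<psi> unfolding mem_T2_bounds by blast
    note Q = combination_represents[OF b]
    have "T2_loc_hom V v m g \<psi> (C.L.rcls r') = C.L.cls (\<Sum>k<m. r' k * dehom v (b k))" if r': "r' \<in> C.L.Rel" for r'
    proof -
      obtain r where r: "r \<in> Rel" "C.dv r = r'" using C.Rel_lift[OF gh r'] by blast
      have "dehom v (\<Sum>k<m. r k * b k) = (\<Sum>k<m. r' k * dehom v (b k))"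
        by (simp add: dehom_sum dehom_mult r(2)[symmetric] C.dv_apply)
      then show ?thesis using C.T2_loc_hom_eq[OF Q r(1)] by (simp add: r(2))
    qed
    then show "T2_loc_hom V v m g \<psi> \<in> T2_bounds (?W v) (?J v) m (?g v)"
      unfolding C.L.mem_T2_bounds using b(2)
      by (intro conjI C.T2_loc_hom_extensional exI[of _ "\<lambda>k. dehom v (b k)"]) (simp_all add: dehom_in_poly_ring)
  next
    fix \<psi> \<psi>' assume z: "\<psi> \<in> ?Z" "\<psi>' \<in> ?Z"
    then obtain Q Q' where Q: "represents \<psi> Q" and Q': "represents \<psi>' Q'" using mem_T2_Hom by blast
    obtain \<psi>'' where d: "represents \<psi>'' (\<lambda>r. Q r - Q' r)" "\<psi>'' \<oplus>\<^bsub>H2\<^esub> \<psi>' = \<psi>"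
      using T2_Hom_diff[OF Q Q'] .
    have "quot_homogeneous V I c (\<psi>'' (rcls r))" if r: "r \<in> Rel" "homogeneous_vec m d c r" for c r
    proof -
      have "quot_homogeneous V I c (cls (Q r))" "quot_homogeneous V I c (cls (Q' r))"
        using z r by (simp_all add: representsD(2)[OF Q] representsD(2)[OF Q'])
      then obtain h h' where "h \<in> P" "homogeneous c h" "Q r - h \<in> I" "h' \<in> P" "homogeneous c h'" "Q' r - h' \<in> I"
        unfolding quot_homogeneous_cls by blast
      then show ?thesis
        unfolding representsD(2)[OF d(1) r(1)] quot_homogeneous_cls
        by (intro bexI[of _ "h - h'"] conjI homogeneous_minus cong_minus) auto
    qed
    then have "\<psi>'' \<in> ?Z" using d(1) mem_T2_Hom by blast
    then show "\<exists>z\<in>?Z. z \<oplus>\<^bsub>H2\<^esub> \<psi>' = \<psi>" using d(2) by blast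
  next
    fix \<psi> assume z: "\<psi> \<in> ?Z"
      and loc: "\<And>v. v \<in> V \<Longrightarrow> T2_loc_hom V v m g \<psi> \<in> T2_bounds (?W v) (?J v) m (?g v)"
    then obtain Q where Q: "represents \<psi> Q" using mem_T2_Hom by blast
    have rvR: "rv e \<in> Rel" if "syzygy V m g e" for e using that by (simp add: mem_Rel syzygy_def)
    interpret G: degree_zero_syzygy_hom V X m g d "\<lambda>e. Q (rv e)"
    proof
      show "g k \<in> I" "homogeneous (d k) (g k)" if "k < m" for k using that g_in_I gh by auto
      show "\<exists>e. (\<forall>k<m. e k \<in> P) \<and> (\<Sum>k<m. e k * g k) = f" if "f \<in> I" for f
        using that by (simp add: I_generated)
      show "Q (rv e) \<in> P" if "syzygy V m g e" for e using representsD(3)[OF Q rvR[OF that]] .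
      show "Q (rv e) = Q (rv e')" if "\<And>k. k < m \<Longrightarrow> e k = e' k" for e e'
        using that rv_cong by metis
      show "Q (rv (\<lambda>k. e k + e' k)) - (Q (rv e) + Q (rv e')) \<in> I" if "syzygy V m g e" "syzygy V m g e'" for e e'
      proof -
        have "rv (\<lambda>k. rv e k + rv e' k) = rv (\<lambda>k. e k + e' k)" by (rule rv_cong) simp
        then show ?thesis using representsD(4)[OF Q rvR[OF that(1)] rvR[OF that(2)]] by simp
      qed
      show "Q (rv (\<lambda>k. p * e k)) - p * Q (rv e) \<in> I" if "p \<in> P" "syzygy V m g e" for p e
      proof -
        have "rv (\<lambda>k. p * rv e k) = rv (\<lambda>k. p * e k)" by (rule rv_cong) simp
        then show ?thesis using representsD(5)[OF Q that(1) rvR[OF that(2)]] by simp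
      qed
      show "\<exists>h. homogeneous c h \<and> Q (rv e) - h \<in> I" if e: "syzygy V m g e" "homogeneous_vec m d c e" for c e
      proof -
        have "homogeneous_vec m d c (rv e)" using e(2) by (simp add: homogeneous_vec_def)
        then have "quot_homogeneous V I c (\<psi> (rcls (rv e)))"
          using z rvR[OF e(1)] by blast
        then have "quot_homogeneous V I c (cls (Q (rv e)))"
          unfolding representsD(2)[OF Q rvR[OF e(1)]] .
        then show ?thesis unfolding quot_homogeneous_cls by blast
      qed
      fix v assume v: "v \<in> V"
      interpret C: presented_complex_chart V X m g v by (rule chart[OF v])
      obtain b where b: "\<forall>k<m. b k \<in> C.L.P"
        "\<And>r'. r' \<in> C.L.Rel \<Longrightarrow> T2_loc_hom V v m g \<psi> (C.L.rcls r') = C.L.cls (\<Sum>k<m. r' k * b k)"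
        using loc[OF v] unfolding C.L.mem_T2_bounds by blast
      have "dehom v (Q (rv e)) - (\<Sum>k<m. dehom v (e k) * b k) \<in> C.L.I" if e: "syzygy V m g e" for e
      proof -
        have "(\<Sum>k<m. C.dv (rv e) k * b k) = (\<Sum>k<m. dehom v (e k) * b k)"
          by (rule sum.cong) (auto simp: C.dv_apply)
        then have "C.L.cls (dehom v (Q (rv e))) = C.L.cls (\<Sum>k<m. dehom v (e k) * b k)"
          using b(2)[OF C.dv_Rel[OF rvR[OF e]]] C.T2_loc_hom_eq[OF Q rvR[OF e]] by simp
        then show ?thesis by (simp add: C.L.cls_eq_iff)
      qed
      then show "\<exists>b. (\<forall>k<m. b k \<in> C.L.P) \<and>
          (\<forall>e. syzygy V m g e \<longrightarrow> dehom v (Q (rv e)) - (\<Sum>k<m. dehom v (e k) * b k) \<in> C.L.I)"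
        using b(1) by blast
    qed
    obtain b where b: "\<forall>k<m. b k \<in> P" "\<And>e. syzygy V m g e \<Longrightarrow> Q (rv e) - (\<Sum>k<m. e k * b k) \<in> I"
      using G.glue_extensions by blast
    have "\<psi> (rcls r) = cls (\<Sum>k<m. r k * b k)" if r: "r \<in> Rel" for r
      using b(2)[of r] r representsD(2)[OF Q r] by (simp add: mem_Rel cls_eq_iff)
    then show "\<psi> \<in> B2"
      unfolding mem_T2_bounds using b(1) representsD(1)[OF Q] by blast
  qed (use finV in auto)
  then show ?thesis
    by (simp add: T2_loc_def[abs_def] T2_deg0_def T2_chart_def T2_def Let_def conj_ac)
qed

end

theorem theorem15:
  fixes n :: nat and X :: "nat set set"
  assumes "simplicial_complex {0..n} X"
  shows "(\<lambda>t. \<lambda>v\<in>{0..n}. T1_loc {0..n} X v t)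
           \<in> mon (T1_deg0 {0..n} (SR_ideal {0..n} X))
                 (sum_group {0..n} (\<lambda>v. T1_chart {0..n} X v)) \<and>
         (\<forall>m (g :: nat \<Rightarrow> cpoly) (d :: nat \<Rightarrow> nat).
            presents (poly_ring {0..n}) (SR_ideal {0..n} X) m g \<and> (\<forall>k<m. homogeneous (d k) (g k))
            \<longrightarrow> (\<lambda>t. \<lambda>v\<in>{0..n}. T2_loc {0..n} X m g v t)
                  \<in> mon (T2_deg0 {0..n} (SR_ideal {0..n} X) m g d)
                        (sum_group {0..n} (\<lambda>v. T2_chart {0..n} X m g v)))"
  proof (intro conjI allI impI)
  interpret complex_on "{0..n}" X
    using assms by unfold_locales (auto simp: simplicial_complex_def)
  show "(\<lambda>t. \<lambda>v\<in>{0..n}. T1_loc {0..n} X v t)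
      \<in> mon (T1_deg0 {0..n} (SR_ideal {0..n} X)) (sum_group {0..n} (\<lambda>v. T1_chart {0..n} X v))"
    by (rule T1_localization_injective)
  fix m and g :: "nat \<Rightarrow> cpoly" and d :: "nat \<Rightarrow> nat"
  assume pres: "presents (poly_ring {0..n}) (SR_ideal {0..n} X) m g \<and> (\<forall>k<m. homogeneous (d k) (g k))"
  then have gh: "homogeneous (d k) (g k)" if "k < m" for k using that by blast
  interpret presented_complex "{0..n}" X m g
    using pres by unfold_locales simp
  show "(\<lambda>t. \<lambda>v\<in>{0..n}. T2_loc {0..n} X m g v t)
      \<in> mon (T2_deg0 {0..n} (SR_ideal {0..n} X) m g d) (sum_group {0..n} (\<lambda>v. T2_chart {0..n} X m g v))"
    by (rule T2_localization_injective[OF gh])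
qed

end
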